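(* Let $\mathfrak{g}$ be a six-dimensional real Lie algebra. Then $\mathfrak{g}$ is $(2,3)$-trivial if and only if one of the following holds: (i) $\mathfrak{g}$ is an indecomposable Lie algebra with five-dimensional non-Abelian nilradical and $h^2(\mathfrak{g})=h^3(\mathfrak{g})=0$; or (ii) the nilradical $\mathfrak{n}$ of $\mathfrak{g}$ is isomorphic to the Abelian Lie algebra $\mathbb{R}^5$ and, for an arbitrary $v\in\mathfrak{g}\setminus\mathfrak{n}$, the induced endomorphism $\operatorname{ad}(v)|_{\Lambda^i\mathfrak{n}}$ of $\Lambda^i\mathfrak{n}$ has trivial kernel for $i=1,2,3$.
   Context: All Lie algebras are finite-dimensional over $\mathbb{R}$. $H^k(\mathfrak{g})$ denotes the Lie algebra (Chevalley--Eilenberg) cohomology with trivial real coefficients and $h^k(\mathfrak{g}):=\dim H^k(\mathfrak{g})$. A Lie algebra $\mathfrak{g}$ is called $(2,3)$-trivial if $H^2(\mathfrak{g})=0$ and $H^3(\mathfrak{g})=0$. A Lie algebra is indecomposable if it is not a direct sum of two non-zero ideals. The nilradical is the largest nilpotent ideal. For an ideal $\mathfrak{n}$ and $v\in\mathfrak{g}$, the endomorphism $\operatorname{ad}(v)|_{\mathfrak{n}}$ is extended to $\Lambda^i\mathfrak{n}$ as a derivation: $x_1\wedge\dots\wedge x_i\mapsto\sum_j x_1\wedge\dots\wedge[v,x_j]\wedge\dots\wedge x_i$. *)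

theory Defs
  imports "HOL-Analysis.Analysis" "HOL-Library.Function_Algebras"
begin

section \<open>Spaces of functions and quotient spaces\<close>

instantiation "fun" :: (type, real_vector) real_vector
begin

definition scaleR_fun :: "real \<Rightarrow> ('a \<Rightarrow> 'b) \<Rightarrow> 'a \<Rightarrow> 'b"
  where "scaleR_fun c f = (\<lambda>x. c *\<^sub>R f x)"

instance
  by standard (auto simp: scaleR_fun_def plus_fun_def fun_eq_iff scaleR_add_right scaleR_add_left)

end

text \<open>
  For subspaces \<open>W \<subseteq> V\<close>, the quotient \<open>V / W\<close> is the set of cosets of \<open>W\<close> in \<open>V\<close>;
  its zero element is the coset \<open>W\<close>.
\<close>

definition quotient_rel :: "'a::real_vector set \<Rightarrow> 'a set \<Rightarrow> ('a \<times> 'a) set"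
  where "quotient_rel V W = {(x, y). x \<in> V \<and> y \<in> V \<and> x - y \<in> W}"

definition quotient_space :: "'a::real_vector set \<Rightarrow> 'a set \<Rightarrow> 'a set set"
  where "quotient_space V W = V // quotient_rel V W"

text \<open>
  The dimension of \<open>V / W\<close> is the number \<open>n\<close> of elements of a (finite) basis: the classes of
  \<open>z 0, \<dots>, z (n - 1)\<close> form a basis if every element of \<open>V / W\<close> is the class of
  \<open>\<Sum>i<n. a i *\<^sub>R z i\<close> for exactly one coefficient vector \<open>a\<close>.
\<close>

definition quotient_dim :: "'a::real_vector set \<Rightarrow> 'a set \<Rightarrow> nat"
  where "quotient_dim V W =
    (THE n. \<exists>z :: nat \<Rightarrow> 'a. (\<forall>i<n. z i \<in> V) \<and>
       (\<forall>C \<in> quotient_space V W.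
          \<exists>!a :: nat \<Rightarrow> real. (\<forall>i\<ge>n. a i = 0) \<and> (\<Sum>i<n. a i *\<^sub>R z i) \<in> C))"

text \<open>The map \<open>V / W \<rightarrow> V / W\<close> induced by a linear map \<open>V \<rightarrow> V\<close> that preserves \<open>W\<close>.\<close>

definition quotient_map :: "'a::real_vector set \<Rightarrow> 'a set \<Rightarrow> ('a \<Rightarrow> 'a) \<Rightarrow> 'a set \<Rightarrow> 'a set"
  where "quotient_map V W D C = (\<Union>u\<in>C. quotient_rel V W `` {D u})"


section \<open>Lie algebras\<close>

locale lie_algebra =
  fixes bracket :: "'a::real_vector \<Rightarrow> 'a \<Rightarrow> 'a"
  assumes bilinear_bracket: "bilinear bracket"
    and bracket_self: "bracket x x = 0"
    and jacobi: "bracket x (bracket y z) + bracket y (bracket z x) + bracket z (bracket x y) = 0"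

definition lie_ideal :: "('a::real_vector \<Rightarrow> 'a \<Rightarrow> 'a) \<Rightarrow> 'a set \<Rightarrow> bool"
  where "lie_ideal br I \<longleftrightarrow> subspace I \<and> (\<forall>x. \<forall>y\<in>I. br x y \<in> I)"

definition indecomposable :: "('a::real_vector \<Rightarrow> 'a \<Rightarrow> 'a) \<Rightarrow> bool"
  where "indecomposable br \<longleftrightarrow>
    \<not> (\<exists>I J. lie_ideal br I \<and> lie_ideal br J \<and> I \<noteq> {0} \<and> J \<noteq> {0} \<and>
             I \<inter> J = {0} \<and> {x + y |x y. x \<in> I \<and> y \<in> J} = UNIV)"

definition abelian_on :: "('a::real_vector \<Rightarrow> 'a \<Rightarrow> 'a) \<Rightarrow> 'a set \<Rightarrow> bool"
  where "abelian_on br S \<longleftrightarrow> (\<forall>x\<in>S. \<forall>y\<in>S. br x y = 0)"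

primrec lower_central :: "('a::real_vector \<Rightarrow> 'a \<Rightarrow> 'a) \<Rightarrow> 'a set \<Rightarrow> nat \<Rightarrow> 'a set"
  where
    "lower_central br S 0 = S"
  | "lower_central br S (Suc m) = span {br x y |x y. x \<in> S \<and> y \<in> lower_central br S m}"

definition nilpotent_on :: "('a::real_vector \<Rightarrow> 'a \<Rightarrow> 'a) \<Rightarrow> 'a set \<Rightarrow> bool"
  where "nilpotent_on br S \<longleftrightarrow> (\<exists>m. lower_central br S m = {0})"

text \<open>\<open>GREATEST\<close> refers to the inclusion order on sets.\<close>

definition nilradical :: "('a::real_vector \<Rightarrow> 'a \<Rightarrow> 'a) \<Rightarrow> 'a set"
  where "nilradical br = (GREATEST N. lie_ideal br N \<and> nilpotent_on br N)"

definition lie_isomorphic ::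
    "('a::real_vector \<Rightarrow> 'a \<Rightarrow> 'a) \<Rightarrow> 'a set \<Rightarrow> ('b::real_vector \<Rightarrow> 'b \<Rightarrow> 'b) \<Rightarrow> 'b set \<Rightarrow> bool"
  where "lie_isomorphic br S br' T \<longleftrightarrow>
    (\<exists>\<phi>. bij_betw \<phi> S T \<and>
         (\<forall>x\<in>S. \<forall>y\<in>S. \<phi> (x + y) = \<phi> x + \<phi> y) \<and>
         (\<forall>c. \<forall>x\<in>S. \<phi> (c *\<^sub>R x) = c *\<^sub>R \<phi> x) \<and>
         (\<forall>x\<in>S. \<forall>y\<in>S. \<phi> (br x y) = br' (\<phi> x) (\<phi> y)))"


section \<open>Chevalley--Eilenberg cohomology with trivial real coefficients\<close>

text \<open>
  A \<open>k\<close>-cochain is an alternating \<open>k\<close>-linear form.  Its argument tuples are lists of length \<open>k\<close>,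
  and it takes the value \<open>0\<close> on lists of any other length.
\<close>

definition cochains :: "nat \<Rightarrow> ('a::real_vector list \<Rightarrow> real) set"
  where "cochains k =
    {f. (\<forall>xs. length xs \<noteq> k \<longrightarrow> f xs = 0) \<and>
        (\<forall>xs i. length xs = k \<and> i < k \<longrightarrow> linear (\<lambda>x. f (xs[i := x]))) \<and>
        (\<forall>xs. length xs = k \<and> \<not> distinct xs \<longrightarrow> f xs = 0)}"

text \<open>
  \<open>(d f)(x\<^sub>0, \<dots>, x\<^sub>k) = \<Sum>i<j. (-1)\<^bsup>i+j\<^esup> f([x\<^sub>i, x\<^sub>j], x\<^sub>0, \<dots>, x\<^sub>k)\<close>, where \<open>x\<^sub>i\<close> and \<open>x\<^sub>j\<close> are
  omitted from the trailing arguments.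
\<close>

definition ce_d ::
    "('a::real_vector \<Rightarrow> 'a \<Rightarrow> 'a) \<Rightarrow> ('a list \<Rightarrow> real) \<Rightarrow> 'a list \<Rightarrow> real"
  where "ce_d br f xs =
    (\<Sum>j<length xs. \<Sum>i<j. (-1) ^ (i + j) * f (br (xs ! i) (xs ! j) # nths xs (- {i, j})))"

definition cocycles :: "('a::real_vector \<Rightarrow> 'a \<Rightarrow> 'a) \<Rightarrow> nat \<Rightarrow> ('a list \<Rightarrow> real) set"
  where "cocycles br k = {f \<in> cochains k. ce_d br f = 0}"

definition coboundaries :: "('a::real_vector \<Rightarrow> 'a \<Rightarrow> 'a) \<Rightarrow> nat \<Rightarrow> ('a list \<Rightarrow> real) set"
  where "coboundaries br k = (case k of 0 \<Rightarrow> {0} | Suc m \<Rightarrow> ce_d br ` cochains m)"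

definition cohomology :: "('a::real_vector \<Rightarrow> 'a \<Rightarrow> 'a) \<Rightarrow> nat \<Rightarrow> ('a list \<Rightarrow> real) set set"
  where "cohomology br k = quotient_space (cocycles br k) (coboundaries br k)"

definition cohomology_dim :: "('a::real_vector \<Rightarrow> 'a \<Rightarrow> 'a) \<Rightarrow> nat \<Rightarrow> nat"
  where "cohomology_dim br k = quotient_dim (cocycles br k) (coboundaries br k)"

text \<open>\<open>H\<^sup>k = 0\<close>: the only cohomology class is the zero class.\<close>

definition trivial_cohomology :: "('a::real_vector \<Rightarrow> 'a \<Rightarrow> 'a) \<Rightarrow> nat \<Rightarrow> bool"
  where "trivial_cohomology br k \<longleftrightarrow> cohomology br k = {coboundaries br k}"

definition two_three_trivial :: "('a::real_vector \<Rightarrow> 'a \<Rightarrow> 'a) \<Rightarrow> bool"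
  where "two_three_trivial br \<longleftrightarrow> trivial_cohomology br 2 \<and> trivial_cohomology br 3"


section \<open>Exterior powers of a subspace\<close>

text \<open>
  \<open>\<Lambda>\<^sup>i V\<close> is the quotient of the free vector space on \<open>V\<^sup>i\<close> (finitely supported real functions on
  lists of length \<open>i\<close> over \<open>V\<close>) by the relations that make \<open>(x\<^sub>1, \<dots>, x\<^sub>i)\<close>, read as
  \<open>x\<^sub>1 \<and> \<dots> \<and> x\<^sub>i\<close>, multilinear and alternating.
\<close>

definition generator :: "'a list \<Rightarrow> 'a list \<Rightarrow> real"
  where "generator xs = (\<lambda>ys. if ys = xs then 1 else 0)"

definition tuples :: "'a set \<Rightarrow> nat \<Rightarrow> 'a list set"
  where "tuples V i = {xs. set xs \<subseteq> V \<and> length xs = i}"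

definition ext_free :: "'a::real_vector set \<Rightarrow> nat \<Rightarrow> ('a list \<Rightarrow> real) set"
  where "ext_free V i = span (generator ` tuples V i)"

definition ext_relations :: "'a::real_vector set \<Rightarrow> nat \<Rightarrow> ('a list \<Rightarrow> real) set"
  where "ext_relations V i = span
    ({generator (xs[j := x + y]) - generator (xs[j := x]) - generator (xs[j := y]) |xs j x y.
        xs \<in> tuples V i \<and> j < i \<and> x \<in> V \<and> y \<in> V} \<union>
     {generator (xs[j := c *\<^sub>R x]) - c *\<^sub>R generator (xs[j := x]) |xs j c x.
        xs \<in> tuples V i \<and> j < i \<and> x \<in> V} \<union>
     {generator xs |xs. xs \<in> tuples V i \<and> \<not> distinct xs})"

definition ext_power :: "'a::real_vector set \<Rightarrow> nat \<Rightarrow> ('a list \<Rightarrow> real) set set"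
  where "ext_power V i = quotient_space (ext_free V i) (ext_relations V i)"

text \<open>
  For an endomorphism \<open>T\<close> of \<open>V\<close>, the linear extension to the free vector space of
  \<open>(x\<^sub>1, \<dots>, x\<^sub>i) \<mapsto> \<Sum>j. (x\<^sub>1, \<dots>, T x\<^sub>j, \<dots>, x\<^sub>i)\<close>, and the map it induces on \<open>\<Lambda>\<^sup>i V\<close>.
\<close>

definition free_derivation :: "('a \<Rightarrow> 'a) \<Rightarrow> ('a list \<Rightarrow> real) \<Rightarrow> 'a list \<Rightarrow> real"
  where "free_derivation T u =
    (\<Sum>xs | u xs \<noteq> 0. u xs *\<^sub>R (\<Sum>j<length xs. generator (xs[j := T (xs ! j)])))"

definition ext_derivation ::
    "'a::real_vector set \<Rightarrow> nat \<Rightarrow> ('a \<Rightarrow> 'a) \<Rightarrow> ('a list \<Rightarrow> real) set \<Rightarrow> ('a list \<Rightarrow> real) set"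
  where "ext_derivation V i T = quotient_map (ext_free V i) (ext_relations V i) (free_derivation T)"

definition ext_kernel ::
    "'a::real_vector set \<Rightarrow> nat \<Rightarrow> ('a \<Rightarrow> 'a) \<Rightarrow> ('a list \<Rightarrow> real) set set"
  where "ext_kernel V i T = {C \<in> ext_power V i. ext_derivation V i T C = ext_relations V i}"

end

(*
  Let g be (2,3)-trivial of dimension six and k = [g, g].

  If g = k, then g is unimodular, so the exact 3-forms and the closed 3-forms annihilate each other
  under the wedge pairing of 3-forms. As H^3 = 0, the exact 3-forms have dimension 10; but d is injective
  on 1-forms, so their dimension is at most 15 - 6 = 9.

  For g distinct from k, exactness of a ^ b, with a a closed 1-form and b closed on the kernel of a,
  shows that k has codimension one. If g were not solvable, the derived series would end in a perfect
  ideal P of dimension 3, 4 or 5. The trace form of g on P gives the closed 3-form tr([x, y] z), and its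
  exactness contradicts Cartan's criterion for P. Hence g is solvable, k is nilpotent, and k is the nilradical.
  Since dim g/k = 1 and k is nilpotent, g is indecomposable.

  If k is Abelian and v is not in k, write i-forms as b + a ^ c with a(v) = 1 and b, c forms on k. The
  differential maps b to -a ^ (v b), so H^i = 0 means that the derivation v is invertible on the
  (i-1)-forms and the i-forms on k, which is dual to the condition on the exterior powers of k.
*)
theory Submission
  imports "Jordan_Normal_Form.Jordan_Normal_Form_Existence" Defs
begin

hide_const (open) VectorSpace.subspace

text \<open>A Levi decomposition is avoided. The perfect ideal P at the end of the derived series
  need not be semisimple, so the argument passes to the radical q of its trace form. P / q is
  perfect and nonzero, hence of dimension at least 3, and dim P \<le> 5 leaves dim q \<le> 2.
  Perfect algebras act with trace zero, so a radical of dimension at most one is central in P, and a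
  trace computation excludes central radicals. A noncentral plane q is excluded by the trace form of
  the adjoint action on q instead, which P / q sees as the natural module of sl(2).

  The theorems of Lie and Cartan rest on one fact on complex matrices. Conjugate the eigenvalues in
  the semisimple part of M to get E. Then E commutes with whatever commutes with M, is a derivation
  of each product of which M is one, and tr(M E) is the sum of the squared moduli of the
  eigenvalues. Thus a single vanishing trace makes M nilpotent, although the ground field is real
  and the eigenvalues are not.\<close>

section \<open>Linear algebra\<close>

text \<open>
  The vectors \<open>b i\<close> represent a basis of \<open>V / U\<close>, and the linear functionals \<open>\<xi> i\<close> induce its dual basis.
\<close>

definition rel_coords ::
    "'a::real_vector set \<Rightarrow> 'a set \<Rightarrow> nat \<Rightarrow> (nat \<Rightarrow> 'a) \<Rightarrow> (nat \<Rightarrow> 'a \<Rightarrow> real) \<Rightarrow> bool"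
  where "rel_coords V U n b \<xi> \<longleftrightarrow>
    subspace V \<and> subspace U \<and> U \<subseteq> V \<and> (\<forall>i<n. b i \<in> V) \<and> (\<forall>i<n. linear (\<xi> i)) \<and>
    (\<forall>i<n. \<forall>x\<in>U. \<xi> i x = 0) \<and> (\<forall>i<n. \<forall>j<n. \<xi> i (b j) = (if i = j then 1 else 0)) \<and>
    (\<forall>x\<in>V. x - (\<Sum>i<n. \<xi> i x *\<^sub>R b i) \<in> U)"

text \<open>For \<open>rel_coords V U n b \<xi>\<close> and T preserving V and U, this is the trace
  of the endomorphism that T induces on V / U.\<close>

definition ctrace :: "nat \<Rightarrow> (nat \<Rightarrow> 'a) \<Rightarrow> (nat \<Rightarrow> 'a \<Rightarrow> real) \<Rightarrow> ('a \<Rightarrow> 'a) \<Rightarrow> real"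
  where "ctrace n b \<xi> T = (\<Sum>i<n. \<xi> i (T (b i)))"

lemma finite_independent_in_span:
  fixes A :: "'a::real_vector set"
  assumes "independent A" "A \<subseteq> span F" "finite F"
  shows "finite A"
  using real_vector.independent_span_bound[OF assms(3,1,2)] by simp

text \<open>A basis A of U is extended to a basis B of V, and b enumerates B - A. Finiteness is
  assumed of V and not of the type, because V will also be a space of cochains inside an
  infinite-dimensional function space.\<close>

lemma rel_coords_exists:
  fixes V U :: "'a::real_vector set"
  assumes "subspace V" "subspace U" "U \<subseteq> V" "V \<subseteq> span F" "finite F"
  obtains n b \<xi> where "rel_coords V U n b \<xi>" "dim V = dim U + n"
proof -
  obtain A where A: "A \<subseteq> U" "independent A" "U \<subseteq> span A"
    using real_vector.maximal_independent_subset by blast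
  obtain B where B: "A \<subseteq> B" "B \<subseteq> V" "independent B" "V \<subseteq> span B"
    using real_vector.maximal_independent_subset_extend[of A V] A assms(3) by blast
  have finB: "finite B"
    using finite_independent_in_span[OF B(3) _ assms(5)] B(2) assms(4) by blast
  define n where "n = card (B - A)"
  have "finite (B - A)" using finB by simp
  then obtain b where b: "bij_betw b {..<n} (B - A)"
    unfolding n_def lessThan_atLeast0 using ex_bij_betw_nat_finite[of "B - A"] by blast
  have "\<exists>g. linear g \<and> (\<forall>x\<in>B. g x = (if x = b i then 1 else (0::real)))" for i
    using linear_independent_extend[OF B(3), of "\<lambda>x. if x = b i then 1 else (0::real)"] .
  then obtain \<xi> where \<xi>: "\<And>i. linear (\<xi> i)" "\<And>i x. x \<in> B \<Longrightarrow> \<xi> i x = (if x = b i then 1 else (0::real))"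
    by metis
  have bB: "b i \<in> B - A" if "i < n" for i using b that by (auto simp: bij_betw_def)
  have U: "U = span A"
    using A assms(2) by (simp add: real_vector.span_minimal subset_antisym)
  have V: "V = span B"
    using B assms(1) by (simp add: real_vector.span_minimal subset_antisym)
  have zero: "\<xi> i x = 0" if "i < n" "x \<in> U" for i x
  proof (rule linear_eq_0_on_span[of "\<xi> i" A])
    show "linear (\<xi> i)" by fact
    show "x \<in> span A" using that U by simp
    show "\<And>y. y \<in> A \<Longrightarrow> \<xi> i y = 0" using \<xi>(2) bB[OF that(1)] B(1) by auto
  qed
  have dual: "\<xi> i (b j) = (if i = j then 1 else 0)" if "i < n" "j < n" for i j
    using \<xi>(2)[of "b j" i] bB[OF that(2)] b that by (auto simp: bij_betw_def inj_on_def)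
  have dec: "x - (\<Sum>i<n. \<xi> i x *\<^sub>R b i) \<in> U" if "x \<in> V" for x
  proof -
    define f where "f x = x - (\<Sum>i<n. \<xi> i x *\<^sub>R b i)" for x
    have lin: "linear f"
      unfolding f_def
      by (rule linearI) (simp_all add: linear_add[OF \<xi>(1)] linear_cmul[OF \<xi>(1)] scaleR_left_distrib
          sum.distrib scaleR_right_diff_distrib scaleR_sum_right)
    have "x \<in> span B" using that V by simp
    then have "f x \<in> U"
    proof (induction rule: real_vector.span_induct_alt)
      case base
      then show ?case using assms(2) by (simp add: linear_0[OF lin] real_vector.subspace_0)
    next
      case (step c y z)
      have "f y \<in> U"
      proof (cases "y \<in> A")
        case True
        then have "\<xi> i y = 0" if "i < n" for i using zero[OF that] A(1) by auto
        then show ?thesis using True A(1) by (auto simp: f_def)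
      next
        case False
        then obtain j where j: "j < n" "y = b j" using b step(1) by (auto simp: bij_betw_def)
        have "(\<Sum>i<n. \<xi> i y *\<^sub>R b i) = (\<Sum>i<n. (if i = j then b i else 0))"
          using j dual by (intro sum.cong) auto
        then show ?thesis using j assms(2) by (simp add: f_def real_vector.subspace_0)
      qed
      then show ?case using step(2) assms(2)
        by (simp add: linear_add[OF lin] linear_cmul[OF lin] real_vector.subspace_add real_vector.subspace_scale)
    qed
    then show ?thesis by (simp add: f_def)
  qed
  have "rel_coords V U n b \<xi>"
    unfolding rel_coords_def using assms \<xi>(1) zero dual dec bB B(2) by blast
  moreover have "dim V = dim U + n"
    unfolding U V n_def
    using real_vector.dim_span_eq_card_independent[OF A(2)] real_vector.dim_span_eq_card_independent[OF B(3)]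
      B(1) finB by (simp add: card_Diff_subset finite_subset card_mono)
  ultimately show thesis by (rule that)
qed

section \<open>Traces on a subquotient\<close>

lemma ctrace_comm:
  assumes rc: "rel_coords V U n b \<xi>"
    and S: "linear S" "S ` V \<subseteq> V" "S ` U \<subseteq> U"
    and T: "linear T" "T ` V \<subseteq> V" "T ` U \<subseteq> U"
  shows "ctrace n b \<xi> (\<lambda>x. S (T x)) = ctrace n b \<xi> (\<lambda>x. T (S x))"
proof -
  have *: "\<xi> i (S (T (b i))) = (\<Sum>j<n. \<xi> j (T (b i)) * \<xi> i (S (b j)))"
    if S: "linear S" "S ` V \<subseteq> V" "S ` U \<subseteq> U" and T: "linear T" "T ` V \<subseteq> V" "T ` U \<subseteq> U" and i: "i < n" for S T i
  proof -
    have l: "linear (\<lambda>x. \<xi> i (S x))"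
      using rc i S(1) linear_compose[of S "\<xi> i"] unfolding rel_coords_def o_def by blast
    have "T (b i) \<in> V" using rc i T unfolding rel_coords_def by blast
    then have "T (b i) - (\<Sum>j<n. \<xi> j (T (b i)) *\<^sub>R b j) \<in> U" using rc unfolding rel_coords_def by blast
    then have "\<xi> i (S (T (b i) - (\<Sum>j<n. \<xi> j (T (b i)) *\<^sub>R b j))) = 0"
      using rc S i unfolding rel_coords_def by blast
    then show ?thesis
      by (simp add: linear_diff[OF l] linear_sum[OF l] linear_cmul[OF l])
  qed
  show ?thesis
    unfolding ctrace_def using *[OF S T] *[OF T S]
    apply simp
    apply (subst sum.swap)
    by (simp add: mult.commute)
qed

lemma ctrace_add: "rel_coords V U n b \<xi> \<Longrightarrow> ctrace n b \<xi> (\<lambda>x. S x + T x) = ctrace n b \<xi> S + ctrace n b \<xi> T"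
  unfolding ctrace_def rel_coords_def sum.distrib[symmetric] by (intro sum.cong) (auto simp: linear_add)

lemma ctrace_diff: "rel_coords V U n b \<xi> \<Longrightarrow> ctrace n b \<xi> (\<lambda>x. S x - T x) = ctrace n b \<xi> S - ctrace n b \<xi> T"
  unfolding ctrace_def rel_coords_def sum_subtractf[symmetric] by (intro sum.cong) (auto simp: linear_diff)

lemma ctrace_scale: "rel_coords V U n b \<xi> \<Longrightarrow> ctrace n b \<xi> (\<lambda>x. c *\<^sub>R S x) = c * ctrace n b \<xi> S"
  unfolding ctrace_def rel_coords_def sum_distrib_left by (intro sum.cong) (auto simp: linear_cmul)

lemma ctrace_cong:
  "rel_coords V U n b \<xi> \<Longrightarrow> (\<And>x. x \<in> V \<Longrightarrow> S x - T x \<in> U) \<Longrightarrow> ctrace n b \<xi> S = ctrace n b \<xi> T"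
proof -
  assume rc: "rel_coords V U n b \<xi>" and d: "\<And>x. x \<in> V \<Longrightarrow> S x - T x \<in> U"
  have "\<xi> i (S (b i)) = \<xi> i (T (b i))" if "i < n" for i
  proof -
    have "\<xi> i (S (b i) - T (b i)) = 0" using rc d that unfolding rel_coords_def by blast
    then show ?thesis using rc that unfolding rel_coords_def by (simp add: linear_diff)
  qed
  then show ?thesis unfolding ctrace_def by simp
qed

text \<open>The common kernel of r functionals has codimension at most r. In the induction a vector
  w killed by the first r functionals but not by \<open>f r\<close> is moved into T; if there is
  none, the last functional imposes no new condition.\<close>

lemma independent_card_le_functionals:
  fixes E T :: "'a::real_vector set" and f :: "nat \<Rightarrow> 'a \<Rightarrow> real"
  assumes "independent E" "finite T"
    and "\<And>i. i < r \<Longrightarrow> linear (f i)"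
    and "\<And>x. x \<in> span E \<Longrightarrow> (\<And>i. i < r \<Longrightarrow> f i x = 0) \<Longrightarrow> x \<in> span T"
  shows "card E \<le> r + card T \<and> finite E"
  using assms(2-)
proof (induction r arbitrary: T)
  case 0
  then have "E \<subseteq> span T" using real_vector.span_base by fastforce
  then show ?case using real_vector.independent_span_bound[OF 0(1) assms(1)] by simp
next
  case (Suc r)
  show ?case
  proof (cases "\<exists>w\<in>span E. (\<forall>i<r. f i w = 0) \<and> f r w \<noteq> 0")
    case False
    have "card E \<le> r + card T \<and> finite E"
      using Suc.prems False by (intro Suc.IH) (auto simp: less_Suc_eq)
    then show ?thesis by simp
  next
    case True
    then obtain w where w: "w \<in> span E" "\<forall>i<r. f i w = 0" "f r w \<noteq> 0" by blast
    have "card E \<le> r + card (insert w T) \<and> finite E"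
    proof (rule Suc.IH)
      show "finite (insert w T)" using Suc.prems by simp
      show "\<And>i. i < r \<Longrightarrow> linear (f i)" using Suc.prems by simp
      fix x assume x: "x \<in> span E" "\<And>i. i < r \<Longrightarrow> f i x = 0"
      define c where "c = f r x / f r w"
      have "x - c *\<^sub>R w \<in> span T"
      proof (rule Suc.prems(3))
        show "x - c *\<^sub>R w \<in> span E" using x w by (simp add: real_vector.span_diff real_vector.span_scale)
        fix i assume i: "i < Suc r"
        have "linear (f i)" using Suc.prems i by simp
        then show "f i (x - c *\<^sub>R w) = 0"
          using i x(2) w by (cases "i = r") (auto simp: linear_diff linear_cmul c_def less_Suc_eq)
      qed
      then have "x - c *\<^sub>R w \<in> span (insert w T)" by (meson in_mono real_vector.span_mono subset_insertI)
      moreover have "c *\<^sub>R w \<in> span (insert w T)" by (simp add: real_vector.span_base real_vector.span_scale)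
      ultimately have "x - c *\<^sub>R w + c *\<^sub>R w \<in> span (insert w T)" by (rule real_vector.span_add)
      then show "x \<in> span (insert w T)" by simp
    qed
    moreover have "card (insert w T) \<le> Suc (card T)" using Suc.prems(1) by (simp add: card_insert_if)
    ultimately show ?thesis by simp
  qed
qed

section \<open>Lie algebras and Engel's theorem\<close>

context lie_algebra
begin

lemma linear_br: "linear (bracket x)" and linear_br_left: "linear (\<lambda>x. bracket x y)"
  using bilinear_bracket unfolding bilinear_def by auto

lemmas br_add = linear_add[OF linear_br] linear_add[OF linear_br_left]
lemmas br_diff = linear_diff[OF linear_br] linear_diff[OF linear_br_left]
lemmas br_scale = linear_cmul[OF linear_br] linear_cmul[OF linear_br_left]
lemmas br_minus = linear_neg[OF linear_br] linear_neg[OF linear_br_left]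
lemmas br_zero = linear_0[OF linear_br] linear_0[OF linear_br_left]
lemmas br_sum = linear_sum[OF linear_br] linear_sum[OF linear_br_left]

lemma br_skew: "bracket x y = - bracket y x"
proof -
  have "bracket (x + y) (x + y) = bracket x y + bracket y x"
    unfolding br_add by (simp add: bracket_self)
  then have "bracket x y + bracket y x = 0" by (simp only: bracket_self)
  then show ?thesis by (simp add: eq_neg_iff_add_eq_0)
qed

lemma br_jacobi: "bracket x (bracket y z) = bracket (bracket x y) z + bracket y (bracket x z)"
proof -
  have "bracket x (bracket y z) - bracket y (bracket x z) - bracket (bracket x y) z = 0"
    using jacobi[of x y z] br_skew[of z x] br_skew[of z "bracket x y"] by (simp add: br_minus)
  then show ?thesis by (simp add: algebra_simps)
qed

definition bracket_span :: "'a set \<Rightarrow> 'a set \<Rightarrow> 'a set"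
  where "bracket_span A B = span {bracket x y |x y. x \<in> A \<and> y \<in> B}"

lemma bracket_in_span: "x \<in> A \<Longrightarrow> y \<in> B \<Longrightarrow> bracket x y \<in> bracket_span A B"
  unfolding bracket_span_def by (rule real_vector.span_base) blast

lemma bracket_span_minimal:
  assumes "subspace C" "\<And>x y. x \<in> A \<Longrightarrow> y \<in> B \<Longrightarrow> bracket x y \<in> C"
  shows "bracket_span A B \<subseteq> C"
  unfolding bracket_span_def using assms by (intro real_vector.span_minimal) auto

lemma subspace_bracket_span [simp]: "subspace (bracket_span A B)"
  unfolding bracket_span_def by simp

definition subalgebra :: "'a set \<Rightarrow> bool"
  where "subalgebra L \<longleftrightarrow> subspace L \<and> (\<forall>x\<in>L. \<forall>y\<in>L. bracket x y \<in> L)"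

lemma lie_ideal_bracket_span:
  assumes "lie_ideal bracket I" "lie_ideal bracket J"
  shows "lie_ideal bracket (bracket_span I J)"
proof -
  have "bracket x y \<in> bracket_span I J" if "y \<in> bracket_span I J" for x y
    using that unfolding bracket_span_def
  proof (induction rule: real_vector.span_induct_alt)
    case base
    then show ?case by (simp add: br_zero real_vector.span_zero)
  next
    case (step c u v)
    then obtain a d where "u = bracket a d" "a \<in> I" "d \<in> J" by blast
    moreover have "bracket x a \<in> I" "bracket x d \<in> J"
      using assms calculation unfolding lie_ideal_def by auto
    ultimately have "bracket x u \<in> bracket_span I J"
      unfolding \<open>u = bracket a d\<close> br_jacobi[of x] using \<open>a \<in> I\<close> \<open>d \<in> J\<close>
      by (intro real_vector.subspace_add[OF subspace_bracket_span] bracket_in_span) auto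
    then show ?case using step(2) unfolding bracket_span_def
      by (simp add: br_add br_scale real_vector.span_add real_vector.span_scale)
  qed
  then show ?thesis unfolding lie_ideal_def by simp
qed

lemma lie_ideal_left: "lie_ideal bracket I \<Longrightarrow> x \<in> I \<Longrightarrow> bracket x y \<in> I"
  unfolding lie_ideal_def using br_skew[of x y] by (simp add: real_vector.subspace_neg)

lemma lie_ideal_subspace: "lie_ideal bracket I \<Longrightarrow> subspace I"
  unfolding lie_ideal_def by simp

lemma lie_ideal_right: "lie_ideal bracket I \<Longrightarrow> y \<in> I \<Longrightarrow> bracket x y \<in> I"
  unfolding lie_ideal_def by simp

end

text \<open>Finite-dimensionality is expressed by a finite spanning set, since \<open>dim\<close> of
  a space with an infinite basis is a default value.\<close>

locale fd_lie_algebra = lie_algebra bracket for bracket :: "'a::real_vector \<Rightarrow> 'a \<Rightarrow> 'a" +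
  assumes finite_span: "\<exists>F. finite F \<and> span F = (UNIV :: 'a set)"
begin

lemma coords:
  fixes V U :: "'a set"
  assumes "subspace V" "subspace U" "U \<subseteq> V"
  obtains n b \<xi> where "rel_coords V U n b \<xi>" "dim V = dim U + n"
proof -
  obtain F where "finite F" "span F = (UNIV :: 'a set)" using finite_span by blast
  then show thesis using rel_coords_exists[OF assms, of F] that by auto
qed

lemma subspace_dim_mono:
  fixes V U :: "'a set"
  assumes "subspace V" "subspace U" "U \<subseteq> V"
  shows "dim U \<le> dim V"
  using coords[OF assms] by (metis le_add1)

lemma subspace_dim_eq:
  fixes V U :: "'a set"
  assumes "subspace V" "subspace U" "U \<subseteq> V" "dim V \<le> dim U"
  shows "U = V"
proof -
  obtain n b \<xi> where rc: "rel_coords V U n b \<xi>" "dim V = dim U + n" using coords[OF assms(1-3)] .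
  then have "n = 0" using assms(4) by simp
  then have "x \<in> U" if "x \<in> V" for x using rc(1) that unfolding rel_coords_def by auto
  then show ?thesis using assms(3) by blast
qed

lemma bounded_dim_maximal:
  fixes Q :: "'a set \<Rightarrow> bool"
  assumes "Q K" "\<And>K. Q K \<Longrightarrow> subspace K"
  obtains M where "Q M" "\<And>K. Q K \<Longrightarrow> dim K \<le> dim M"
proof -
  have *: "dim K < Suc (dim (UNIV :: 'a set))" if "Q K" for K
    using subspace_dim_mono[of UNIV K] assms(2)[OF that] by simp
  have "\<exists>M. Q M \<and> (\<forall>K. Q K \<longrightarrow> dim K \<le> dim M)"
    by (rule ex_has_greatest_nat[of Q K dim "Suc (dim (UNIV :: 'a set))", OF assms(1)]) (auto dest: *)
  then show thesis using that by blast
qed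

text \<open>K is a proper subalgebra of largest dimension. If [K, x] lies in K, then K and x span a
  subalgebra, and maximality forces it to be L.\<close>

lemma maximal_subalgebra:
  assumes "subalgebra L" "L \<noteq> {0}"
  obtains K where "subalgebra K" "K \<subset> L"
    "\<And>x. x \<in> L \<Longrightarrow> x \<notin> K \<Longrightarrow> (\<And>y. y \<in> K \<Longrightarrow> bracket y x \<in> K) \<Longrightarrow> L = span (insert x K)"
proof -
  have "subalgebra {0} \<and> {0} \<subset> L"
    using assms unfolding subalgebra_def by (auto simp: br_zero real_vector.subspace_0)
  moreover have "\<And>K. subalgebra K \<and> K \<subset> L \<Longrightarrow> subspace K" unfolding subalgebra_def by blast
  ultimately obtain K where K: "subalgebra K \<and> K \<subset> L"
    and max: "\<And>K'. subalgebra K' \<and> K' \<subset> L \<Longrightarrow> dim K' \<le> dim K"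
    by (rule bounded_dim_maximal[of "\<lambda>K. subalgebra K \<and> K \<subset> L" "{0}"]) blast+
  have "L = span (insert x K)" if x: "x \<in> L" "x \<notin> K" "\<And>y. y \<in> K \<Longrightarrow> bracket y x \<in> K" for x
  proof (rule ccontr)
    assume ne: "L \<noteq> span (insert x K)"
    have sK: "subspace K" and sL: "subspace L" using K assms(1) unfolding subalgebra_def by auto
    have rep: "\<exists>c k. k \<in> K \<and> z = c *\<^sub>R x + k" if "z \<in> span (insert x K)" for z
    proof -
      obtain c where "z - c *\<^sub>R x \<in> span K" using \<open>z \<in> span (insert x K)\<close> real_vector.span_breakdown_eq by blast
      then have "z - c *\<^sub>R x \<in> K" using sK by (metis real_vector.span_eq_iff)
      then show ?thesis by (metis add.commute diff_add_cancel)
    qed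
    have "subalgebra (span (insert x K))"
      unfolding subalgebra_def
    proof (intro conjI ballI)
      fix y z assume "y \<in> span (insert x K)" "z \<in> span (insert x K)"
      then obtain c k d l where y: "y = c *\<^sub>R x + k" "k \<in> K" and z: "z = d *\<^sub>R x + l" "l \<in> K"
        using rep by metis
      have 1: "bracket k x \<in> K" "bracket l x \<in> K" using x(3) y(2) z(2) by auto
      then have 2: "bracket x l \<in> K" using br_skew[of x l] sK by (simp add: real_vector.subspace_neg)
      have "bracket k l \<in> K" using K y z unfolding subalgebra_def by blast
      then have "bracket y z \<in> K" unfolding y z using 1 2 sK
        by (simp add: br_add br_scale bracket_self real_vector.subspace_add real_vector.subspace_scale)
      then show "bracket y z \<in> span (insert x K)" by (simp add: real_vector.span_base)
    qed simp
    moreover have "span (insert x K) \<subseteq> L"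
      using sL x K by (intro real_vector.span_minimal) auto
    ultimately have "dim (span (insert x K)) \<le> dim K" using max ne by blast
    moreover have "K \<subseteq> span (insert x K)" by (meson real_vector.span_base subsetI insertI2)
    ultimately have "K = span (insert x K)" by (intro subspace_dim_eq) (auto simp: sK)
    then show False using x(2) by (metis insertI1 real_vector.span_base)
  qed
  then show thesis using that[of K] K by blast
qed

text \<open>Engel's theorem for the subquotient V / U of the adjoint module, by induction on dim L.
  The set P contains both L and V, so that one nilpotency hypothesis covers the module V / U as well
  as the module L / K for a maximal subalgebra K, to which the induction hypothesis is also
  applied.\<close>

lemma engel:
  assumes "subalgebra L" "L \<subseteq> P" "\<And>x v. x \<in> L \<Longrightarrow> v \<in> P \<Longrightarrow> \<exists>m. (bracket x ^^ m) v = 0"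
    and "subspace V" "subspace U" "U \<subset> V" "V \<subseteq> P"
    and "\<And>x v. x \<in> L \<Longrightarrow> v \<in> V \<Longrightarrow> bracket x v \<in> V" "\<And>x v. x \<in> L \<Longrightarrow> v \<in> U \<Longrightarrow> bracket x v \<in> U"
  shows "\<exists>v\<in>V - U. \<forall>x\<in>L. bracket x v \<in> U"
  using assms
proof (induction "dim L" arbitrary: L V U rule: less_induct)
  case less
  show ?case
  proof (cases "L = {0}")
    case True
    then show ?thesis using less.prems(5,6) by (auto simp: br_zero real_vector.subspace_0)
  next
    case False
    obtain K where K: "subalgebra K" "K \<subset> L"
      and max: "\<And>x. x \<in> L \<Longrightarrow> x \<notin> K \<Longrightarrow> (\<And>y. y \<in> K \<Longrightarrow> bracket y x \<in> K) \<Longrightarrow> L = span (insert x K)"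
      using maximal_subalgebra[OF less.prems(1) False] by blast
    have sub: "subspace K" "subspace L" using K less.prems(1) unfolding subalgebra_def by auto
    then have dK: "dim K < dim L"
      using subspace_dim_eq[of L K] K(2) by fastforce
    have nilK: "\<And>x v. x \<in> K \<Longrightarrow> v \<in> P \<Longrightarrow> \<exists>m. (bracket x ^^ m) v = 0" using less.prems(3) K(2) by blast
    \<comment> \<open>The induction hypothesis for K acting on L / K yields an element outside K
      that normalises K.\<close>
    have "\<exists>x\<in>L - K. \<forall>y\<in>K. bracket y x \<in> K"
      using less.prems K sub by (intro less.hyps[OF dK]) (auto simp: subalgebra_def)
    then obtain x where x: "x \<in> L" "x \<notin> K" "\<And>y. y \<in> K \<Longrightarrow> bracket y x \<in> K" by blast
    have L: "L = span (insert x K)" using max x by blast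
    have "\<exists>v\<in>V - U. \<forall>y\<in>K. bracket y v \<in> U"
      using less.prems K sub by (intro less.hyps[OF dK]) (auto simp: subalgebra_def)
    then obtain v where v: "v \<in> V" "v \<notin> U" "\<And>y. y \<in> K \<Longrightarrow> bracket y v \<in> U" by blast
    \<comment> \<open>The vectors of V that K sends into U are stable under x because [y, x] lies in
      K. The last iterate of v outside U is then sent into U by x as well as by K.\<close>
    have W: "(bracket x ^^ m) v \<in> V \<and> (\<forall>y\<in>K. bracket y ((bracket x ^^ m) v) \<in> U)" for m
    proof (induction m)
      case 0
      then show ?case using v by simp
    next
      case (Suc m)
      have "bracket y (bracket x ((bracket x ^^ m) v)) \<in> U" if "y \<in> K" for y
      proof -
        have "bracket (bracket y x) ((bracket x ^^ m) v) \<in> U" using Suc x(3) that by blast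
        moreover have "bracket x (bracket y ((bracket x ^^ m) v)) \<in> U" using Suc that less.prems(9) x(1) by blast
        ultimately show ?thesis unfolding br_jacobi[of y] using less.prems(5) by (simp only: real_vector.subspace_add)
      qed
      then show ?case using Suc less.prems(8) x(1) by simp
    qed
    obtain m0 where "(bracket x ^^ m0) v = 0" using less.prems(3,7) x(1) v(1) by blast
    then have ex: "\<exists>m. (bracket x ^^ m) v \<in> U" using less.prems(5) by (metis real_vector.subspace_0)
    define m where "m = (LEAST m. (bracket x ^^ m) v \<in> U)"
    have m: "(bracket x ^^ m) v \<in> U" unfolding m_def using ex by (rule LeastI_ex)
    have "m \<noteq> 0" using m v(2) by (intro notI) simp
    then obtain l where l: "m = Suc l" using not0_implies_Suc by blast
    then have wU: "(bracket x ^^ l) v \<notin> U" using not_less_Least[of l] unfolding m_def by (metis lessI)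
    have "bracket y ((bracket x ^^ l) v) \<in> U" if yL: "y \<in> L" for y
    proof -
      obtain c where "y - c *\<^sub>R x \<in> span K" using yL unfolding L real_vector.span_breakdown_eq by blast
      then have "y - c *\<^sub>R x \<in> K" using sub by (metis real_vector.span_eq_iff)
      then have "bracket (y - c *\<^sub>R x) ((bracket x ^^ l) v) \<in> U" using W by blast
      moreover have "bracket (c *\<^sub>R x) ((bracket x ^^ l) v) \<in> U"
        using m l less.prems(5) by (simp add: br_scale real_vector.subspace_scale)
      ultimately have "bracket (y - c *\<^sub>R x) ((bracket x ^^ l) v) + bracket (c *\<^sub>R x) ((bracket x ^^ l) v) \<in> U"
        using less.prems(5) by (simp add: real_vector.subspace_add)
      then show ?thesis by (simp add: br_add[symmetric])
    qed
    then show ?thesis using W[of l] wU by blast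
  qed
qed

text \<open>If every ad x were nilpotent on P, Engel's theorem for P / K with K a maximal subalgebra
  would make K an ideal of P of codimension one, so [P, P] would lie in K.\<close>

lemma perfect_not_nil:
  assumes "subspace P" "bracket_span P P = P" "P \<noteq> {0}"
  shows "\<exists>x\<in>P. \<exists>v\<in>P. \<forall>m. (bracket x ^^ m) v \<noteq> 0"
proof (rule ccontr)
  assume "\<not> ?thesis"
  then have nil: "\<And>x v. x \<in> P \<Longrightarrow> v \<in> P \<Longrightarrow> \<exists>m. (bracket x ^^ m) v = 0" by blast
  have P: "subalgebra P" unfolding subalgebra_def using assms bracket_in_span by blast
  obtain K where K: "subalgebra K" "K \<subset> P"
      and max: "\<And>x. x \<in> P \<Longrightarrow> x \<notin> K \<Longrightarrow> (\<And>y. y \<in> K \<Longrightarrow> bracket y x \<in> K) \<Longrightarrow> P = span (insert x K)"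
      using maximal_subalgebra[OF P assms(3)] by blast
  have sub: "subspace K" using K unfolding subalgebra_def by auto
  have "\<exists>x\<in>P - K. \<forall>y\<in>K. bracket y x \<in> K"
    using K P nil sub assms(1) by (intro engel[of K P]) (auto simp: subalgebra_def)
  then obtain x where x: "x \<in> P" "x \<notin> K" "\<And>y. y \<in> K \<Longrightarrow> bracket y x \<in> K" by blast
  have PK: "P = span (insert x K)" using max x by blast
  have rep: "\<exists>c k. k \<in> K \<and> z = c *\<^sub>R x + k" if "z \<in> P" for z
  proof -
    have "\<exists>c. z - c *\<^sub>R x \<in> span K" using that PK real_vector.span_breakdown_eq[of z x K] by simp
    then obtain c where "z - c *\<^sub>R x \<in> span K" ..
    then have "z - c *\<^sub>R x \<in> K" using sub by (metis real_vector.span_eq_iff)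
    then show ?thesis by (metis add.commute diff_add_cancel)
  qed
  have "bracket y z \<in> K" if yz: "y \<in> P" "z \<in> P" for y z
  proof -
    obtain c k where y: "y = c *\<^sub>R x + k" "k \<in> K" using rep[OF yz(1)] by blast
    obtain d l where z: "z = d *\<^sub>R x + l" "l \<in> K" using rep[OF yz(2)] by blast
    have 1: "bracket k x \<in> K" "bracket l x \<in> K" using x(3) y(2) z(2) by auto
    then have 2: "bracket x l \<in> K" using br_skew[of x l] sub by (simp add: real_vector.subspace_neg)
    have "bracket k l \<in> K" using K y(2) z(2) unfolding subalgebra_def by blast
    then show ?thesis unfolding y(1) z(1) using 1 2 sub
      by (simp add: br_add br_scale bracket_self real_vector.subspace_add real_vector.subspace_scale)
  qed
  then have "bracket_span P P \<subseteq> K" by (intro bracket_span_minimal sub) auto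
  then show False using assms(2) K(2) by blast
qed

text \<open>In dimension at most two all brackets are multiples of one vector w modulo U, so a
  functional that kills U and w kills all of V. On a nonzero quotient such a functional
  exists.\<close>

lemma perfect_quotient_dim_ge_3:
  assumes "subspace V" "subspace U" "U \<subseteq> V"
    and "\<And>x y. x \<in> V \<Longrightarrow> y \<in> U \<Longrightarrow> bracket x y \<in> U"
    and "V \<subseteq> span (bracket_span V V \<union> U)" and "dim V \<le> dim U + 2"
  shows "V = U"
proof -
  obtain n b \<xi> where rc: "rel_coords V U n b \<xi>" "dim V = dim U + n" using coords[OF assms(1-3)] .
  have n2: "n \<le> 2" using rc(2) assms(6) by simp
  \<comment> \<open>For n < 2 all brackets vanish modulo U, hence the default 0.\<close>
  define w where "w = (if n = 2 then bracket (b 0) (b 1) else 0)"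
  have b: "\<And>i. i < n \<Longrightarrow> b i \<in> V" and lin: "\<And>i. i < n \<Longrightarrow> linear (\<xi> i)"
    and z: "\<And>i x. i < n \<Longrightarrow> x \<in> U \<Longrightarrow> \<xi> i x = 0"
    and du: "\<And>i j. i < n \<Longrightarrow> j < n \<Longrightarrow> \<xi> i (b j) = (if i = j then 1 else 0)"
    and dec: "\<And>x. x \<in> V \<Longrightarrow> x - (\<Sum>i<n. \<xi> i x *\<^sub>R b i) \<in> U"
    using rc(1) unfolding rel_coords_def by auto
  have br: "\<exists>c. bracket x y - c *\<^sub>R w \<in> U" if xy: "x \<in> V" "y \<in> V" for x y
  proof -
    define x' y' where "x' = (\<Sum>i<n. \<xi> i x *\<^sub>R b i)" and "y' = (\<Sum>i<n. \<xi> i y *\<^sub>R b i)"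
    have y': "y' \<in> V" unfolding y'_def using b assms(1)
      by (intro real_vector.subspace_sum real_vector.subspace_scale) auto
    have "bracket x (y - y') \<in> U" using assms(4) xy dec[OF xy(2)] by (simp add: y'_def)
    moreover have "bracket (x - x') y' \<in> U"
      using assms(4)[OF y' dec[OF xy(1)]] br_skew[of "x - x'" y'] assms(2)
      by (simp add: x'_def real_vector.subspace_neg)
    ultimately have "bracket x (y - y') + bracket (x - x') y' \<in> U" using assms(2) by (simp add: real_vector.subspace_add)
    then have *: "bracket x y - bracket x' y' \<in> U" by (simp add: br_diff)
    have "\<exists>c. bracket x' y' = c *\<^sub>R w"
    proof -
      consider "n = 0" | "n = 1" | "n = 2" using n2 by linarith
      then show ?thesis
      proof cases
        case 3
        have "bracket x' y' = (\<xi> 0 x * \<xi> 1 y - \<xi> 1 x * \<xi> 0 y) *\<^sub>R w"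
          unfolding x'_def y'_def w_def using 3 br_skew[of "b 1" "b 0"]
          by (simp add: numeral_2_eq_2 br_add br_scale bracket_self scaleR_diff_left algebra_simps)
        then show ?thesis by blast
      qed (auto simp: x'_def y'_def br_zero br_scale bracket_self w_def)
    qed
    then show ?thesis using * by auto
  qed
  have fun0: "\<zeta> x = 0" if "linear \<zeta>" "\<And>x. x \<in> U \<Longrightarrow> \<zeta> x = 0" "\<zeta> w = 0" "x \<in> V" for x and \<zeta> :: "'a \<Rightarrow> real"
  proof -
    have "\<zeta> y = 0" if "y \<in> {bracket x y |x y. x \<in> V \<and> y \<in> V}" for y
    proof -
      obtain u v where "y = bracket u v" "u \<in> V" "v \<in> V" using \<open>y \<in> _\<close> by blast
      then obtain c where "y - c *\<^sub>R w \<in> U" using br by blast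
      then have "\<zeta> (y - c *\<^sub>R w) = 0" using \<open>\<And>x. x \<in> U \<Longrightarrow> \<zeta> x = 0\<close> by blast
      then show ?thesis using \<open>linear \<zeta>\<close> \<open>\<zeta> w = 0\<close> by (simp add: linear_diff linear_cmul)
    qed
    then have "\<zeta> y = 0" if "y \<in> bracket_span V V" for y
      using that linear_eq_0_on_span[OF \<open>linear \<zeta>\<close>] unfolding bracket_span_def by blast
    then have "\<zeta> y = 0" if "y \<in> bracket_span V V \<union> U" for y using that \<open>\<And>x. x \<in> U \<Longrightarrow> \<zeta> x = 0\<close> by blast
    then show ?thesis using linear_eq_0_on_span[OF \<open>linear \<zeta>\<close>] assms(5) \<open>x \<in> V\<close> by blast
  qed
  have w0: "\<xi> i w = 0" if "i < n" for i
  proof (cases "n = 2")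
    case True
    \<comment> \<open>This functional kills w by construction, and its values at the two basis
      vectors are the coordinates of w up to sign. So w is zero modulo U.\<close>
    define \<zeta> where "\<zeta> x = \<xi> 1 w * \<xi> 0 x - \<xi> 0 w * \<xi> 1 x" for x
    have "linear \<zeta>" unfolding \<zeta>_def using lin True
      by (intro linearI) (auto simp: linear_add linear_cmul algebra_simps)
    moreover have "\<zeta> u = 0" if "u \<in> U" for u using True z[of 0 u] z[of 1 u] that by (simp add: \<zeta>_def)
    moreover have "\<zeta> w = 0" by (simp add: \<zeta>_def)
    ultimately have "\<zeta> (b 0) = 0" "\<zeta> (b 1) = 0" using True b[of 0] b[of 1] by (auto intro: fun0)
    then have "\<xi> 0 w = 0" "\<xi> 1 w = 0" using True du by (auto simp: \<zeta>_def)
    then show ?thesis using that True by (auto simp: less_2_cases_iff)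
  next
    case False
    then show ?thesis using lin[OF that] by (simp add: w_def linear_0)
  qed
  have "n = 0"
  proof (rule ccontr)
    assume "n \<noteq> 0"
    then have "\<xi> 0 (b 0) = 0" using fun0[of "\<xi> 0" "b 0"] lin[of 0] z[of 0] w0[of 0] b[of 0] by blast
    then show False using du \<open>n \<noteq> 0\<close> by simp
  qed
  then show ?thesis using subspace_dim_eq[OF assms(1-3)] rc(2) by simp
qed

end

section \<open>The complex conjugate of the semisimple part of a matrix\<close>

text \<open>Matrices are plain functions of two indices, of which only those below n count. This
  spares carrier conditions: associativity holds as an equality of functions, and only the unit laws
  are restricted to \<open>meq n\<close>.\<close>

definition mmul :: "nat \<Rightarrow> (nat \<Rightarrow> nat \<Rightarrow> complex) \<Rightarrow> (nat \<Rightarrow> nat \<Rightarrow> complex) \<Rightarrow> nat \<Rightarrow> nat \<Rightarrow> complex"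
  where "mmul n A B i j = (\<Sum>k<n. A i k * B k j)"

definition mone :: "nat \<Rightarrow> nat \<Rightarrow> complex"
  where "mone i j = (if i = j then 1 else 0)"

definition meq :: "nat \<Rightarrow> (nat \<Rightarrow> nat \<Rightarrow> complex) \<Rightarrow> (nat \<Rightarrow> nat \<Rightarrow> complex) \<Rightarrow> bool"
  where "meq n A B \<longleftrightarrow> (\<forall>i<n. \<forall>j<n. A i j = B i j)"

lemma mmul_assoc: "mmul n (mmul n A B) C = mmul n A (mmul n B C)"
proof (intro ext)
  fix i j
  have "mmul n (mmul n A B) C i j = (\<Sum>k<n. \<Sum>l<n. A i l * B l k * C k j)"
    by (simp add: mmul_def sum_distrib_right)
  also have "\<dots> = (\<Sum>l<n. \<Sum>k<n. A i l * B l k * C k j)" by (rule sum.swap)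
  also have "\<dots> = mmul n A (mmul n B C) i j" by (simp add: mmul_def sum_distrib_left mult.assoc)
  finally show "mmul n (mmul n A B) C i j = mmul n A (mmul n B C) i j" .
qed

lemma meq_mmul: "meq n A A' \<Longrightarrow> meq n B B' \<Longrightarrow> meq n (mmul n A B) (mmul n A' B')"
  by (simp add: meq_def mmul_def)

lemma meq_trans [trans]: "meq n A B \<Longrightarrow> meq n B C \<Longrightarrow> meq n A C" and meq_sym: "meq n A B \<Longrightarrow> meq n B A"
  and meq_refl: "meq n A A"
  by (simp_all add: meq_def)

lemma mmul_one: "meq n (mmul n mone A) A" "meq n (mmul n A mone) A"
  by (simp_all add: meq_def mmul_def mone_def if_distrib[of "\<lambda>x. x * _"] if_distrib[of "\<lambda>x. _ * x"] cong: if_cong)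

lemma mmul_one_comm: "meq n (mmul n A mone) (mmul n mone A)"
  by (rule meq_trans[OF mmul_one(2) meq_sym[OF mmul_one(1)]])

lemma mtrace_comm: "(\<Sum>i<n. mmul n A B i i) = (\<Sum>i<n. mmul n B A i i)"
  unfolding mmul_def by (subst sum.swap) (simp add: mult.commute)

lemma mtrace_cong: "meq n A B \<Longrightarrow> (\<Sum>i<n. A i i) = (\<Sum>i<n. B i i)"
  by (simp add: meq_def)

text \<open>The one property of Jordan matrices on which the rest relies: off the diagonal only the
  superdiagonal is occupied, and it links equal eigenvalues.\<close>

lemma jordan_matrix_bidiagonal:
  assumes "i < sum_list (map fst n_as)" "j < sum_list (map fst n_as)" "jordan_matrix n_as $$ (i, j) \<noteq> (0::complex)"
  shows "i = j \<or> (j = Suc i \<and> jordan_matrix n_as $$ (i, i) = jordan_matrix n_as $$ (j, j))"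
  using assms
proof (induction n_as arbitrary: i j)
  case Nil
  then show ?case by simp
next
  case (Cons na n_as)
  obtain m a where na: "na = (m, a)" by (cases na)
  let ?N = "sum_list (map fst n_as)"
  have J: "jordan_matrix (na # n_as) $$ (i, j) =
      (if i < m then if j < m then jordan_block m a $$ (i, j) else 0
       else if j < m then 0 else jordan_matrix n_as $$ (i - m, j - m))"
    if "i < m + ?N" "j < m + ?N" for i j
    using that unfolding na jordan_matrix_Cons by (auto simp: not_less)
  have ij: "i < m + ?N" "j < m + ?N" using Cons.prems na by auto
  show ?case
  proof (cases "i < m")
    case True
    then have "j < m" "jordan_block m a $$ (i, j) \<noteq> 0" using J[OF ij] Cons.prems(3) by (auto split: if_splits)
    then show ?thesis using True ij J by (auto simp: jordan_block_index split: if_splits)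
  next
    case False
    then have *: "\<not> j < m" "jordan_matrix n_as $$ (i - m, j - m) \<noteq> 0"
      using J[OF ij] Cons.prems(3) by (auto split: if_splits)
    then have "i - m = j - m \<or> (j - m = Suc (i - m) \<and>
        jordan_matrix n_as $$ (i - m, i - m) = jordan_matrix n_as $$ (j - m, j - m))"
      using ij False by (intro Cons.IH) auto
    then show ?thesis using False * ij J by auto
  qed
qed

lemma jordan_basis:
  fixes M :: "nat \<Rightarrow> nat \<Rightarrow> complex"
  obtains P Q J where "meq n (mmul n P Q) mone" "meq n (mmul n Q P) mone"
    "meq n (mmul n M P) (mmul n P J)" "meq n (mmul n Q M) (mmul n J Q)"
    "\<And>i j. i < n \<Longrightarrow> j < n \<Longrightarrow> J i j \<noteq> 0 \<Longrightarrow> i = j \<or> (j = Suc i \<and> J i i = J j j)"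
proof -
  define A where "A = Matrix.mat n n (\<lambda>(i, j). M i j)"
  have A: "A \<in> carrier_mat n n" unfolding A_def by simp
  obtain n_as where "jordan_nf A n_as"
    using char_poly_factorized[OF A] jordan_nf_exists[OF A] by blast
  then have "similar_mat A (jordan_matrix n_as)" unfolding jordan_nf_def by simp
  then obtain n' P Q where sim: "{A, jordan_matrix n_as, P, Q} \<subseteq> carrier_mat n' n'"
    "P * Q = 1\<^sub>m n'" "Q * P = 1\<^sub>m n'" "A = P * jordan_matrix n_as * Q"
    using similar_matD by metis
  then have n': "n' = n" using A by auto
  define J where "J = jordan_matrix n_as"
  have J: "J \<in> carrier_mat n n" "P \<in> carrier_mat n n" "Q \<in> carrier_mat n n"
    using sim n' unfolding J_def by auto
  then have N: "sum_list (map fst n_as) = n" unfolding J_def using jordan_matrix_dim(1)[of n_as] by auto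
  have AP: "A * P = P * J" "Q * A = J * Q"
  proof -
    have "A * P = P * J * (Q * P)" using sim(4) J unfolding J_def[symmetric] by (simp add: assoc_mult_mat[of _ n n _ n _ n])
    then show "A * P = P * J" using sim(3) n' J by simp
    have "Q * A = (Q * P) * (J * Q)" using sim(4) J unfolding J_def[symmetric]
      by (simp add: assoc_mult_mat[of _ n n _ n _ n])
    then show "Q * A = J * Q" using sim(3) n' J by simp
  qed
  have mm: "mmul n (\<lambda>i j. X $$ (i, j)) (\<lambda>i j. Y $$ (i, j)) i j = (X * Y) $$ (i, j)"
    if "X \<in> carrier_mat n n" "Y \<in> carrier_mat n n" "i < n" "j < n" for X Y i j
    using that by (simp add: mmul_def scalar_prod_def atLeast0LessThan)
  have MA: "meq n M (\<lambda>i j. A $$ (i, j))" unfolding meq_def A_def by simp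
  show thesis
  proof (rule that[of "\<lambda>i j. P $$ (i, j)" "\<lambda>i j. Q $$ (i, j)" "\<lambda>i j. J $$ (i, j)"])
    show "meq n (mmul n (\<lambda>i j. P $$ (i, j)) (\<lambda>i j. Q $$ (i, j))) mone"
      "meq n (mmul n (\<lambda>i j. Q $$ (i, j)) (\<lambda>i j. P $$ (i, j))) mone"
      using J sim(2,3) n' by (auto simp: meq_def mm mone_def)
    show "meq n (mmul n M (\<lambda>i j. P $$ (i, j))) (mmul n (\<lambda>i j. P $$ (i, j)) (\<lambda>i j. J $$ (i, j)))"
      by (rule meq_trans[OF meq_mmul[OF MA meq_refl]]) (use J A AP in \<open>auto simp: meq_def mm\<close>)
    show "meq n (mmul n (\<lambda>i j. Q $$ (i, j)) M) (mmul n (\<lambda>i j. J $$ (i, j)) (\<lambda>i j. Q $$ (i, j)))"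
      by (rule meq_trans[OF meq_mmul[OF meq_refl MA]]) (use J A AP in \<open>auto simp: meq_def mm\<close>)
    show "\<And>i j. i < n \<Longrightarrow> j < n \<Longrightarrow> J $$ (i, j) \<noteq> 0 \<Longrightarrow> i = j \<or> (j = Suc i \<and> J $$ (i, i) = J $$ (j, j))"
      using jordan_matrix_bidiagonal[of _ n_as] N unfolding J_def by blast
  qed
qed

text \<open>A acts on the upper index e of a tensor, B and C on its two lower indices. The lower
  factors multiply from the other side, so their order is reversed in
  \<open>tri_tri\<close>.\<close>

definition tri :: "nat \<Rightarrow> (nat \<Rightarrow> nat \<Rightarrow> complex) \<Rightarrow> (nat \<Rightarrow> nat \<Rightarrow> complex) \<Rightarrow> (nat \<Rightarrow> nat \<Rightarrow> complex) \<Rightarrow>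
    (nat \<Rightarrow> nat \<Rightarrow> nat \<Rightarrow> complex) \<Rightarrow> nat \<Rightarrow> nat \<Rightarrow> nat \<Rightarrow> complex"
  where "tri n A B C g e i j = (\<Sum>d<n. \<Sum>k<n. \<Sum>l<n. A e d * B k i * C l j * g d k l)"

lemma tri_tri: "tri n A B C (tri n A' B' C' g) = tri n (mmul n A A') (mmul n B' B) (mmul n C' C) g"
proof (intro ext)
  fix e i j
  have "tri n A B C (tri n A' B' C' g) e i j =
     (\<Sum>(d, k, l)\<in>{..<n} \<times> {..<n} \<times> {..<n}. \<Sum>(d', k', l')\<in>{..<n} \<times> {..<n} \<times> {..<n}.
        A e d * B k i * C l j * (A' d d' * B' k' k * C' l' l * g d' k' l'))"
    by (simp add: tri_def sum.cartesian_product[symmetric] sum_distrib_left)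
  also have "\<dots> = (\<Sum>(d', k', l')\<in>{..<n} \<times> {..<n} \<times> {..<n}. \<Sum>(d, k, l)\<in>{..<n} \<times> {..<n} \<times> {..<n}.
        A e d * B k i * C l j * (A' d d' * B' k' k * C' l' l * g d' k' l'))"
    unfolding case_prod_unfold by (rule sum.swap)
  also have "\<dots> = (\<Sum>d'<n. \<Sum>k'<n. \<Sum>l'<n. \<Sum>d<n. \<Sum>k<n. \<Sum>l<n.
        (A e d * A' d d') * ((B' k' k * B k i) * ((C' l' l * C l j) * g d' k' l')))"
    by (simp add: sum.cartesian_product[symmetric] mult_ac)
  also have "\<dots> = (\<Sum>d'<n. \<Sum>k'<n. \<Sum>l'<n. (\<Sum>d<n. A e d * A' d d') *
        ((\<Sum>k<n. B' k' k * B k i) * ((\<Sum>l<n. C' l' l * C l j) * g d' k' l')))"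
    by (simp only: sum_distrib_left[symmetric] sum_distrib_right[symmetric])
  also have "\<dots> = tri n (mmul n A A') (mmul n B' B) (mmul n C' C) g e i j"
    by (simp add: tri_def mmul_def mult.assoc)
  finally show "tri n A B C (tri n A' B' C' g) e i j = tri n (mmul n A A') (mmul n B' B) (mmul n C' C) g e i j" .
qed


lemma tri_cong:
  assumes "meq n A A'" "meq n B B'" "meq n C C'"
    and "\<And>d k l. d < n \<Longrightarrow> k < n \<Longrightarrow> l < n \<Longrightarrow> g d k l = g' d k l" "e < n" "i < n" "j < n"
  shows "tri n A B C g e i j = tri n A' B' C' g' e i j"
  using assms by (simp add: tri_def meq_def)

lemma tri_slots:
  assumes "e < n" "i < n" "j < n"
  shows "tri n A mone mone g e i j = (\<Sum>d<n. A e d * g d i j)"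
    "tri n mone B mone g e i j = (\<Sum>k<n. B k i * g e k j)"
    "tri n mone mone C g e i j = (\<Sum>l<n. C l j * g e i l)"
proof -
  have if_sum: "(\<Sum>k<n. if P then f k else 0) = (if P then \<Sum>k<n. f k else (0::complex))" for P f
    by simp
  show "tri n A mone mone g e i j = (\<Sum>d<n. A e d * g d i j)"
    "tri n mone B mone g e i j = (\<Sum>k<n. B k i * g e k j)"
    "tri n mone mone C g e i j = (\<Sum>l<n. C l j * g e i l)"
    using assms
    by (simp_all add: tri_def mone_def if_distrib[of "\<lambda>x. x * _"] if_distrib[of "\<lambda>x. _ * x"] if_sum cong: if_cong)
qed

text \<open>M is a derivation of the product with structure constants g, where
  \<open>g e i j\<close> is the coordinate e of the product of the basis vectors i and j.\<close>

definition mderivation :: "nat \<Rightarrow> (nat \<Rightarrow> nat \<Rightarrow> complex) \<Rightarrow> (nat \<Rightarrow> nat \<Rightarrow> nat \<Rightarrow> complex) \<Rightarrow> bool"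
  where "mderivation n M g \<longleftrightarrow> (\<forall>e<n. \<forall>i<n. \<forall>j<n.
    (\<Sum>d<n. M e d * g d i j) = (\<Sum>k<n. M k i * g e k j) + (\<Sum>l<n. M l j * g e i l))"

lemma mderivation_tri:
  "mderivation n M g \<longleftrightarrow> (\<forall>e<n. \<forall>i<n. \<forall>j<n.
    tri n M mone mone g e i j = tri n mone M mone g e i j + tri n mone mone M g e i j)"
  by (simp add: mderivation_def tri_slots)

lemma tri_add: "tri n A B C (\<lambda>d k l. g d k l + h d k l) e i j = tri n A B C g e i j + tri n A B C h e i j"
  by (simp add: tri_def distrib_left sum.distrib)

lemma mderivation_transport:
  assumes der: "mderivation n M g"
    and PQ: "meq n (mmul n P Q) mone" "meq n (mmul n Q P) mone"
    and MP: "meq n (mmul n M P) (mmul n P J)" and QM: "meq n (mmul n Q M) (mmul n J Q)"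
  shows "mderivation n J (tri n Q P P g)"
  unfolding mderivation_tri
proof (intro allI impI)
  fix e i j assume eij: "e < n" "i < n" "j < n"
  have "tri n J mone mone (tri n Q P P g) e i j = tri n Q P P (tri n M mone mone g) e i j"
    unfolding tri_tri by (rule tri_cong) (use eij in \<open>auto intro: meq_trans meq_sym mmul_one mmul_one_comm QM\<close>)
  also have "\<dots> = tri n Q P P (\<lambda>e i j. tri n mone M mone g e i j + tri n mone mone M g e i j) e i j"
    by (rule tri_cong) (use eij der in \<open>auto simp: meq_refl mderivation_tri\<close>)
  also have "\<dots> = tri n Q P P (tri n mone M mone g) e i j + tri n Q P P (tri n mone mone M g) e i j"
    by (rule tri_add)
  also have "tri n Q P P (tri n mone M mone g) e i j = tri n mone J mone (tri n Q P P g) e i j"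
    unfolding tri_tri by (rule tri_cong) (use eij in \<open>auto intro: meq_trans meq_sym mmul_one mmul_one_comm MP\<close>)
  also have "tri n Q P P (tri n mone mone M g) e i j = tri n mone mone J (tri n Q P P g) e i j"
    unfolding tri_tri by (rule tri_cong) (use eij in \<open>auto intro: meq_trans meq_sym mmul_one mmul_one_comm MP\<close>)
  finally show "tri n J mone mone (tri n Q P P g) e i j =
      tri n mone J mone (tri n Q P P g) e i j + tri n mone mone J (tri n Q P P g) e i j" .
qed


lemma bidiagonal_sum_row:
  assumes "\<And>i j. i < n \<Longrightarrow> j < n \<Longrightarrow> J i j \<noteq> 0 \<Longrightarrow> i = j \<or> j = Suc i" "i < n"
  shows "(\<Sum>d<n. J i d * x d) = J i i * x i + (if Suc i < n then J i (Suc i) * x (Suc i) else (0::complex))"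
proof -
  have "(\<Sum>d<n. J i d * x d) = (\<Sum>d\<in>{i} \<union> {d. d = Suc i \<and> d < n}. J i d * x d)"
    using assms by (intro sum.mono_neutral_right) force+
  also have "\<dots> = J i i * x i + (\<Sum>d\<in>{d. d = Suc i \<and> d < n}. J i d * x d)"
    by (subst sum.union_disjoint) auto
  also have "{d. d = Suc i \<and> d < n} = (if Suc i < n then {Suc i} else {})" by auto
  finally show ?thesis by simp
qed

lemma bidiagonal_sum_col:
  assumes "\<And>i j. i < n \<Longrightarrow> j < n \<Longrightarrow> J i j \<noteq> 0 \<Longrightarrow> i = j \<or> j = Suc i" "j < n"
  shows "(\<Sum>d<n. J d j * x d) = J j j * x j + (if j > 0 then J (j - 1) j * x (j - 1) else (0::complex))"
proof -
  have "(\<Sum>d<n. J d j * x d) = (\<Sum>d\<in>{j} \<union> {d. Suc d = j}. J d j * x d)"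
    using assms by (intro sum.mono_neutral_right) force+
  also have "\<dots> = J j j * x j + (\<Sum>d\<in>{d. Suc d = j}. J d j * x d)"
    by (subst sum.union_disjoint) (auto intro: finite_subset[of _ "{..j}"])
  also have "{d. Suc d = j} = (if j > 0 then {j - 1} else {})" by auto
  finally show ?thesis by simp
qed

text \<open>
  \<open>J\<close> is a Jordan matrix and \<open>D\<close> the complex conjugate of its diagonal part. Entries of a tensor that
  \<open>J\<close> annihilates vanish unless the eigenvalues match, and then \<open>D\<close> annihilates the tensor too.
\<close>

context
  fixes n :: nat and J :: "nat \<Rightarrow> nat \<Rightarrow> complex" and D :: "nat \<Rightarrow> nat \<Rightarrow> complex"
  assumes bidiag: "\<And>i j. i < n \<Longrightarrow> j < n \<Longrightarrow> J i j \<noteq> 0 \<Longrightarrow> i = j \<or> (j = Suc i \<and> J i i = J j j)"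
  defines D: "D \<equiv> (\<lambda>i j. if i = j then cnj (J i i) else 0)"
begin

lemma J_row: "i < n \<Longrightarrow> (\<Sum>d<n. J i d * x d) = J i i * x i + (if Suc i < n then J i (Suc i) * x (Suc i) else 0)"
  by (rule bidiagonal_sum_row) (use bidiag in blast)+

lemma J_col: "j < n \<Longrightarrow> (\<Sum>d<n. J d j * x d) = J j j * x j + (if j > 0 then J (j - 1) j * x (j - 1) else 0)"
  by (rule bidiagonal_sum_col) (use bidiag in blast)+

lemma J_prev: "i > 0 \<Longrightarrow> i < n \<Longrightarrow> J (i - 1) i \<noteq> 0 \<Longrightarrow> J (i - 1) (i - 1) = J i i"
  using bidiag[of "i - 1" i] by (cases i) auto

lemma D_sum: "i < n \<Longrightarrow> (\<Sum>d<n. D i d * x d) = cnj (J i i) * x i" "i < n \<Longrightarrow> (\<Sum>d<n. D d i * x d) = cnj (J i i) * x i"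
  by (simp_all add: D if_distrib[of "\<lambda>x. x * _"] cong: if_cong)

lemma mderivation_cnj_diag:
  assumes "mderivation n J g"
  shows "mderivation n D g"
proof -
  have "g e i j = 0" if "e < n" "i < n" "j < n" "J e e \<noteq> J i i + J j j" for e i j
    using that
  \<comment> \<open>The superdiagonal of J couples \<open>g e i j\<close> only to entries with
    larger e, smaller i or smaller j, so this measure decreases. Coupled indices share their
    eigenvalue, so the inequality of eigenvalues is inherited.\<close>
  proof (induction "i + j + (n - e)" arbitrary: e i j rule: less_induct)
    case less
    have "J e e * g e i j + (if Suc e < n then J e (Suc e) * g (Suc e) i j else 0) =
        J i i * g e i j + (if i > 0 then J (i - 1) i * g e (i - 1) j else 0) +
        (J j j * g e i j + (if j > 0 then J (j - 1) j * g e i (j - 1) else 0))"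
    proof -
      have "(\<Sum>d<n. J e d * g d i j) = (\<Sum>k<n. J k i * g e k j) + (\<Sum>l<n. J l j * g e i l)"
        using assms less.prems unfolding mderivation_def by blast
      then show ?thesis
        unfolding J_row[OF less.prems(1)] J_col[OF less.prems(2)]
          J_col[OF less.prems(3)] .
    qed
    moreover have "(if Suc e < n then J e (Suc e) * g (Suc e) i j else 0) = 0"
    proof (cases "Suc e < n \<and> J e (Suc e) \<noteq> 0")
      case True
      then have "J e e = J (Suc e) (Suc e)" using bidiag[of e "Suc e"] less.prems by auto
      then have "g (Suc e) i j = 0" using less.prems True by (intro less.hyps) auto
      then show ?thesis by simp
    qed auto
    moreover have "(if i > 0 then J (i - 1) i * g e (i - 1) j else 0) = 0"
    proof (cases "i > 0 \<and> J (i - 1) i \<noteq> 0")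
      case True
      then have "J (i - 1) (i - 1) = J i i" using J_prev less.prems by blast
      then have "g e (i - 1) j = 0" using less.prems True by (intro less.hyps) auto
      then show ?thesis by simp
    qed auto
    moreover have "(if j > 0 then J (j - 1) j * g e i (j - 1) else 0) = 0"
    proof (cases "j > 0 \<and> J (j - 1) j \<noteq> 0")
      case True
      then have "J (j - 1) (j - 1) = J j j" using J_prev less.prems by blast
      then have "g e i (j - 1) = 0" using less.prems True by (intro less.hyps) auto
      then show ?thesis by simp
    qed auto
    ultimately have "(J e e - (J i i + J j j)) * g e i j = 0" by (simp add: algebra_simps)
    then show ?case using less.prems by simp
  qed
  \<comment> \<open>A nonzero entry forces J e e = J i i + J j j, and the conjugate of this relation
    is the one for D.\<close>
  then have "cnj (J e e) * g e i j = cnj (J i i) * g e i j + cnj (J j j) * g e i j"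
    if "e < n" "i < n" "j < n" for e i j
    using that by (cases "J e e = J i i + J j j") (auto simp: algebra_simps)
  then show ?thesis unfolding mderivation_def by (simp add: D_sum)
qed

lemma mmul_commute_cnj_diag:
  assumes "meq n (mmul n J a) (mmul n a J)"
  shows "meq n (mmul n D a) (mmul n a D)"
proof -
  have "a e i = 0" if "e < n" "i < n" "J e e \<noteq> J i i" for e i
    using that
  proof (induction "i + (n - e)" arbitrary: e i rule: less_induct)
    case less
    have "(\<Sum>d<n. J e d * a d i) = (\<Sum>k<n. J k i * a e k)"
      using assms less.prems unfolding meq_def mmul_def by (simp add: mult.commute)
    then have "J e e * a e i + (if Suc e < n then J e (Suc e) * a (Suc e) i else 0) =
        J i i * a e i + (if i > 0 then J (i - 1) i * a e (i - 1) else 0)"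
      unfolding J_row[OF less.prems(1)] J_col[OF less.prems(2)] .
    moreover have "(if Suc e < n then J e (Suc e) * a (Suc e) i else 0) = 0"
    proof (cases "Suc e < n \<and> J e (Suc e) \<noteq> 0")
      case True
      then have "J e e = J (Suc e) (Suc e)" using bidiag[of e "Suc e"] less.prems by auto
      then have "a (Suc e) i = 0" using less.prems True by (intro less.hyps) auto
      then show ?thesis by simp
    qed auto
    moreover have "(if i > 0 then J (i - 1) i * a e (i - 1) else 0) = 0"
    proof (cases "i > 0 \<and> J (i - 1) i \<noteq> 0")
      case True
      then have "J (i - 1) (i - 1) = J i i" using J_prev less.prems by blast
      then have "a e (i - 1) = 0" using less.prems True by (intro less.hyps) auto
      then show ?thesis by simp
    qed auto
    ultimately have "(J e e - J i i) * a e i = 0" by (simp add: algebra_simps)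
    then show ?case using less.prems by simp
  qed
  then have "cnj (J e e) * a e i = cnj (J i i) * a e i" if "e < n" "i < n" for e i
    using that by (cases "J e e = J i i") auto
  then have "(\<Sum>k<n. D e k * a k i) = (\<Sum>k<n. a e k * D k i)" if "e < n" "i < n" for e i
    using that D_sum(1)[OF that(1), of "\<lambda>k. a k i"] D_sum(2)[OF that(2), of "\<lambda>k. a e k"]
    by (simp add: mult.commute[of "a e _"])
  then show ?thesis unfolding meq_def mmul_def by blast
qed

text \<open>The trace of J D is the sum of the squared moduli of the diagonal entries. This is why D
  carries the conjugates of the eigenvalues.\<close>

lemma trace_cnj_diag:
  assumes "(\<Sum>i<n. mmul n J D i i) = 0" "i < n"
  shows "J i i = 0"
proof -
  have "mmul n J D i i = complex_of_real ((cmod (J i i))\<^sup>2)" if "i < n" for i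
    unfolding mmul_def using D_sum(2)[OF that, of "\<lambda>d. J i d"] by (simp add: mult.commute complex_norm_square del: of_real_power)
  then have "(\<Sum>i<n. mmul n J D i i) = complex_of_real (\<Sum>i<n. (cmod (J i i))\<^sup>2)" by simp
  then have "(\<Sum>i<n. (cmod (J i i))\<^sup>2) = 0" using assms(1) by (metis of_real_eq_0_iff)
  then have "(cmod (J i i))\<^sup>2 = 0" using assms(2) by (subst (asm) sum_nonneg_eq_0_iff) auto
  then show ?thesis by simp
qed

end

text \<open>E is the conjugated diagonal part D of the Jordan form, carried back to the original
  basis; it is not the entrywise conjugate of a matrix. In the last property tr(M E) = 0 makes all
  eigenvalues vanish, so the n-th iterate of M is zero. It is stated for sequences w with w (m + 1)
  = M w m, which fits iterated brackets directly.\<close>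

lemma conj_semisimple_part:
  fixes M :: "nat \<Rightarrow> nat \<Rightarrow> complex"
  obtains E where
    "\<And>a. meq n (mmul n M a) (mmul n a M) \<Longrightarrow> meq n (mmul n E a) (mmul n a E)"
    "\<And>g. mderivation n M g \<Longrightarrow> mderivation n E g"
    "\<And>w i. (\<Sum>i<n. mmul n M E i i) = 0 \<Longrightarrow> (\<And>m i. i < n \<Longrightarrow> w (Suc m) i = (\<Sum>j<n. M i j * w m j)) \<Longrightarrow>
        i < n \<Longrightarrow> w n i = (0::complex)"
proof -
  obtain P Q J where PQ: "meq n (mmul n P Q) mone" "meq n (mmul n Q P) mone"
    and MP: "meq n (mmul n M P) (mmul n P J)" and QM: "meq n (mmul n Q M) (mmul n J Q)"
    and bd: "\<And>i j. i < n \<Longrightarrow> j < n \<Longrightarrow> J i j \<noteq> 0 \<Longrightarrow> i = j \<or> (j = Suc i \<and> J i i = J j j)"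
    using jordan_basis[of n M] by metis
  define D where "D = (\<lambda>i j. if i = j then cnj (J i i) else 0)"
  define E where "E = mmul n P (mmul n D Q)"
  note R = meq_refl and T = meq_trans and S = meq_sym
  have EP: "meq n (mmul n E P) (mmul n P D)"
    unfolding E_def mmul_assoc by (intro meq_mmul R T[OF meq_mmul[OF R PQ(2)] mmul_one(2)])
  have QE: "meq n (mmul n Q E) (mmul n D Q)"
    unfolding E_def by (subst mmul_assoc[symmetric]) (rule T[OF meq_mmul[OF PQ(2) R] mmul_one(1)])
  show thesis
  proof (rule that[of E])
    fix a assume a: "meq n (mmul n M a) (mmul n a M)"
    define a' where "a' = mmul n Q (mmul n a P)"
    have "meq n (mmul n J a') (mmul n Q (mmul n M (mmul n a P)))"
      unfolding a'_def by (subst (1 3) mmul_assoc[symmetric]) (rule meq_mmul[OF S[OF QM] R])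
    also have "meq n \<dots> (mmul n Q (mmul n a (mmul n M P)))"
      by (subst (2 4) mmul_assoc[symmetric]) (intro meq_mmul R a)
    also have "meq n \<dots> (mmul n a' J)"
      unfolding a'_def mmul_assoc by (intro meq_mmul R MP)
    finally have "meq n (mmul n D a') (mmul n a' D)"
      unfolding D_def by (intro mmul_commute_cnj_diag bd)
    then have *: "meq n (mmul n P (mmul n (mmul n D a') Q)) (mmul n P (mmul n (mmul n a' D) Q))"
      by (rule meq_mmul[OF R meq_mmul[OF _ R]])
    have aPQ: "meq n (mmul n (mmul n a P) Q) a"
      unfolding mmul_assoc by (rule T[OF meq_mmul[OF R PQ(1)] mmul_one(2)])
    have "meq n (mmul n P (mmul n (mmul n D a') Q)) (mmul n E a)"
    proof -
      have "mmul n P (mmul n (mmul n D a') Q) = mmul n E (mmul n (mmul n a P) Q)"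
        unfolding E_def a'_def mmul_assoc ..
      then show ?thesis using meq_mmul[OF R aPQ] by simp
    qed
    moreover have "meq n (mmul n P (mmul n (mmul n a' D) Q)) (mmul n a E)"
    proof -
      have "mmul n P (mmul n (mmul n a' D) Q) = mmul n (mmul n P Q) (mmul n a E)"
        unfolding E_def a'_def mmul_assoc ..
      then show ?thesis using T[OF meq_mmul[OF PQ(1) R] mmul_one(1)] by simp
    qed
    ultimately show "meq n (mmul n E a) (mmul n a E)" using * S T by blast
  next
    fix g assume g: "mderivation n M g"
    have "mderivation n D (tri n Q P P g)"
      unfolding D_def by (intro mderivation_cnj_diag bd mderivation_transport[OF g PQ MP QM])
    then have "mderivation n E (tri n P Q Q (tri n Q P P g))"
      by (rule mderivation_transport[OF _ PQ(2,1)])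
        (use QE EP S in blast)+
    moreover have "tri n P Q Q (tri n Q P P g) e i j = g e i j" if "e < n" "i < n" "j < n" for e i j
    proof -
      have "tri n P Q Q (tri n Q P P g) e i j = tri n mone mone mone g e i j"
        unfolding tri_tri by (rule tri_cong) (use that PQ in auto)
      also have "\<dots> = g e i j" using that
        by (simp add: tri_slots(1)) (simp add: mone_def if_distrib[of "\<lambda>x. x * _"] cong: if_cong)
      finally show ?thesis .
    qed
    ultimately show "mderivation n E g" unfolding mderivation_def by simp
  next
    fix w i
    assume tr: "(\<Sum>i<n. mmul n M E i i) = 0"
      and w: "\<And>m i. i < n \<Longrightarrow> w (Suc m) i = (\<Sum>j<n. M i j * w m j)" and i: "i < n"
    have "(\<Sum>i<n. mmul n M E i i) = (\<Sum>i<n. mmul n (mmul n (mmul n M P) D) Q i i)"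
      unfolding E_def mmul_assoc ..
    also have "\<dots> = (\<Sum>i<n. mmul n (mmul n (mmul n P J) D) Q i i)"
      by (intro mtrace_cong meq_mmul R MP)
    also have "\<dots> = (\<Sum>i<n. mmul n P (mmul n (mmul n J D) Q) i i)" unfolding mmul_assoc ..
    also have "\<dots> = (\<Sum>i<n. mmul n (mmul n (mmul n J D) Q) P i i)" by (rule mtrace_comm)
    also have "\<dots> = (\<Sum>i<n. mmul n J D i i)"
      unfolding mmul_assoc[of _ _ Q P] by (intro mtrace_cong T[OF meq_mmul[OF R PQ(2)] mmul_one(2)])
    finally have tr0: "(\<Sum>i<n. mmul n J D i i) = 0" using tr by simp
    have J0: "J i i = 0" if "i < n" for i
      by (rule trace_cnj_diag[OF _ tr0[unfolded D_def] that]) (rule bd)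
    define y where "y m i = (\<Sum>j<n. Q i j * w m j)" for m i
    have y: "y (Suc m) i = (if Suc i < n then J i (Suc i) * y m (Suc i) else 0)" if "i < n" for m i
    proof -
      have "y (Suc m) i = (\<Sum>k<n. mmul n Q M i k * w m k)"
        unfolding y_def mmul_def by (simp add: w sum_distrib_left sum_distrib_right mult.assoc) (rule sum.swap)
      also have "\<dots> = (\<Sum>k<n. mmul n J Q i k * w m k)" using QM that unfolding meq_def by simp
      also have "\<dots> = (\<Sum>j<n. J i j * y m j)"
        unfolding y_def mmul_def by (simp add: sum_distrib_left sum_distrib_right mult.assoc) (rule sum.swap)
      also have "\<dots> = J i i * y m i + (if Suc i < n then J i (Suc i) * y m (Suc i) else 0)"
        using bd that by (intro bidiagonal_sum_row) blast+
      finally show ?thesis using J0[OF that] by simp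
    qed
    \<comment> \<open>J is strictly upper triangular now, so the m-th iterate vanishes in the last m
      coordinates.\<close>
    have y0: "y m i = 0" if "i < n" "n \<le> i + m" for m i
      using that by (induction m arbitrary: i) (auto simp: y)
    have "w n i = (\<Sum>k<n. mmul n P Q i k * w n k)"
      using PQ(1) i unfolding meq_def by (simp add: mone_def if_distrib[of "\<lambda>x. x * _"] cong: if_cong)
    also have "\<dots> = (\<Sum>j<n. P i j * y n j)"
      unfolding y_def mmul_def by (simp add: sum_distrib_left sum_distrib_right mult.assoc) (rule sum.swap)
    also have "\<dots> = 0" using y0 by simp
    finally show "w n i = 0" .
  qed
qed

section \<open>Traces of commutators: the theorems of Lie and Cartan\<close>

lemma rel_coordsD:
  assumes "rel_coords V U n b \<xi>"
  shows "subspace V" "subspace U" "U \<subseteq> V" "\<And>i. i < n \<Longrightarrow> b i \<in> V" "\<And>i. i < n \<Longrightarrow> linear (\<xi> i)"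
    "\<And>i x. i < n \<Longrightarrow> x \<in> U \<Longrightarrow> \<xi> i x = 0" "\<And>i j. i < n \<Longrightarrow> j < n \<Longrightarrow> \<xi> i (b j) = (if i = j then 1 else 0)"
    "\<And>x. x \<in> V \<Longrightarrow> x - (\<Sum>i<n. \<xi> i x *\<^sub>R b i) \<in> U"
  using assms unfolding rel_coords_def by auto

lemma rel_coords_apply:
  assumes rc: "rel_coords V U n b \<xi>" and T: "linear T" "T ` U \<subseteq> U" and "x \<in> V" "i < n"
  shows "\<xi> i (T x) = (\<Sum>j<n. \<xi> i (T (b j)) * \<xi> j x)"
proof -
  have "T (x - (\<Sum>j<n. \<xi> j x *\<^sub>R b j)) \<in> U" using rel_coordsD(8)[OF rc] assms by blast
  then have "\<xi> i (T (x - (\<Sum>j<n. \<xi> j x *\<^sub>R b j))) = 0" using rel_coordsD(6)[OF rc] assms by blast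
  then show ?thesis using rel_coordsD(5)[OF rc \<open>i < n\<close>] T(1)
    by (simp add: linear_diff linear_sum linear_cmul mult.commute)
qed

lemma rel_coords_zero:
  assumes rc: "rel_coords V U n b \<xi>" and "x \<in> V" "\<And>i. i < n \<Longrightarrow> \<xi> i x = 0"
  shows "x \<in> U"
  using rel_coordsD(8)[OF rc assms(2)] assms(3) by simp

context fd_lie_algebra
begin

definition ad_matrix :: "(nat \<Rightarrow> 'a) \<Rightarrow> (nat \<Rightarrow> 'a \<Rightarrow> real) \<Rightarrow> 'a \<Rightarrow> nat \<Rightarrow> nat \<Rightarrow> complex"
  where "ad_matrix b \<xi> x i j = complex_of_real (\<xi> i (bracket x (b j)))"

lemma ad_matrix_mult:
  assumes rc: "rel_coords V U n b \<xi>" and "\<And>v. v \<in> V \<Longrightarrow> bracket y v \<in> V" "\<And>v. v \<in> U \<Longrightarrow> bracket x v \<in> U"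
    and "i < n" "j < n"
  shows "mmul n (ad_matrix b \<xi> x) (ad_matrix b \<xi> y) i j = complex_of_real (\<xi> i (bracket x (bracket y (b j))))"
proof -
  have "\<xi> i (bracket x (bracket y (b j))) = (\<Sum>k<n. \<xi> i (bracket x (b k)) * \<xi> k (bracket y (b j)))"
    by (rule rel_coords_apply[OF rc linear_br]) (use assms rel_coordsD(4)[OF rc] in auto)
  then show ?thesis by (simp add: mmul_def ad_matrix_def)
qed

lemma ad_matrix_bracket:
  assumes rc: "rel_coords V U n b \<xi>" and "\<And>x v. v \<in> V \<Longrightarrow> bracket x v \<in> V" "\<And>x v. v \<in> U \<Longrightarrow> bracket x v \<in> U"
    and "i < n" "j < n"
  shows "ad_matrix b \<xi> (bracket x y) i j =
    mmul n (ad_matrix b \<xi> x) (ad_matrix b \<xi> y) i j - mmul n (ad_matrix b \<xi> y) (ad_matrix b \<xi> x) i j"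
proof -
  have "mmul n (ad_matrix b \<xi> x) (ad_matrix b \<xi> y) i j = complex_of_real (\<xi> i (bracket x (bracket y (b j))))" for x y
    using assms by (intro ad_matrix_mult[OF rc]) auto
  then show ?thesis
    using br_jacobi[of x y "b j"] rel_coordsD(5)[OF rc \<open>i < n\<close>] by (simp add: ad_matrix_def linear_add)
qed

lemma ad_matrix_iterate:
  assumes rc: "rel_coords V U n b \<xi>" and "\<And>v. v \<in> V \<Longrightarrow> bracket z v \<in> V" "\<And>v. v \<in> U \<Longrightarrow> bracket z v \<in> U"
    and "v \<in> V" "i < n"
  shows "complex_of_real (\<xi> i ((bracket z ^^ Suc m) v)) =
    (\<Sum>j<n. ad_matrix b \<xi> z i j * complex_of_real (\<xi> j ((bracket z ^^ m) v)))"
proof -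
  have "(bracket z ^^ m) v \<in> V" using assms(2,4) by (induction m) auto
  then have "\<xi> i (bracket z ((bracket z ^^ m) v)) = (\<Sum>j<n. \<xi> i (bracket z (b j)) * \<xi> j ((bracket z ^^ m) v))"
    by (intro rel_coords_apply[OF rc linear_br]) (use assms in auto)
  then show ?thesis by (simp add: ad_matrix_def)
qed

definition ad_trace :: "nat \<Rightarrow> (nat \<Rightarrow> 'a) \<Rightarrow> (nat \<Rightarrow> 'a \<Rightarrow> real) \<Rightarrow> (nat \<Rightarrow> nat \<Rightarrow> complex) \<Rightarrow> 'a \<Rightarrow> complex"
  where "ad_trace n b \<xi> E x = (\<Sum>i<n. mmul n (ad_matrix b \<xi> x) E i i)"

lemma linear_ad_trace:
  assumes rc: "rel_coords V U n b \<xi>"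
  shows "linear (ad_trace n b \<xi> E)"
  by (rule linearI)
    (simp_all add: ad_trace_def mmul_def ad_matrix_def br_add br_scale linear_add[OF rel_coordsD(5)[OF rc]]
      linear_cmul[OF rel_coordsD(5)[OF rc]] distrib_right sum.distrib scaleR_conv_of_real sum_distrib_left mult.assoc)

text \<open>The form in which Lie's theorem enters. On V / U the element z commutes with each y in
  S, hence so does E, and tr([X, Y] E) = tr(X [Y, E]) = 0. As z is a sum of brackets [x, y], this
  gives tr(Z E) = 0 and therefore nilpotency.\<close>

lemma commutator_nilpotent:
  assumes rc: "rel_coords V U n b \<xi>" and V: "lie_ideal bracket V" and U: "lie_ideal bracket U"
    and comm: "\<And>y v. y \<in> S \<Longrightarrow> v \<in> V \<Longrightarrow> bracket (bracket z y) v \<in> U"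
    and z: "z \<in> span {bracket x y |x y. y \<in> S}" and v: "v \<in> V"
  shows "(bracket z ^^ n) v \<in> U"
proof -
  note VU = lie_ideal_right[OF V] lie_ideal_right[OF U]
  obtain E where E: "\<And>a. meq n (mmul n (ad_matrix b \<xi> z) a) (mmul n a (ad_matrix b \<xi> z)) \<Longrightarrow> meq n (mmul n E a) (mmul n a E)"
    and "\<And>g. mderivation n (ad_matrix b \<xi> z) g \<Longrightarrow> mderivation n E g"
    and nil: "\<And>w i. (\<Sum>i<n. mmul n (ad_matrix b \<xi> z) E i i) = 0 \<Longrightarrow>
        (\<And>m i. i < n \<Longrightarrow> w (Suc m) i = (\<Sum>j<n. ad_matrix b \<xi> z i j * w m j)) \<Longrightarrow> i < n \<Longrightarrow> w n i = (0::complex)"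
    by (rule conj_semisimple_part[of n "ad_matrix b \<xi> z"]) blast
  have "ad_trace n b \<xi> E (bracket x y) = 0" if y: "y \<in> S" for x y
  proof -
    let ?X = "ad_matrix b \<xi> x" and ?Y = "ad_matrix b \<xi> y"
    have "meq n (mmul n (ad_matrix b \<xi> z) ?Y) (mmul n ?Y (ad_matrix b \<xi> z))"
      unfolding meq_def
    proof (intro allI impI)
      fix i j assume ij: "i < n" "j < n"
      have "\<xi> i (bracket (bracket z y) (b j)) = 0"
        using comm[OF y] rel_coordsD(4)[OF rc ij(2)] rel_coordsD(6)[OF rc ij(1)] by blast
      then have "ad_matrix b \<xi> (bracket z y) i j = 0" unfolding ad_matrix_def by simp
      then show "mmul n (ad_matrix b \<xi> z) ?Y i j = mmul n ?Y (ad_matrix b \<xi> z) i j"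
        using ad_matrix_bracket[OF rc VU ij, of z y] by simp
    qed
    then have EY: "meq n (mmul n E ?Y) (mmul n ?Y E)" by (rule E)
    have "ad_trace n b \<xi> E (bracket x y) = (\<Sum>i<n. mmul n (mmul n ?X ?Y) E i i) - (\<Sum>i<n. mmul n (mmul n ?Y ?X) E i i)"
      unfolding ad_trace_def mmul_def[of n _ E]
      by (simp add: ad_matrix_bracket[OF rc VU] left_diff_distrib sum_subtractf)
    also have "(\<Sum>i<n. mmul n (mmul n ?X ?Y) E i i) = (\<Sum>i<n. mmul n ?X (mmul n E ?Y) i i)"
      unfolding mmul_assoc by (rule mtrace_cong[OF meq_mmul[OF meq_refl meq_sym[OF EY]]])
    also have "\<dots> = (\<Sum>i<n. mmul n (mmul n ?X E) ?Y i i)" by (simp only: mmul_assoc)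
    also have "\<dots> = (\<Sum>i<n. mmul n ?Y (mmul n ?X E) i i)" by (rule mtrace_comm)
    finally show ?thesis by (simp add: mmul_assoc)
  qed
  then have "ad_trace n b \<xi> E z = 0"
    by (intro linear_eq_0_on_span[OF linear_ad_trace[OF rc] _ z]) blast
  then have tr: "(\<Sum>i<n. mmul n (ad_matrix b \<xi> z) E i i) = 0" by (simp add: ad_trace_def)
  have "\<xi> i ((bracket z ^^ n) v) = 0" if "i < n" for i
    using nil[OF tr, of "\<lambda>m i. complex_of_real (\<xi> i ((bracket z ^^ m) v))" i]
      ad_matrix_iterate[OF rc VU v] that by (simp del: funpow.simps)
  moreover have "(bracket z ^^ m) v \<in> V" for m using VU(1) v by (induction m) auto
  ultimately show ?thesis using rel_coords_zero[OF rc] by blast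
qed

text \<open>Cartan's criterion. For h in P that is not ad-nilpotent, E is a derivation of the
  complexified P, so tr(ad [x, y] E) = - tr(ad x ad (E y)). This is zero because the Killing form of
  P vanishes. Since h is a sum of brackets, tr(ad h E) = 0, and h would be nilpotent after
  all.\<close>

lemma cartan_perfect:
  assumes P: "bracket_span P P = P" "P \<noteq> {0}" and rc: "rel_coords P {0} n b \<xi>"
    and B: "\<And>x y. x \<in> P \<Longrightarrow> y \<in> P \<Longrightarrow> ctrace n b \<xi> (\<lambda>v. bracket x (bracket y v)) = 0"
  shows False
proof -
  have sP: "subspace P" by (rule rel_coordsD(1)[OF rc])
  obtain h v where hv: "h \<in> P" "v \<in> P" "\<And>m. (bracket h ^^ m) v \<noteq> 0"
    using perfect_not_nil[OF sP P] by blast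
  have PP: "bracket x y \<in> P" if "x \<in> P" "y \<in> P" for x y using bracket_in_span[OF that] P(1) by simp
  have Z: "\<And>x v. v \<in> {0} \<Longrightarrow> bracket x v \<in> {0}" by (simp add: br_zero)
  have bP: "b i \<in> P" if "i < n" for i using rel_coordsD(4)[OF rc that] .
  have ex: "x = (\<Sum>i<n. \<xi> i x *\<^sub>R b i)" if "x \<in> P" for x using rel_coordsD(8)[OF rc that] by simp
  \<comment> \<open>The structure constants of P: M is a derivation of them by the Jacobi
    identity.\<close>
  define g where "g e i j = ad_matrix b \<xi> (b i) e j" for e i j
  let ?M = "ad_matrix b \<xi> h"
  obtain E where "\<And>a. meq n (mmul n ?M a) (mmul n a ?M) \<Longrightarrow> meq n (mmul n E a) (mmul n a E)"
    and E: "\<And>g. mderivation n ?M g \<Longrightarrow> mderivation n E g"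
    and nil: "\<And>w i. (\<Sum>i<n. mmul n ?M E i i) = 0 \<Longrightarrow>
        (\<And>m i. i < n \<Longrightarrow> w (Suc m) i = (\<Sum>j<n. ?M i j * w m j)) \<Longrightarrow> i < n \<Longrightarrow> w n i = (0::complex)"
    by (rule conj_semisimple_part[of n ?M]) blast
  have "mderivation n ?M g"
    unfolding mderivation_def
  proof (intro allI impI)
    fix e i j assume eij: "e < n" "i < n" "j < n"
    have "\<xi> e (bracket h (bracket (b i) (b j))) = (\<Sum>d<n. \<xi> e (bracket h (b d)) * \<xi> d (bracket (b i) (b j)))"
      by (rule rel_coords_apply[OF rc linear_br]) (use eij bP PP in \<open>auto simp: br_zero\<close>)
    moreover have "\<xi> e (bracket (bracket h (b i)) (b j)) = (\<Sum>k<n. \<xi> e (bracket (b k) (b j)) * \<xi> k (bracket h (b i)))"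
      by (rule rel_coords_apply[OF rc linear_br_left]) (use eij bP PP hv in \<open>auto simp: br_zero\<close>)
    moreover have "\<xi> e (bracket (b i) (bracket h (b j))) = (\<Sum>l<n. \<xi> e (bracket (b i) (b l)) * \<xi> l (bracket h (b j)))"
      by (rule rel_coords_apply[OF rc linear_br]) (use eij bP PP hv in \<open>auto simp: br_zero\<close>)
    moreover have "\<xi> e (bracket h (bracket (b i) (b j))) =
        \<xi> e (bracket (bracket h (b i)) (b j)) + \<xi> e (bracket (b i) (bracket h (b j)))"
      using br_jacobi[of h "b i" "b j"] rel_coordsD(5)[OF rc eij(1)] by (simp add: linear_add)
    ultimately have "(\<Sum>d<n. \<xi> e (bracket h (b d)) * \<xi> d (bracket (b i) (b j))) =
        (\<Sum>k<n. \<xi> e (bracket (b k) (b j)) * \<xi> k (bracket h (b i))) +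
        (\<Sum>l<n. \<xi> e (bracket (b i) (b l)) * \<xi> l (bracket h (b j)))" by simp
    then have "complex_of_real (\<Sum>d<n. \<xi> e (bracket h (b d)) * \<xi> d (bracket (b i) (b j))) =
        complex_of_real ((\<Sum>k<n. \<xi> e (bracket (b k) (b j)) * \<xi> k (bracket h (b i))) +
        (\<Sum>l<n. \<xi> e (bracket (b i) (b l)) * \<xi> l (bracket h (b j))))" by (rule arg_cong)
    then show "(\<Sum>d<n. ?M e d * g d i j) = (\<Sum>k<n. ?M k i * g e k j) + (\<Sum>l<n. ?M l j * g e i l)"
      unfolding g_def ad_matrix_def by (simp add: mult.commute)
  qed
  then have dE: "mderivation n E g" by (rule E)
  have tbb: "ad_trace n b \<xi> E (bracket (b p) (b q)) = 0" if pq: "p < n" "q < n" for p q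
  proof -
    let ?Y = "\<lambda>i. ad_matrix b \<xi> (b i)"
    have br: "ad_matrix b \<xi> (bracket (b p) (b q)) i j = mmul n (?Y p) (?Y q) i j - mmul n (?Y q) (?Y p) i j"
      if "i < n" "j < n" for i j
    proof -
      have "mmul n (?Y p) (?Y q) i j = complex_of_real (\<xi> i (bracket (b p) (bracket (b q) (b j))))"
        "mmul n (?Y q) (?Y p) i j = complex_of_real (\<xi> i (bracket (b q) (bracket (b p) (b j))))"
        using that pq by (auto intro!: ad_matrix_mult[OF rc] PP bP simp: br_zero)
      then show ?thesis unfolding ad_matrix_def
        using br_jacobi[of "b p" "b q" "b j"] rel_coordsD(5)[OF rc \<open>i < n\<close>] by (simp add: linear_add)
    qed
    \<comment> \<open>The derivation property of E read as [E, ad y] = ad (E y) for y =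
      \<open>b q\<close>; E y has complex coordinates, so it is written out in the basis.\<close>
    have EY: "mmul n E (?Y q) i j = (\<Sum>k<n. E k q * ?Y k i j) + mmul n (?Y q) E i j" if "i < n" "j < n" for i j
      using dE that pq unfolding mderivation_def g_def mmul_def by (simp add: mult.commute)
    have tr0: "(\<Sum>i<n. mmul n (?Y p) (?Y k) i i) = 0" if "k < n" for k
    proof -
      have "mmul n (?Y p) (?Y k) i i = complex_of_real (\<xi> i (bracket (b p) (bracket (b k) (b i))))" if "i < n" for i
        using that \<open>k < n\<close> pq by (auto intro!: ad_matrix_mult[OF rc] PP bP simp: br_zero)
      then have "(\<Sum>i<n. mmul n (?Y p) (?Y k) i i) = complex_of_real (ctrace n b \<xi> (\<lambda>v. bracket (b p) (bracket (b k) v)))"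
        unfolding ctrace_def by simp
      then show ?thesis using B bP pq that by simp
    qed
    have "ad_trace n b \<xi> E (bracket (b p) (b q)) =
        (\<Sum>i<n. mmul n (mmul n (?Y p) (?Y q)) E i i) - (\<Sum>i<n. mmul n (mmul n (?Y q) (?Y p)) E i i)"
      unfolding ad_trace_def mmul_def[of n _ E] by (simp add: br left_diff_distrib sum_subtractf)
    also have "(\<Sum>i<n. mmul n (mmul n (?Y q) (?Y p)) E i i) = (\<Sum>i<n. mmul n (?Y q) (mmul n (?Y p) E) i i)"
      by (simp only: mmul_assoc)
    also have "\<dots> = (\<Sum>i<n. mmul n (mmul n (?Y p) E) (?Y q) i i)" by (rule mtrace_comm)
    also have "\<dots> = (\<Sum>i<n. mmul n (?Y p) (mmul n E (?Y q)) i i)" by (simp only: mmul_assoc)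
    also have "\<dots> = (\<Sum>i<n. mmul n (?Y p) (\<lambda>i j. (\<Sum>k<n. E k q * ?Y k i j) + mmul n (?Y q) E i j) i i)"
      by (intro mtrace_cong meq_mmul meq_refl) (simp add: meq_def EY)
    also have "\<dots> = (\<Sum>i<n. mmul n (?Y p) (\<lambda>i j. \<Sum>k<n. E k q * ?Y k i j) i i) + (\<Sum>i<n. mmul n (?Y p) (mmul n (?Y q) E) i i)"
      unfolding mmul_def[of n "?Y p"] by (simp add: distrib_left sum.distrib)
    also have "(\<Sum>i<n. mmul n (?Y p) (\<lambda>i j. \<Sum>k<n. E k q * ?Y k i j) i i) = (\<Sum>i<n. \<Sum>k<n. E k q * mmul n (?Y p) (?Y k) i i)"
    proof (rule sum.cong[OF refl])
      fix i
      have "mmul n (?Y p) (\<lambda>i j. \<Sum>k<n. E k q * ?Y k i j) i i = (\<Sum>d<n. \<Sum>k<n. E k q * (?Y p i d * ?Y k d i))"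
        unfolding mmul_def by (simp add: sum_distrib_left mult_ac)
      also have "\<dots> = (\<Sum>k<n. \<Sum>d<n. E k q * (?Y p i d * ?Y k d i))" by (rule sum.swap)
      finally show "mmul n (?Y p) (\<lambda>i j. \<Sum>k<n. E k q * ?Y k i j) i i = (\<Sum>k<n. E k q * mmul n (?Y p) (?Y k) i i)"
        by (simp add: mmul_def sum_distrib_left)
    qed
    also have "(\<Sum>i<n. \<Sum>k<n. E k q * mmul n (?Y p) (?Y k) i i) = (\<Sum>k<n. E k q * (\<Sum>i<n. mmul n (?Y p) (?Y k) i i))"
      by (subst sum.swap) (simp add: sum_distrib_left)
    also have "\<dots> = 0" using tr0 by simp
    finally show ?thesis by (simp add: mmul_assoc)
  qed
  have txy: "ad_trace n b \<xi> E (bracket x y) = 0" if "x \<in> P" "y \<in> P" for x y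
  proof -
    have "bracket x y = (\<Sum>q<n. \<Sum>p<n. (\<xi> p x * \<xi> q y) *\<^sub>R bracket (b p) (b q))"
      by (subst ex[OF that(1)], subst ex[OF that(2)]) (simp add: br_sum br_scale scaleR_sum_right mult_ac)
    then show ?thesis
      using linear_ad_trace[OF rc, of E] tbb by (simp add: linear_sum linear_cmul)
  qed
  have "h \<in> span {bracket x y |x y. x \<in> P \<and> y \<in> P}" using hv(1) P(1) unfolding bracket_span_def by simp
  then have "ad_trace n b \<xi> E h = 0"
    by (rule linear_eq_0_on_span[OF linear_ad_trace[OF rc], rotated]) (use txy in blast)
  then have tr: "(\<Sum>i<n. mmul n ?M E i i) = 0" by (simp add: ad_trace_def)
  have hP: "\<And>v. v \<in> P \<Longrightarrow> bracket h v \<in> P" using PP hv by blast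
  have "\<xi> i ((bracket h ^^ n) v) = 0" if "i < n" for i
    using nil[OF tr, of "\<lambda>m i. complex_of_real (\<xi> i ((bracket h ^^ m) v))" i]
      ad_matrix_iterate[OF rc hP Z hv(2)] that by (simp del: funpow.simps)
  moreover have "(bracket h ^^ m) v \<in> P" for m using hP hv by (induction m) auto
  ultimately have "(bracket h ^^ n) v \<in> {0}" using rel_coords_zero[OF rc] by blast
  then show False using hv(3) by blast
qed


section \<open>The derived series and nilpotency of the derived algebra of a solvable
  algebra\<close>

primrec derived :: "nat \<Rightarrow> 'a set"
  where "derived 0 = UNIV" | "derived (Suc m) = bracket_span (derived m) (derived m)"

lemma lie_ideal_UNIV: "lie_ideal bracket UNIV"
  unfolding lie_ideal_def by simp

lemma lie_ideal_zero: "lie_ideal bracket {0}"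
  unfolding lie_ideal_def by (simp add: br_zero)

lemma lie_ideal_derived: "lie_ideal bracket (derived m)"
  by (induction m) (auto intro: lie_ideal_UNIV lie_ideal_bracket_span)

lemma derived_Suc_subset: "derived (Suc m) \<subseteq> derived m"
  using bracket_span_minimal[OF lie_ideal_subspace[OF lie_ideal_derived]] lie_ideal_right[OF lie_ideal_derived]
  by simp

lemma derived_antimono: "i \<le> j \<Longrightarrow> derived j \<subseteq> derived i"
  by (induction rule: dec_induct) (use derived_Suc_subset in blast)+

lemma nilpotent_kernel:
  assumes "(bracket z ^^ n) v \<in> U" "v \<in> W" "v \<notin> U" "\<And>w. w \<in> W \<Longrightarrow> bracket z w \<in> W"
  shows "\<exists>w\<in>W - U. bracket z w \<in> U"
proof -
  define l where "l = (LEAST l. (bracket z ^^ l) v \<in> U)"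
  have l: "(bracket z ^^ l) v \<in> U" unfolding l_def using assms(1) by (rule LeastI)
  then have "l \<noteq> 0" using assms(3) by (intro notI) simp
  then obtain k where k: "l = Suc k" using not0_implies_Suc by blast
  have "(bracket z ^^ k) v \<notin> U" using not_less_Least[of k] k unfolding l_def by (metis lessI)
  moreover have "(bracket z ^^ k) v \<in> W" using assms(2,4) by (induction k) auto
  ultimately show ?thesis using l k by auto
qed

text \<open>
  A nonzero irreducible module \<open>V / U\<close> of a solvable algebra is killed by \<open>[\<g>, \<g>]\<close>: otherwise let \<open>A\<close>
  be the last derived algebra that acts nontrivially. The elements of \<open>[\<g>, A]\<close> act by commuting nilpotent
  maps, so they act by zero; hence \<open>A\<close> acts by central elements, which are nilpotent too.
\<close>

lemma solvable_irreducible: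
  assumes sol: "derived m = {0}"
    and V: "lie_ideal bracket V" and U: "lie_ideal bracket U" and UV: "U \<subset> V"
    and min: "\<And>I. lie_ideal bracket I \<Longrightarrow> U \<subseteq> I \<Longrightarrow> I \<subseteq> V \<Longrightarrow> I = U \<or> I = V"
    and "x \<in> derived 1" "v \<in> V"
  shows "bracket x v \<in> U"
proof (rule ccontr)
  assume not: "bracket x v \<notin> U"
  note sU = lie_ideal_subspace[OF U] and sV = lie_ideal_subspace[OF V]
  obtain n b \<xi> where rc: "rel_coords V U n b \<xi>" by (rule coords[OF sV sU psubset_imp_subset[OF UV]])
  define Q where "Q j \<longleftrightarrow> (\<exists>x\<in>derived j. \<exists>v\<in>V. bracket x v \<notin> U)" for j
  have Qm: "\<not> Q j" if "m \<le> j" for j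
    using derived_antimono[OF that] sol sU by (auto simp: Q_def br_zero real_vector.subspace_0)
  have Q1: "Q 1" using not assms(6,7) unfolding Q_def by blast
  define j where "j = (GREATEST j. Q j)"
  have j: "Q j" "1 \<le> j" "\<not> Q (Suc j)"
  proof -
    have bound: "\<And>y. Q y \<Longrightarrow> y \<le> m" using Qm nat_le_linear by blast
    show "Q j" unfolding j_def using Q1 bound by (rule GreatestI_nat)
    show "1 \<le> j" unfolding j_def using Q1 bound by (rule Greatest_le_nat)
    show "\<not> Q (Suc j)"
    proof
      assume "Q (Suc j)"
      then have "Suc j \<le> j" unfolding j_def using bound by (rule Greatest_le_nat)
      then show False by simp
    qed
  qed
  define A where "A = derived j"
  have A: "lie_ideal bracket A" unfolding A_def by (rule lie_ideal_derived)
  \<comment> \<open>[A, A] is the next derived algebra, which acts trivially on V / U by the choice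
    of j.\<close>
  have AA: "bracket (bracket a c) v \<in> U" if "a \<in> A" "c \<in> A" "v \<in> V" for a c v
    using j(3) that bracket_in_span[of a A c A] unfolding Q_def A_def by auto
  have nil1: "(bracket (bracket x a) ^^ n) v \<in> U" if "a \<in> A" "v \<in> V" for x a v
  proof (rule commutator_nilpotent[OF rc V U])
    show "bracket (bracket (bracket x a) y) v \<in> U" if "y \<in> {a}" "v \<in> V" for y v
      using that \<open>a \<in> A\<close> AA lie_ideal_right[OF A] by blast
    show "bracket x a \<in> span {bracket x y |x y. y \<in> {a}}" by (rule real_vector.span_base) blast
  qed fact
  \<comment> \<open>W will be a minimal A-submodule above U. An element z = [x, a] commutes with A
    on V / U, so the vectors of W that z sends into U form an A-submodule. It exceeds U as z is
    nilpotent, hence it is W.\<close>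
  define R where "R W \<longleftrightarrow> subspace W \<and> U \<subset> W \<and> W \<subseteq> V \<and> (\<forall>a\<in>A. \<forall>w\<in>W. bracket a w \<in> W)" for W
  have "R V" unfolding R_def using sV UV lie_ideal_right[OF V] by auto
  then obtain W where W: "R W" "\<And>W'. R W' \<Longrightarrow> dim W \<le> dim W'"
    using ex_has_least_nat[of R V dim] by blast
  have Wkill: "bracket (bracket x a) w \<in> U" if aw: "a \<in> A" "w \<in> W" for x a w
  proof -
    let ?z = "bracket x a"
    have z: "?z \<in> A" using that lie_ideal_right[OF A] by blast
    define K where "K = {w\<in>W. bracket ?z w \<in> U}"
    obtain w0 where w0: "w0 \<in> W" "w0 \<notin> U" using W(1) unfolding R_def by blast
    then obtain w1 where w1: "w1 \<in> W - U" "bracket ?z w1 \<in> U"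
      using nilpotent_kernel[where z = ?z and v = w0 and U = U and W = W and n = n] nil1[OF aw(1)] W(1) z unfolding R_def by blast
    have "R K"
      unfolding R_def
    proof (intro conjI ballI)
      show "subspace K"
        unfolding K_def real_vector.subspace_def using W(1) sU
        by (auto simp: R_def br_zero br_add br_scale real_vector.subspace_0 real_vector.subspace_add real_vector.subspace_scale)
      show "U \<subset> K" using W(1) w1 lie_ideal_right[OF U] unfolding K_def R_def by blast
      show "K \<subseteq> V" using W(1) unfolding K_def R_def by blast
      fix a' w assume aw: "a' \<in> A" "w \<in> K"
      have "bracket (bracket ?z a') w \<in> U" using AA z aw W(1) unfolding K_def R_def by blast
      moreover have "bracket a' (bracket ?z w) \<in> U" using aw lie_ideal_right[OF U] unfolding K_def by blast
      ultimately have "bracket ?z (bracket a' w) \<in> U"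
        unfolding br_jacobi[of ?z a'] using sU by (simp only: real_vector.subspace_add)
      then show "bracket a' w \<in> K" using aw W(1) unfolding K_def R_def by blast
    qed
    then have "K = W" using W unfolding R_def K_def by (intro subspace_dim_eq) (auto simp: R_def)
    then show ?thesis using that unfolding K_def by blast
  qed
  \<comment> \<open>The part of V killed by [g, A] modulo U is an ideal of g and contains W, so
    irreducibility makes it V.\<close>
  define M where "M = {v\<in>V. \<forall>x. \<forall>a\<in>A. bracket (bracket x a) v \<in> U}"
  have "lie_ideal bracket M"
    unfolding lie_ideal_def
  proof (intro conjI allI ballI)
    show "subspace M"
      unfolding M_def real_vector.subspace_def using sV sU
      by (auto simp: br_zero br_add br_scale real_vector.subspace_0 real_vector.subspace_add real_vector.subspace_scale)
    fix y v assume v: "v \<in> M"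
    have "bracket (bracket x a) (bracket y v) \<in> U" if "a \<in> A" for x a
    proof -
      have "bracket x a \<in> A" using that lie_ideal_right[OF A] by blast
      then have "bracket (bracket y (bracket x a)) v \<in> U" using v unfolding M_def by blast
      then have "bracket (bracket (bracket x a) y) v \<in> U"
        using br_skew[of "bracket x a" y] sU by (simp add: br_minus real_vector.subspace_neg)
      moreover have "bracket y (bracket (bracket x a) v) \<in> U" using v that lie_ideal_right[OF U] unfolding M_def by blast
      ultimately show ?thesis unfolding br_jacobi[of "bracket x a" y] using sU by (simp only: real_vector.subspace_add)
    qed
    then show "bracket y v \<in> M" using v lie_ideal_right[OF V] unfolding M_def by blast
  qed
  moreover have "U \<subseteq> M" using UV lie_ideal_right[OF U] unfolding M_def by blast
  moreover have "M \<subseteq> V" unfolding M_def by blast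
  moreover have "M \<noteq> U" using W(1) Wkill unfolding R_def M_def by blast
  ultimately have M: "M = V" using min by blast
  have central: "bracket (bracket a y) v \<in> U" if "a \<in> A" "v \<in> V" for a y v
  proof -
    have "bracket (bracket y a) v \<in> U" using that M unfolding M_def by blast
    then show ?thesis using br_skew[of a y] sU by (simp add: br_minus real_vector.subspace_neg)
  qed
  have "bracket a v \<in> U" if a: "a \<in> A" and "v \<in> V" for a v
  proof -
    have a1: "a \<in> derived 1" using a derived_antimono[OF j(2)] unfolding A_def by blast
    \<comment> \<open>Here a lies in [g, g] and commutes with all of g on V / U, so the set S of
      \<open>commutator_nilpotent\<close> may be the whole algebra.\<close>
    have nil: "(bracket a ^^ n) v \<in> U" if "v \<in> V" for v
    proof (rule commutator_nilpotent[OF rc V U])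
      show "bracket (bracket a y) v \<in> U" if "y \<in> UNIV" "v \<in> V" for y v using central a that by blast
      show "a \<in> span {bracket x y |x y. y \<in> UNIV}" using a1 by (simp add: bracket_span_def)
    qed fact
    define K where "K = {v\<in>V. bracket a v \<in> U}"
    obtain v0 where "v0 \<in> V" "v0 \<notin> U" using UV by blast
    then obtain v1 where v1: "v1 \<in> V - U" "bracket a v1 \<in> U"
      using nilpotent_kernel[where z = a and v = v0 and U = U and W = V and n = n] nil lie_ideal_right[OF V] by blast
    have "lie_ideal bracket K"
      unfolding lie_ideal_def
    proof (intro conjI allI ballI)
      show "subspace K"
        unfolding K_def real_vector.subspace_def using sV sU
        by (auto simp: br_zero br_add br_scale real_vector.subspace_0 real_vector.subspace_add real_vector.subspace_scale)
      fix y v assume v: "v \<in> K"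
      have "bracket (bracket a y) v \<in> U" using central a v unfolding K_def by blast
      moreover have "bracket y (bracket a v) \<in> U" using v lie_ideal_right[OF U] unfolding K_def by blast
      ultimately have "bracket a (bracket y v) \<in> U"
        unfolding br_jacobi[of a y] using sU by (simp only: real_vector.subspace_add)
      then show "bracket y v \<in> K" using v lie_ideal_right[OF V] unfolding K_def by blast
    qed
    moreover have "U \<subseteq> K" "K \<subseteq> V" "K \<noteq> U" using UV v1 lie_ideal_right[OF U] unfolding K_def by blast+
    ultimately have "K = V" using min by blast
    then show ?thesis using \<open>v \<in> V\<close> unfolding K_def by blast
  qed
  then show False using j(1) unfolding Q_def A_def by blast
qed

text \<open>The lower central series of V as a module over K. Keeping the two arguments apart allows
  an induction over ideals V with K fixed.\<close>

primrec act :: "'a set \<Rightarrow> 'a set \<Rightarrow> nat \<Rightarrow> 'a set"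
  where "act K V 0 = V" | "act K V (Suc m) = bracket_span K (act K V m)"

lemma lower_central_eq_act: "lower_central bracket S m = act S S m"
  by (induction m) (simp_all add: bracket_span_def)

lemma act_Suc_right: "act K V (Suc m) = act K (bracket_span K V) m"
  by (induction m) simp_all

lemma bracket_span_mono: "A \<subseteq> A' \<Longrightarrow> B \<subseteq> B' \<Longrightarrow> bracket_span A B \<subseteq> bracket_span A' B'"
  unfolding bracket_span_def by (rule real_vector.span_mono) blast

lemma act_mono: "K \<subseteq> K' \<Longrightarrow> V \<subseteq> V' \<Longrightarrow> act K V m \<subseteq> act K' V' m"
  by (induction m) (simp_all add: bracket_span_mono)

text \<open>By induction on dimension [g, g] acts nilpotently on every ideal I: for a maximal ideal
  U properly inside I the module I / U is irreducible, so [g, g] sends I into U. The case I = [g, g]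
  is the claim.\<close>

lemma solvable_derived_nilpotent:
  assumes sol: "derived m = {0}"
  shows "nilpotent_on bracket (derived 1)"
proof -
  have "\<exists>m. act (derived 1) I m = {0}" if "lie_ideal bracket I" for I
    using that
  proof (induction "dim I" arbitrary: I rule: less_induct)
    case less
    show ?case
    proof (cases "I = {0}")
      case True
      then show ?thesis by (intro exI[of _ 0]) simp
    next
      case False
      note sI = lie_ideal_subspace[OF less.prems]
      let ?Q = "\<lambda>J. lie_ideal bracket J \<and> J \<subset> I"
      have "?Q {0}" using False sI lie_ideal_zero by (auto simp: real_vector.subspace_0)
      moreover have "\<And>J. ?Q J \<Longrightarrow> subspace J" using lie_ideal_subspace by blast
      ultimately have "\<exists>U. ?Q U \<and> (\<forall>J. ?Q J \<longrightarrow> dim J \<le> dim U)"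
        by (rule bounded_dim_maximal[of ?Q "{0}"]) (assumption, rule exI, rule conjI, assumption, simp)
      then obtain U where U: "?Q U" and max: "\<And>J. ?Q J \<Longrightarrow> dim J \<le> dim U" by blast
      have sU: "subspace U" using U lie_ideal_subspace by blast
      have "dim U < dim I" using subspace_dim_eq[OF sI sU psubset_imp_subset] U by (metis less_irrefl not_le_imp_less)
      then have "\<exists>k. act (derived 1) U k = {0}" using less.hyps U by simp
      then obtain k where k: "act (derived 1) U k = {0}" ..
      have "bracket x v \<in> U" if "x \<in> derived 1" "v \<in> I" for x v
      proof (rule solvable_irreducible[OF sol less.prems _ _ _ that])
        fix J assume J: "lie_ideal bracket J" "U \<subseteq> J" "J \<subseteq> I"
        show "J = U \<or> J = I"
        proof (rule ccontr)
          assume ne: "\<not> (J = U \<or> J = I)"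
          then have "dim J \<le> dim U" using J max by blast
          then have "U = J" using J sU by (intro subspace_dim_eq) (auto intro: lie_ideal_subspace)
          then show False using ne by blast
        qed
      qed (use U in auto)
      then have "bracket_span (derived 1) I \<subseteq> U" by (intro bracket_span_minimal sU)
      then have "act (derived 1) I (Suc k) \<subseteq> {0}"
        unfolding act_Suc_right k[symmetric] by (intro act_mono order_refl)
      moreover have "0 \<in> act (derived 1) I (Suc k)" by (simp add: real_vector.subspace_0)
      ultimately show ?thesis by blast
    qed
  qed
  then show ?thesis unfolding nilpotent_on_def lower_central_eq_act using lie_ideal_derived by blast
qed

end

section \<open>Invariant forms and exactness of their 3-forms\<close>

lemma inj_endomorphism_surj:
  fixes f :: "'a::real_vector \<Rightarrow> 'a"
  assumes f: "linear f" "f ` S \<subseteq> S" and S: "subspace S" "S \<subseteq> span F" "finite F"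
    and inj: "\<And>x. x \<in> S \<Longrightarrow> f x = 0 \<Longrightarrow> x = 0"
  shows "f ` S = S"
proof -
  obtain B where B: "B \<subseteq> S" "independent B" "S \<subseteq> span B"
    using real_vector.maximal_independent_subset by blast
  have sp: "span B = S" using B S(1) by (simp add: real_vector.span_minimal subset_antisym)
  have finB: "finite B" using finite_independent_in_span[OF B(2) _ S(3)] B(1) S(2) by blast
  have injS: "inj_on f S"
  proof (rule inj_onI)
    fix x y assume "x \<in> S" "y \<in> S" "f x = f y"
    then have "f (x - y) = 0" "x - y \<in> S" using f S by (auto simp: linear_diff real_vector.subspace_diff)
    then have "x - y = 0" using inj by blast
    then show "x = y" by simp
  qed
  have indep: "independent (f ` B)"
    using linear_independent_injective_image[OF f(1) B(2)] injS sp by simp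
  have card: "card (f ` B) = card B" using card_image[of f B] inj_on_subset[OF injS B(1)] by simp
  have sub: "f ` B \<subseteq> S" using B(1) f(2) by blast
  have "x \<in> span (f ` B)" if "x \<in> S" for x
  proof (rule ccontr)
    assume n: "x \<notin> span (f ` B)"
    then have "x \<notin> f ` B" using real_vector.span_base[of x "f ` B"] by argo
    moreover have "independent (insert x (f ` B))" using n indep by (simp add: real_vector.independent_insert)
    moreover have "insert x (f ` B) \<subseteq> span B" using sub that sp by simp
    ultimately show False
      using real_vector.independent_span_bound[OF finB, of "insert x (f ` B)"] card finB by simp
  qed
  then have "S \<subseteq> f ` S" using linear_span_image[OF f(1), of B] sp by auto
  then show ?thesis using f(2) by blast
qed

lemma surj_endomorphism_inj:
  fixes f :: "'a::real_vector \<Rightarrow> 'a"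
  assumes f: "linear f" "f ` S = S" and S: "subspace S" "S \<subseteq> span F" "finite F"
    and x: "x \<in> S" "f x = 0"
  shows "x = 0"
proof (rule ccontr)
  assume "x \<noteq> 0"
  then obtain B where B: "{x} \<subseteq> B" "B \<subseteq> S" "independent B" "S \<subseteq> span B"
    using real_vector.maximal_independent_subset_extend[of "{x}" S] x(1) by (auto simp: real_vector.dependent_single)
  have sp: "span B = S" using B S(1) by (simp add: real_vector.span_minimal subset_antisym)
  have finB: "finite B" using finite_independent_in_span[OF B(3) _ S(3)] B(2) S(2) by blast
  have "f ` S = span (f ` B)" using linear_span_image[OF f(1), of B] sp by simp
  also have "f ` B = insert 0 (f ` (B - {x}))" using B(1) x(2) by auto
  finally have "S = span (f ` (B - {x}))" using f(2) by (simp add: real_vector.span_insert_0)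
  then have "card B \<le> card (f ` (B - {x}))"
    using real_vector.independent_span_bound[OF _ B(3), of "f ` (B - {x})"] B(2) finB by simp
  also have "\<dots> \<le> card (B - {x})" using finB by (intro card_image_le) simp
  also have "\<dots> < card B" using B(1) finB by (intro psubset_card_mono) auto
  finally show False by simp
qed

text \<open>The number m of functionals equals dim P / K. Sending x to the combination of the c j
  with coefficients f j x is an endomorphism of the span of the c j; it is injective by the
  hypothesis on the common kernel, hence surjective.\<close>

lemma dual_vector_exists:
  assumes rc: "rel_coords P K m c \<eta>" and f: "\<And>j. j < m \<Longrightarrow> linear (f j)"
    and ker: "\<And>x. x \<in> P \<Longrightarrow> (\<And>j. j < m \<Longrightarrow> f j x = 0) \<Longrightarrow> x \<in> K"
  shows "\<exists>t\<in>P. \<forall>j<m. f j t = (a j :: real)"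
proof -
  define g where "g x = (\<Sum>j<m. f j x *\<^sub>R c j)" for x
  let ?S = "span (c ` {..<m})"
  have lin: "linear g" unfolding g_def
    by (rule linearI) (simp_all add: linear_add[OF f] linear_cmul[OF f] scaleR_left_distrib sum.distrib scaleR_sum_right)
  have cS: "c j \<in> ?S" if "j < m" for j using that by (intro real_vector.span_base) blast
  have gS: "g ` ?S \<subseteq> ?S" unfolding g_def by (auto intro!: real_vector.span_sum real_vector.span_scale cS)
  have SP: "?S \<subseteq> P" using rel_coordsD(1,4)[OF rc] by (intro real_vector.span_minimal) auto
  have \<eta>sum: "\<eta> i (\<Sum>j<m. a j *\<^sub>R c j) = a i" if "i < m" for i a
    using rel_coordsD(5,7)[OF rc] that
    by (simp add: linear_sum linear_cmul if_distrib[of "\<lambda>x. _ * x"] cong: if_cong)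
  have exp: "x = (\<Sum>i<m. \<eta> i x *\<^sub>R c i)" if "x \<in> ?S" for x
    using that
  proof (induction rule: real_vector.span_induct_alt)
    case base
    then show ?case using rel_coordsD(5)[OF rc] by (simp add: linear_0)
  next
    case (step r y z)
    obtain j where j: "j < m" "y = c j" using step(1) by blast
    have "y = (\<Sum>i<m. \<eta> i y *\<^sub>R c i)"
      using j rel_coordsD(7)[OF rc] by (simp add: if_distrib[of "\<lambda>x. x *\<^sub>R _"] cong: if_cong)
    then have "r *\<^sub>R y + z = r *\<^sub>R (\<Sum>i<m. \<eta> i y *\<^sub>R c i) + (\<Sum>i<m. \<eta> i z *\<^sub>R c i)" using step(2) by simp
    also have "\<dots> = (\<Sum>i<m. \<eta> i (r *\<^sub>R y + z) *\<^sub>R c i)"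
      using rel_coordsD(5)[OF rc]
      by (simp add: linear_add linear_cmul scaleR_left_distrib sum.distrib scaleR_sum_right)
    finally show ?case .
  qed
  have "g ` ?S = ?S"
  proof (rule inj_endomorphism_surj[OF lin gS])
    fix x assume x: "x \<in> ?S" "g x = 0"
    then have "f j x = 0" if "j < m" for j
      using \<eta>sum[OF that, of "\<lambda>j. f j x"] rel_coordsD(5)[OF rc that] by (simp add: g_def linear_0)
    then have "x \<in> K" using ker x SP by blast
    then show "x = 0" using exp[OF x(1)] rel_coordsD(6)[OF rc] by simp
  qed auto
  moreover have "(\<Sum>j<m. a j *\<^sub>R c j) \<in> ?S" by (auto intro!: real_vector.span_sum real_vector.span_scale cS)
  ultimately have "(\<Sum>j<m. a j *\<^sub>R c j) \<in> g ` ?S" by simp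
  then obtain t where t: "t \<in> ?S" "g t = (\<Sum>j<m. a j *\<^sub>R c j)" by auto
  have "f j t = a j" if "j < m" for j
    using \<eta>sum[OF that, of a] \<eta>sum[OF that, of "\<lambda>j. f j t"] t(2) unfolding g_def by simp
  then show ?thesis using t SP by blast
qed

section \<open>Alternating forms of degree two and three and their differentials\<close>

definition alt2 :: "('a::real_vector \<Rightarrow> 'a \<Rightarrow> real) \<Rightarrow> bool"
  where "alt2 \<omega> \<longleftrightarrow> bilinear \<omega> \<and> (\<forall>x. \<omega> x x = 0)"

definition alt3 :: "('a::real_vector \<Rightarrow> 'a \<Rightarrow> 'a \<Rightarrow> real) \<Rightarrow> bool"
  where "alt3 \<phi> \<longleftrightarrow> (\<forall>x y. linear (\<phi> x y)) \<and> (\<forall>x z. linear (\<lambda>y. \<phi> x y z)) \<and> (\<forall>y z. linear (\<lambda>x. \<phi> x y z)) \<and>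
    (\<forall>x y. \<phi> x x y = 0 \<and> \<phi> x y y = 0 \<and> \<phi> x y x = 0)"

lemma alt2_linear: "alt2 \<omega> \<Longrightarrow> linear (\<omega> x)" "alt2 \<omega> \<Longrightarrow> linear (\<lambda>x. \<omega> x y)" "alt2 \<omega> \<Longrightarrow> \<omega> x x = 0"
  by (simp_all add: alt2_def bilinear_def)

lemma alt2_skew: "alt2 \<omega> \<Longrightarrow> \<omega> x y = - \<omega> y x"
proof -
  assume a: "alt2 \<omega>"
  have "\<omega> (x + y) (x + y) = \<omega> x x + \<omega> x y + (\<omega> y x + \<omega> y y)"
    by (simp add: linear_add[OF alt2_linear(1)[OF a]] linear_add[OF alt2_linear(2)[OF a]])
  then show ?thesis by (simp add: alt2_linear(3)[OF a])
qed

context lie_algebra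
begin

text \<open>Curried versions of the Chevalley-Eilenberg differential; \<open>ce_d_form2\<close> and
  \<open>ce_d_form3\<close> connect \<open>d2\<close> and \<open>d3\<close> with
  \<open>ce_d\<close>.\<close>

definition d2 :: "('a \<Rightarrow> 'a \<Rightarrow> real) \<Rightarrow> 'a \<Rightarrow> 'a \<Rightarrow> 'a \<Rightarrow> real"
  where "d2 \<omega> x y z = - \<omega> (bracket x y) z + \<omega> (bracket x z) y - \<omega> (bracket y z) x"

definition d3 :: "('a \<Rightarrow> 'a \<Rightarrow> 'a \<Rightarrow> real) \<Rightarrow> 'a \<Rightarrow> 'a \<Rightarrow> 'a \<Rightarrow> 'a \<Rightarrow> real"
  where "d3 \<phi> x y z w = - \<phi> (bracket x y) z w + \<phi> (bracket x z) y w - \<phi> (bracket x w) y z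
    - \<phi> (bracket y z) x w + \<phi> (bracket y w) x z - \<phi> (bracket z w) x y"

definition H2_trivial :: bool
  where "H2_trivial \<longleftrightarrow> (\<forall>\<omega>. alt2 \<omega> \<and> (\<forall>x y z. d2 \<omega> x y z = 0) \<longrightarrow>
    (\<exists>\<theta>. linear \<theta> \<and> (\<forall>x y. \<omega> x y = - \<theta> (bracket x y))))"

definition H3_trivial :: bool
  where "H3_trivial \<longleftrightarrow> (\<forall>\<phi>. alt3 \<phi> \<and> (\<forall>x y z w. d3 \<phi> x y z w = 0) \<longrightarrow>
    (\<exists>\<omega>. alt2 \<omega> \<and> (\<forall>x y z. \<phi> x y z = d2 \<omega> x y z)))"

definition invariant_form :: "('a \<Rightarrow> 'a \<Rightarrow> real) \<Rightarrow> bool"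
  where "invariant_form B \<longleftrightarrow> bilinear B \<and> (\<forall>x y. B x y = B y x) \<and> (\<forall>x y z. B (bracket x y) z = B x (bracket y z))"

text \<open>The 3-form B([x, y], z) is closed: by invariance the six terms of its differential agree
  in pairs, and each half is B of a Jacobi expression and w.\<close>

lemma invariant_form_exact:
  assumes "H3_trivial" "invariant_form B"
  obtains \<omega> where "alt2 \<omega>" "\<And>x y z. B (bracket x y) z = d2 \<omega> x y z"
proof -
  have lin: "\<And>x. linear (B x)" "\<And>y. linear (\<lambda>x. B x y)" and sym: "\<And>x y. B x y = B y x"
    and inv: "\<And>x y z. B (bracket x y) z = B x (bracket y z)"
    using assms(2) unfolding invariant_form_def bilinear_def by auto
  note simps = linear_add[OF lin(1)] linear_add[OF lin(2)] linear_cmul[OF lin(1)] linear_cmul[OF lin(2)]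
    linear_0[OF lin(1)] linear_0[OF lin(2)] linear_neg[OF lin(1)] linear_neg[OF lin(2)]
  have "alt3 (\<lambda>x y z. B (bracket x y) z)"
  proof -
    have "B (bracket x y) y = 0" "B (bracket x y) x = 0" for x y
      using inv[of x y y] inv[of x x y] sym[of "bracket x y" x] by (simp_all add: bracket_self simps)
    then show ?thesis unfolding alt3_def
      by (auto intro!: linearI simp: br_add br_scale bracket_self simps)
  qed
  moreover have "d3 (\<lambda>x y z. B (bracket x y) z) x y z w = 0" for x y z w
  proof -
    have *: "B (bracket (bracket x w) y) z = B (bracket (bracket y z) x) w" for x y z w
    proof -
      have "B (bracket (bracket x w) y) z = B x (bracket w (bracket y z))" by (simp only: inv)
      also have "\<dots> = - B (bracket x (bracket y z)) w" using br_skew[of w "bracket y z"] by (simp add: inv simps)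
      also have "\<dots> = B (bracket (bracket y z) x) w" using br_skew[of x "bracket y z"] by (simp add: simps)
      finally show ?thesis .
    qed
    have "B (bracket (bracket x y) z - bracket (bracket x z) y + bracket (bracket y z) x) w = 0"
    proof -
      have "bracket (bracket x y) z - bracket (bracket x z) y + bracket (bracket y z) x = 0"
        using jacobi[of x y z] br_skew[of z "bracket x y"] br_skew[of z x] br_skew[of y "bracket x z"] br_skew[of x "bracket y z"]
        by (simp add: br_minus algebra_simps)
      then show ?thesis by (simp add: simps)
    qed
    then show ?thesis unfolding d3_def using *[of x w y z] *[of y w x z] *[of z w x y]
      by (simp add: simps linear_diff[OF lin(2)])
  qed
  ultimately show thesis using assms(1) that unfolding H3_trivial_def by blast
qed

end

context fd_lie_algebra
begin

text \<open>For coordinates of an ideal P this is the trace form of the adjoint module P, with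
  arguments from the whole algebra; on P itself it is the Killing form of P.\<close>

definition trace_form :: "nat \<Rightarrow> (nat \<Rightarrow> 'a) \<Rightarrow> (nat \<Rightarrow> 'a \<Rightarrow> real) \<Rightarrow> 'a \<Rightarrow> 'a \<Rightarrow> real"
  where "trace_form n b \<xi> x y = ctrace n b \<xi> (\<lambda>v. bracket x (bracket y v))"

lemma ctrace_ad_comm:
  assumes rc: "rel_coords P {0} n b \<xi>" and "linear S" "\<And>v. v \<in> P \<Longrightarrow> S v \<in> P" "linear T" "\<And>v. v \<in> P \<Longrightarrow> T v \<in> P"
  shows "ctrace n b \<xi> (\<lambda>v. S (T v)) = ctrace n b \<xi> (\<lambda>v. T (S v))"
  by (rule ctrace_comm[OF rc]) (use assms in \<open>auto simp: linear_0\<close>)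

lemma invariant_trace_form:
  assumes rc: "rel_coords P {0} n b \<xi>" and P: "lie_ideal bracket P"
  shows "invariant_form (trace_form n b \<xi>)"
  unfolding invariant_form_def
proof (intro conjI allI)
  note PP = lie_ideal_right[OF P]
  show "bilinear (trace_form n b \<xi>)"
    unfolding bilinear_def trace_form_def
    by (auto intro!: linearI simp: br_add br_scale ctrace_add[OF rc] ctrace_scale[OF rc])
  show sym: "trace_form n b \<xi> x y = trace_form n b \<xi> y x" for x y
    unfolding trace_form_def by (rule ctrace_ad_comm[OF rc]) (auto intro: linear_br PP)
  fix x y z
  have "trace_form n b \<xi> (bracket x y) z =
      ctrace n b \<xi> (\<lambda>v. bracket x (bracket y (bracket z v)) - bracket y (bracket x (bracket z v)))"
    unfolding trace_form_def using br_jacobi[of x y] by (simp add: algebra_simps)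
  also have "\<dots> = ctrace n b \<xi> (\<lambda>v. bracket x (bracket y (bracket z v))) - ctrace n b \<xi> (\<lambda>v. bracket y (bracket x (bracket z v)))"
    by (rule ctrace_diff[OF rc])
  also have "ctrace n b \<xi> (\<lambda>v. bracket y (bracket x (bracket z v))) = ctrace n b \<xi> (\<lambda>v. bracket x (bracket z (bracket y v)))"
    by (rule ctrace_ad_comm[OF rc, of "bracket y" "\<lambda>v. bracket x (bracket z v)"])
      (auto intro: linear_br PP linear_compose[OF linear_br linear_br, unfolded o_def])
  also have "ctrace n b \<xi> (\<lambda>v. bracket x (bracket y (bracket z v))) - ctrace n b \<xi> (\<lambda>v. bracket x (bracket z (bracket y v))) =
      ctrace n b \<xi> (\<lambda>v. bracket x (bracket y (bracket z v)) - bracket x (bracket z (bracket y v)))"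
    by (rule ctrace_diff[OF rc, symmetric])
  also have "\<dots> = trace_form n b \<xi> x (bracket y z)"
    unfolding trace_form_def using br_jacobi[of y z] by (simp add: br_diff[symmetric])
  finally show "trace_form n b \<xi> (bracket x y) z = trace_form n b \<xi> x (bracket y z)" .
qed

text \<open>
  If the radical \<open>q\<close> of the Killing form \<open>B\<close> of \<open>P\<close> is central and \<open>B([x, y], z)\<close> is the differential of \<open>\<omega>\<close>, write
  \<open>\<omega>(x, y) = B(T x, y)\<close>. Then \<open>ad x = ad (T x) - [T, ad x]\<close> modulo \<open>q\<close>, hence
  \<open>B(x, y) = \<omega>(x, y) - tr (ad [x, y] T)\<close>; the left-hand side is symmetric and the right-hand side is skew.
\<close>

lemma perfect_radical_not_central:
  assumes H3: "H3_trivial" and P: "lie_ideal bracket P" "bracket_span P P = P" "P \<noteq> {0}"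
    and rc: "rel_coords P {0} n b \<xi>"
    and central: "\<And>x y. x \<in> P \<Longrightarrow> (\<And>z. z \<in> P \<Longrightarrow> trace_form n b \<xi> x z = 0) \<Longrightarrow> y \<in> P \<Longrightarrow> bracket y x = 0"
  shows False
proof -
  let ?B = "trace_form n b \<xi>"
  have inv_form: "invariant_form ?B" by (rule invariant_trace_form[OF rc P(1)])
  then have lin: "\<And>x. linear (?B x)" "\<And>y. linear (\<lambda>x. ?B x y)" and sym: "\<And>x y. ?B x y = ?B y x"
    and inv: "\<And>x y z. ?B (bracket x y) z = ?B x (bracket y z)"
    unfolding invariant_form_def bilinear_def by auto
  note simps = linear_add[OF lin(1)] linear_add[OF lin(2)] linear_cmul[OF lin(1)] linear_cmul[OF lin(2)]
    linear_0[OF lin(1)] linear_0[OF lin(2)] linear_neg[OF lin(1)] linear_neg[OF lin(2)]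
    linear_diff[OF lin(1)] linear_diff[OF lin(2)]
  obtain \<omega> where \<omega>: "alt2 \<omega>" "\<And>x y z. ?B (bracket x y) z = d2 \<omega> x y z"
    using invariant_form_exact[OF H3 inv_form] by blast
  have sP: "subspace P" using P(1) by (rule lie_ideal_subspace)
  note PP = lie_ideal_right[OF P(1)]
  define q where "q = {x\<in>P. \<forall>z\<in>P. ?B x z = 0}"
  have sq: "subspace q" unfolding q_def real_vector.subspace_def using sP
    by (auto simp: simps real_vector.subspace_0 real_vector.subspace_add real_vector.subspace_scale)
  have qc: "bracket y x = 0" if "x \<in> q" "y \<in> P" for x y using central that unfolding q_def by blast
  have \<omega>q: "\<omega> x z = 0" if z: "z \<in> q" and x: "x \<in> P" for x z
  proof -
    have "x \<in> span {bracket x y |x y. x \<in> P \<and> y \<in> P}" using x P(2) unfolding bracket_span_def by simp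
    then show ?thesis
    proof (rule linear_eq_0_on_span[OF alt2_linear(2)[OF \<omega>(1)], rotated])
      fix u assume "u \<in> {bracket x y |x y. x \<in> P \<and> y \<in> P}"
      then obtain x y where u: "u = bracket x y" "x \<in> P" "y \<in> P" by blast
      have 1: "bracket z x = 0" "bracket z y = 0"
        using qc[OF z u(2)] qc[OF z u(3)] br_skew[of z x] br_skew[of z y] by auto
      \<comment> \<open>Since z is central in P, the left-hand side is zero and only the term
        \<omega>([x, y], z) of the differential survives.\<close>
      have "?B (bracket z x) y = d2 \<omega> z x y" by (rule \<omega>(2))
      then show "\<omega> u z = 0"
        unfolding d2_def 1 u using linear_0[OF alt2_linear(2)[OF \<omega>(1)]] by (simp add: simps)
    qed
  qed
  have qP: "q \<subseteq> P" unfolding q_def by blast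
  obtain m c \<eta> where rq: "rel_coords P q m c \<eta>" by (rule coords[OF sP sq qP])
  \<comment> \<open>B is nondegenerate on P / q and \<omega> vanishes on P and q, so an endomorphism
    T with B(T x, y) = \<omega>(x, y) on P can be built from dual vectors t j.\<close>
  have dual: "\<exists>t\<in>P. \<forall>j<m. ?B t (c j) = a j" for a
  proof (rule dual_vector_exists[OF rq lin(2)])
    fix x assume x: "x \<in> P" "\<And>j. j < m \<Longrightarrow> ?B x (c j) = 0"
    have "?B x z = 0" if "z \<in> P" for z
    proof -
      have "?B (z - (\<Sum>i<m. \<eta> i z *\<^sub>R c i)) x = 0" using rel_coordsD(8)[OF rq that] x(1) unfolding q_def by blast
      then have "?B x (z - (\<Sum>i<m. \<eta> i z *\<^sub>R c i)) = 0" by (simp only: sym[of x])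
      then show ?thesis using x(2) by (simp add: simps linear_sum[OF lin(1)])
    qed
    then show "x \<in> q" using x(1) unfolding q_def by blast
  qed
  have "\<forall>j. \<exists>t. t \<in> P \<and> (\<forall>k<m. ?B t (c k) = (if k = j then 1 else 0))"
    using dual[of "\<lambda>k. if k = _ then 1 else 0"] by blast
  then obtain t where "\<forall>j. t j \<in> P \<and> (\<forall>k<m. ?B (t j) (c k) = (if k = j then 1 else 0))"
    unfolding choice_iff ..
  then have t: "\<And>j. t j \<in> P" "\<And>j k. k < m \<Longrightarrow> ?B (t j) (c k) = (if k = j then 1 else 0)" by simp_all
  define T where "T x = (\<Sum>j<m. \<omega> x (c j) *\<^sub>R t j)" for x
  have linT: "linear T" unfolding T_def
    by (rule linearI) (simp_all add: linear_add[OF alt2_linear(2)[OF \<omega>(1)]] linear_cmul[OF alt2_linear(2)[OF \<omega>(1)]]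
        scaleR_left_distrib sum.distrib scaleR_sum_right)
  have TP: "T x \<in> P" for x unfolding T_def using sP t by (intro real_vector.subspace_sum real_vector.subspace_scale) auto
  have BT: "?B (T x) y = \<omega> x y" if "x \<in> P" "y \<in> P" for x y
  proof -
    define y' where "y' = (\<Sum>i<m. \<eta> i y *\<^sub>R c i)"
    have q: "y - y' \<in> q" unfolding y'_def by (rule rel_coordsD(8)[OF rq that(2)])
    have "\<omega> x (y - y') = 0" using \<omega>q[OF q that(1)] .
    moreover have "?B (T x) (y - y') = 0" using q TP sym[of "T x"] unfolding q_def by simp
    moreover have "?B (T x) y' = \<omega> x y'"
    proof -
      have "?B (T x) (c i) = \<omega> x (c i)" if "i < m" for i
        unfolding T_def using t that
        by (simp add: linear_sum[OF lin(2)] simps if_distrib[of "\<lambda>x. _ * x"] cong: if_cong)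
      then show ?thesis unfolding y'_def
        by (simp add: linear_sum[OF lin(1)] simps linear_sum[OF alt2_linear(1)[OF \<omega>(1)]] linear_cmul[OF alt2_linear(1)[OF \<omega>(1)]])
    qed
    ultimately show ?thesis by (simp add: simps linear_diff[OF alt2_linear(1)[OF \<omega>(1)]])
  qed
  have key: "bracket x v + T (bracket x v) - bracket (T x) v - bracket x (T v) \<in> q" if "x \<in> P" "v \<in> P" for x v
  proof -
    let ?u = "bracket x v + T (bracket x v) - bracket (T x) v - bracket x (T v)"
    have "?B ?u z = 0" if z: "z \<in> P" for z
    proof -
      have "?B (bracket x v) z = - \<omega> (bracket x v) z + \<omega> (bracket x z) v - \<omega> (bracket v z) x"
        using \<omega>(2)[of x v z] unfolding d2_def .
      also have "\<omega> (bracket x v) z = ?B (T (bracket x v)) z" using BT PP that \<open>v \<in> P\<close> z by simp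
      also have "\<omega> (bracket x z) v = ?B (bracket x (T v)) z"
      proof -
        have "\<omega> (bracket x z) v = - ?B (T v) (bracket x z)"
          using alt2_skew[OF \<omega>(1), of "bracket x z" v] BT[OF \<open>v \<in> P\<close>] PP z by simp
        also have "\<dots> = ?B (bracket x (T v)) z" using inv[of "T v" x z] br_skew[of x "T v"] by (simp add: simps)
        finally show ?thesis .
      qed
      also have "\<omega> (bracket v z) x = - ?B (bracket (T x) v) z"
        using alt2_skew[OF \<omega>(1), of "bracket v z" x] BT[OF \<open>x \<in> P\<close>] PP z inv[of "T x" v z] by simp
      finally show ?thesis by (simp add: simps)
    qed
    moreover have "?u \<in> P" using sP PP that TP
      by (intro real_vector.subspace_diff real_vector.subspace_add) auto
    ultimately show ?thesis unfolding q_def by blast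
  qed
  have main: "?B y x = \<omega> x y - ctrace n b \<xi> (\<lambda>v. bracket (bracket x y) (T v))" if xy: "x \<in> P" "y \<in> P" for x y
  proof -
    \<comment> \<open>\<open>key\<close> holds only modulo q, but applying ad y makes it exact
      because q is central in P.\<close>
    have id: "bracket y (bracket x v) = bracket y (bracket (T x) v) - bracket y (T (bracket x v)) + bracket y (bracket x (T v))"
      if "v \<in> P" for v
      using qc[OF key[OF xy(1) that] xy(2)] by (simp add: br_add br_diff algebra_simps)
    have "?B y x = ctrace n b \<xi> (\<lambda>v. bracket y (bracket (T x) v) - bracket y (T (bracket x v)) + bracket y (bracket x (T v)))"
      unfolding trace_form_def by (rule ctrace_cong[OF rc]) (use id in auto)
    also have "\<dots> = ?B y (T x) - ctrace n b \<xi> (\<lambda>v. bracket y (T (bracket x v))) + ctrace n b \<xi> (\<lambda>v. bracket y (bracket x (T v)))"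
      unfolding trace_form_def by (simp add: ctrace_add[OF rc] ctrace_diff[OF rc])
    also have "ctrace n b \<xi> (\<lambda>v. bracket y (T (bracket x v))) = ctrace n b \<xi> (\<lambda>v. bracket x (bracket y (T v)))"
      by (rule ctrace_ad_comm[OF rc, of "\<lambda>v. bracket y (T v)" "bracket x"])
        (auto intro: linear_br PP TP linear_compose[OF linT linear_br, unfolded o_def])
    also have "?B y (T x) = \<omega> x y" using BT[OF xy] sym by simp
    also have "\<omega> x y - ctrace n b \<xi> (\<lambda>v. bracket x (bracket y (T v))) + ctrace n b \<xi> (\<lambda>v. bracket y (bracket x (T v))) =
        \<omega> x y - ctrace n b \<xi> (\<lambda>v. bracket x (bracket y (T v)) - bracket y (bracket x (T v)))"
      by (simp add: ctrace_diff[OF rc])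
    also have "(\<lambda>v. bracket x (bracket y (T v)) - bracket y (bracket x (T v))) = (\<lambda>v. bracket (bracket x y) (T v))"
      using br_jacobi[of x y] by (simp add: algebra_simps)
    finally show ?thesis .
  qed
  have "?B x y = 0" if "x \<in> P" "y \<in> P" for x y
  proof -
    have "ctrace n b \<xi> (\<lambda>v. bracket (bracket y x) (T v)) = - ctrace n b \<xi> (\<lambda>v. bracket (bracket x y) (T v))"
      using br_skew[of y x] ctrace_scale[OF rc, of "-1" "\<lambda>v. bracket (bracket x y) (T v)"] by (simp add: br_minus)
    then show ?thesis using main[OF that] main[OF that(2,1)] sym[of x y] alt2_skew[OF \<omega>(1), of x y] by simp
  qed
  then show False using cartan_perfect[OF P(2,3) rc] unfolding trace_form_def by blast
qed


text \<open>Elements of P are sums of brackets and thus act on q by sums of commutators.\<close>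

lemma perfect_ctrace_zero:
  assumes P: "lie_ideal bracket P" "bracket_span P P = P" and q: "lie_ideal bracket q"
    and rc: "rel_coords q {0} n b \<xi>" and "x \<in> P"
  shows "ctrace n b \<xi> (bracket x) = 0"
proof -
  have lin: "linear (\<lambda>x. ctrace n b \<xi> (bracket x))"
    unfolding ctrace_def
    by (rule linearI) (simp_all add: br_add br_scale linear_add[OF rel_coordsD(5)[OF rc]]
        linear_cmul[OF rel_coordsD(5)[OF rc]] sum.distrib sum_distrib_left)
  have comm: "ctrace n b \<xi> (bracket (bracket x y)) = 0" for x y
  proof -
    have "ctrace n b \<xi> (bracket (bracket x y)) = ctrace n b \<xi> (\<lambda>v. bracket x (bracket y v) - bracket y (bracket x v))"
      using br_jacobi[of x y] by (simp add: algebra_simps)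
    also have "\<dots> = ctrace n b \<xi> (\<lambda>v. bracket x (bracket y v)) - ctrace n b \<xi> (\<lambda>v. bracket y (bracket x v))"
      by (rule ctrace_diff[OF rc])
    also have "ctrace n b \<xi> (\<lambda>v. bracket y (bracket x v)) = ctrace n b \<xi> (\<lambda>v. bracket x (bracket y v))"
      by (rule ctrace_ad_comm[OF rc]) (auto intro: linear_br lie_ideal_right[OF q])
    finally show ?thesis by simp
  qed
  have "x \<in> span {bracket x y |x y. x \<in> P \<and> y \<in> P}" using assms(5) P(2) unfolding bracket_span_def by simp
  then show ?thesis by (rule linear_eq_0_on_span[OF lin, rotated]) (use comm in blast)
qed

text \<open>
  If the centraliser of a plane \<open>q\<close> in \<open>P\<close> is \<open>q\<close> itself, \<open>P / q\<close> acts on \<open>q\<close> as \<open>\<ss>\<ll>\<^sub>2\<close>. Eigenvectors of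
  a lift of \<open>h\<close> lift \<open>e\<close> and \<open>f\<close> such that the relations of \<open>\<ss>\<ll>\<^sub>2\<close> hold in \<open>P\<close>, so that every exact
  3-form vanishes on \<open>(h, e, f)\<close>, whereas \<open>tr ([h, e] f) = 2\<close> on \<open>q\<close>.
\<close>

lemma plane_not_self_centralising:
  assumes H3: "H3_trivial" and P: "lie_ideal bracket P" "bracket_span P P = P"
    and q: "lie_ideal bracket q" "q \<subseteq> P" "dim q = 2" "dim P \<le> 5"
    and nc: "\<exists>x\<in>P. \<exists>y\<in>q. bracket x y \<noteq> 0"
  shows False
proof -
  note sP = lie_ideal_subspace[OF P(1)] and sq = lie_ideal_subspace[OF q(1)]
  note PP = lie_ideal_right[OF P(1)] and qq = lie_ideal_right[OF q(1)]
  have s0: "subspace {0}" and "{0} \<subseteq> q" using sq by (auto simp: real_vector.subspace_0)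
  then obtain n b \<xi> where "rel_coords q {0} n b \<xi>" "dim q = dim ({0} :: 'a set) + n" by (rule coords[OF sq])
  moreover have "dim ({0} :: 'a set) = 0" by (metis card.empty real_vector.dim_span_eq_card_independent real_vector.independent_empty real_vector.span_empty)
  ultimately have rc: "rel_coords q {0} 2 b \<xi>" using q(3) by simp
  define u v where "u = b 0" and "v = b 1"
  have uv: "u \<in> q" "v \<in> q" using rel_coordsD(4)[OF rc] unfolding u_def v_def by auto
  have lin\<xi>: "linear (\<xi> 0)" "linear (\<xi> 1)" using rel_coordsD(5)[OF rc] by auto
  have \<xi>uv: "\<xi> 0 u = 1" "\<xi> 1 u = 0" "\<xi> 0 v = 0" "\<xi> 1 v = 1" using rel_coordsD(7)[OF rc] unfolding u_def v_def by auto
  have rep: "w = \<xi> 0 w *\<^sub>R u + \<xi> 1 w *\<^sub>R v" if "w \<in> q" for w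
    using rel_coordsD(8)[OF rc that] unfolding u_def v_def by (simp add: numeral_2_eq_2)
  have repI: "w = a *\<^sub>R u + c *\<^sub>R v" if "w \<in> q" "\<xi> 0 w = a" "\<xi> 1 w = c" for w a c
    using rep that by blast
  have tr: "\<xi> 0 (bracket x u) + \<xi> 1 (bracket x v) = 0" if "x \<in> P" for x
    using perfect_ctrace_zero[OF P q(1) rc that] unfolding ctrace_def u_def v_def by (simp add: numeral_2_eq_2)
  have buv: "bracket u v = 0"
  proof -
    have "\<xi> 1 (bracket u v) = 0" using tr[of u] uv q(2) linear_0[OF lin\<xi>(1)] by (auto simp: bracket_self)
    moreover have "\<xi> 0 (bracket u v) = 0"
      using tr[of v] uv q(2) linear_0[OF lin\<xi>(2)] br_skew[of v u] linear_neg[OF lin\<xi>(1)] by (auto simp: bracket_self)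
    ultimately show ?thesis using repI[of "bracket u v" 0 0] qq uv by simp
  qed
  have abel: "bracket x y = 0" if "x \<in> q" "y \<in> q" for x y
  proof -
    have "bracket (\<xi> 0 x *\<^sub>R u + \<xi> 1 x *\<^sub>R v) (\<xi> 0 y *\<^sub>R u + \<xi> 1 y *\<^sub>R v) = 0"
      using buv br_skew[of v u] by (simp add: br_add br_scale bracket_self)
    then show ?thesis by (simp only: rep[OF that(1), symmetric] rep[OF that(2), symmetric])
  qed
  define K where "K = {x\<in>P. bracket x u = 0 \<and> bracket x v = 0}"
  have Kq: "bracket x w = 0" if "x \<in> K" "w \<in> q" for x w
  proof -
    have "bracket x (\<xi> 0 w *\<^sub>R u + \<xi> 1 w *\<^sub>R v) = 0" using that(1) by (simp add: br_add br_scale K_def)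
    then show ?thesis by (simp only: rep[OF that(2), symmetric])
  qed
  have sK: "subspace K" unfolding K_def real_vector.subspace_def using sP
    by (auto simp: br_zero br_add br_scale real_vector.subspace_0 real_vector.subspace_add real_vector.subspace_scale)
  have KP: "K \<subseteq> P" unfolding K_def by blast
  have qK: "q \<subseteq> K" using q(2) abel uv unfolding K_def by blast
  have "K \<noteq> P" using nc Kq by blast
  \<comment> \<open>P / K is perfect and nonzero, so dim P \<ge> dim K + 3. With dim P \<le> 5 and
    the plane q inside the centraliser K this leaves K = q and dim P = 5.\<close>
  moreover have "P = K" if "dim P \<le> dim K + 2"
  proof (rule perfect_quotient_dim_ge_3[OF sP sK KP _ _ that])
    fix x y assume xy: "x \<in> P" "y \<in> K"
    have "bracket (bracket x y) w = 0" if "w \<in> q" for w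
      using br_jacobi[of x y w] Kq[OF xy(2)] qq that by (simp add: br_zero)
    then show "bracket x y \<in> K" using PP xy KP uv unfolding K_def by blast
  next
    show "P \<subseteq> span (bracket_span P P \<union> K)" unfolding P(2) by (auto intro: real_vector.span_base)
  qed
  ultimately have dK: "dim K + 3 \<le> dim P" by fastforce
  then have "dim K \<le> dim q" using q(3,4) by simp
  then have Kq_eq: "K = q" using subspace_dim_eq[OF sK sq qK] by simp
  obtain m c \<eta> where rK: "rel_coords P K m c \<eta>" and "dim P = dim K + m" by (rule coords[OF sP sK KP])
  then have m: "m = 3" using dK q(3,4) Kq_eq by simp
  \<comment> \<open>Three entries of the matrix of x on q; as it is traceless they determine it.
    Their common kernel is K and dim P / K = 3, so every traceless matrix occurs, which
    \<open>lift\<close> records.\<close>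
  define f where "f j x = (if j = 0 then \<xi> 0 (bracket x u) else if j = 1 then \<xi> 0 (bracket x v) else \<xi> 1 (bracket x u))"
    for j :: nat and x
  have f: "\<exists>t\<in>P. \<forall>j<3. f j t = a j" for a
  proof (rule dual_vector_exists[OF rK[unfolded m]])
    show "linear (f j)" for j
      unfolding f_def by (rule linearI) (simp_all add: br_add br_scale linear_add[OF lin\<xi>(1)] linear_add[OF lin\<xi>(2)]
          linear_cmul[OF lin\<xi>(1)] linear_cmul[OF lin\<xi>(2)] del: One_nat_def)
    fix x assume x: "x \<in> P" "\<And>j. j < 3 \<Longrightarrow> f j x = 0"
    have "\<xi> 0 (bracket x u) = 0" "\<xi> 0 (bracket x v) = 0" "\<xi> 1 (bracket x u) = 0"
      using x(2)[of 0] x(2)[of 1] x(2)[of 2] by (auto simp: f_def)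
    moreover then have "\<xi> 1 (bracket x v) = 0" using tr[OF x(1)] by simp
    ultimately have "bracket x u = 0" "bracket x v = 0"
      using repI[of "bracket x u" 0 0] repI[of "bracket x v" 0 0] qq uv by simp_all
    then show "x \<in> K" using x(1) unfolding K_def by blast
  qed
  have lift: "\<exists>t\<in>P. bracket t u = a *\<^sub>R u + c *\<^sub>R v \<and> bracket t v = d *\<^sub>R u - a *\<^sub>R v" for a d c
  proof -
    obtain t where t: "t \<in> P" "\<forall>j<3. f j t = (if j = 0 then a else if j = 1 then d else c)" using f[of "\<lambda>j. if j = 0 then a else if j = 1 then d else c"] by blast
    have "\<xi> 0 (bracket t u) = a" "\<xi> 0 (bracket t v) = d" "\<xi> 1 (bracket t u) = c"
      using spec[OF t(2), of 0] spec[OF t(2), of 1] spec[OF t(2), of 2] by (auto simp: f_def)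
    moreover then have "\<xi> 1 (bracket t v) = - a" using tr[OF t(1)] by simp
    ultimately have "bracket t u = a *\<^sub>R u + c *\<^sub>R v" "bracket t v = d *\<^sub>R u + (- a) *\<^sub>R v"
      using qq uv by (blast intro: repI)+
    then show ?thesis using t(1) by auto
  qed
  obtain H where H: "H \<in> P" "bracket H u = u" "bracket H v = - v" using lift[of 1 0 0] by auto
  obtain E where E: "E \<in> P" "bracket E u = 0" "bracket E v = u" using lift[of 0 0 1] by auto
  obtain F where F: "F \<in> P" "bracket F u = v" "bracket F v = 0" using lift[of 0 1 0] by auto
  have ker: "\<exists>r s. x = r *\<^sub>R u + s *\<^sub>R v" if "x \<in> P" "bracket x u = 0" "bracket x v = 0" for x
    using that rep[of x] Kq_eq unfolding K_def by blast
  have act: "bracket (bracket x y) w = bracket x (bracket y w) - bracket y (bracket x w)" for x y w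
    using br_jacobi[of x y w] by simp
  have inP: "bracket H E - 2 *\<^sub>R E \<in> P" "bracket H F + 2 *\<^sub>R F \<in> P"
    using sP PP H E F by (auto intro!: real_vector.subspace_diff real_vector.subspace_add real_vector.subspace_scale)
  have "bracket (bracket H E - 2 *\<^sub>R E) u = 0" "bracket (bracket H E - 2 *\<^sub>R E) v = 0"
    "bracket (bracket H F + 2 *\<^sub>R F) u = 0" "bracket (bracket H F + 2 *\<^sub>R F) v = 0"
    using H E F by (simp_all add: br_diff br_add br_scale act br_zero br_minus scaleR_2)
  then obtain r1 s1 r2 s2 where HE: "bracket H E - 2 *\<^sub>R E = r1 *\<^sub>R u + s1 *\<^sub>R v"
    and HF: "bracket H F + 2 *\<^sub>R F = r2 *\<^sub>R u + s2 *\<^sub>R v"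
    using ker[OF inP(1)] ker[OF inP(2)] by blast
  \<comment> \<open>E and F are corrected within q to eigenvectors of ad H for 2 and -2. Since u and
    v have weights 1 and -1, the denominators are differences of weights: 2 - 1 and 2 + 1 for E', 1
    + 2 and -1 + 2 for F'.\<close>
  define E' where "E' = E + r1 *\<^sub>R u + (s1 / 3) *\<^sub>R v"
  define F' where "F' = F - (r2 / 3) *\<^sub>R u - s2 *\<^sub>R v"
  have HE': "bracket H E' = 2 *\<^sub>R E'"
  proof -
    have "bracket H E' = bracket H E + r1 *\<^sub>R u - (s1 / 3) *\<^sub>R v" unfolding E'_def using H by (simp add: br_add br_scale)
    also have "bracket H E = 2 *\<^sub>R E + r1 *\<^sub>R u + s1 *\<^sub>R v" using HE by (simp add: algebra_simps)
    also have "2 *\<^sub>R E + r1 *\<^sub>R u + s1 *\<^sub>R v + r1 *\<^sub>R u - (s1 / 3) *\<^sub>R v =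
        2 *\<^sub>R E + (r1 + r1) *\<^sub>R u + (s1 - s1 / 3) *\<^sub>R v" by (simp only: scaleR_left_distrib scaleR_left_diff_distrib) simp
    also have "\<dots> = 2 *\<^sub>R E'" unfolding E'_def by (simp add: scaleR_right_distrib)
    finally show ?thesis .
  qed
  have HF': "bracket H F' = - (2 *\<^sub>R F')"
  proof -
    have "bracket H F' = bracket H F - (r2 / 3) *\<^sub>R u + s2 *\<^sub>R v" unfolding F'_def using H by (simp add: br_diff br_scale)
    also have "bracket H F = - 2 *\<^sub>R F + r2 *\<^sub>R u + s2 *\<^sub>R v" using HF by (simp add: algebra_simps)
    also have "- 2 *\<^sub>R F + r2 *\<^sub>R u + s2 *\<^sub>R v - (r2 / 3) *\<^sub>R u + s2 *\<^sub>R v =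
        - 2 *\<^sub>R F + (r2 - r2 / 3) *\<^sub>R u + (s2 + s2) *\<^sub>R v" by (simp only: scaleR_left_distrib scaleR_left_diff_distrib) simp
    also have "\<dots> = - (2 *\<^sub>R F')" unfolding F'_def by (simp add: scaleR_right_diff_distrib)
    finally show ?thesis .
  qed
  have E'uv: "E' \<in> P" "bracket E' u = 0" "bracket E' v = u"
    using E uv q(2) sP buv br_skew[of v u] unfolding E'_def
    by (auto simp: br_add br_scale bracket_self intro!: real_vector.subspace_add real_vector.subspace_scale)
  have F'uv: "F' \<in> P" "bracket F' u = v" "bracket F' v = 0"
    using F uv q(2) sP buv br_skew[of v u] unfolding F'_def
    by (auto simp: br_diff br_scale bracket_self intro!: real_vector.subspace_diff real_vector.subspace_scale)
  have EF': "bracket E' F' = H"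
  proof -
    have "bracket E' F' - H \<in> P" using sP PP F'uv H by (auto intro!: real_vector.subspace_diff)
    moreover have "bracket (bracket E' F' - H) u = 0" "bracket (bracket E' F' - H) v = 0"
      using E'uv F'uv H by (simp_all add: br_diff act br_zero)
    ultimately obtain r s where rs: "bracket E' F' - H = r *\<^sub>R u + s *\<^sub>R v" using ker by blast
    \<comment> \<open>The difference of [E', F'] and H lies in q and has weight 0, whereas q has
      only the weights 1 and -1.\<close>
    have "bracket H (bracket E' F') = 0"
      unfolding br_jacobi[of H] HE' HF' by (simp add: br_scale br_minus)
    moreover have "bracket E' F' = H + r *\<^sub>R u + s *\<^sub>R v" using rs by (simp add: algebra_simps)
    ultimately have "r *\<^sub>R u - s *\<^sub>R v = 0" using H by (simp add: br_add br_scale bracket_self)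
    moreover have "\<xi> 0 (r *\<^sub>R u - s *\<^sub>R v) = r" "\<xi> 1 (r *\<^sub>R u - s *\<^sub>R v) = - s"
      using \<xi>uv by (simp_all add: linear_diff[OF lin\<xi>(1)] linear_diff[OF lin\<xi>(2)]
          linear_cmul[OF lin\<xi>(1)] linear_cmul[OF lin\<xi>(2)] del: One_nat_def)
    ultimately have "r = 0" "- s = 0" using linear_0[OF lin\<xi>(1)] linear_0[OF lin\<xi>(2)] by metis+
    then have "r = 0" "s = 0" by simp_all
    then show ?thesis using rs by simp
  qed
  have inv_form: "invariant_form (trace_form 2 b \<xi>)" by (rule invariant_trace_form[OF rc q(1)])
  then have lin: "linear (\<lambda>x. trace_form 2 b \<xi> x y)" for y unfolding invariant_form_def bilinear_def by auto
  obtain \<omega> where \<omega>: "alt2 \<omega>" "\<And>x y z. trace_form 2 b \<xi> (bracket x y) z = d2 \<omega> x y z"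
    using invariant_form_exact[OF H3 inv_form] by blast
  \<comment> \<open>The two terms with \<omega>(E', F') cancel as the weights of E' and F' are
    opposite, and the third is \<omega>(H, H).\<close>
  have "d2 \<omega> H E' F' = 0"
    unfolding d2_def HE' HF' EF' using alt2_skew[OF \<omega>(1), of E' F'] alt2_linear(3)[OF \<omega>(1)]
      linear_cmul[OF alt2_linear(2)[OF \<omega>(1)]] linear_neg[OF alt2_linear(2)[OF \<omega>(1)]] by simp
  moreover have "trace_form 2 b \<xi> (bracket H E') F' = 2 * trace_form 2 b \<xi> E' F'"
    unfolding HE' using linear_cmul[OF lin] by simp
  moreover have "trace_form 2 b \<xi> E' F' = 1"
    using E'uv F'uv \<xi>uv lin\<xi> unfolding trace_form_def ctrace_def u_def v_def
    by (simp add: numeral_2_eq_2 br_zero linear_0)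
  ultimately show False using \<omega>(2)[of H E' F'] by simp
qed

lemma derived_stabilises: "\<exists>m\<ge>1. derived (Suc m) = derived m"
proof -
  obtain m where m: "m \<ge> 1" "\<And>k. k \<ge> 1 \<Longrightarrow> dim (derived m) \<le> dim (derived k)"
    using ex_has_least_nat[of "\<lambda>m. m \<ge> (1::nat)" 1 "\<lambda>m. dim (derived m)"] by auto
  have "dim (derived m) \<le> dim (derived (Suc m))" using m(2)[of "Suc m"] by (simp del: derived.simps)
  then have "derived (Suc m) = derived m"
    by (intro subspace_dim_eq derived_Suc_subset lie_ideal_subspace[OF lie_ideal_derived])
  then show ?thesis using m(1) by blast
qed

lemma H3_trivial_solvable:
  assumes H3: "H3_trivial" and dim: "dim (derived 1) \<le> 5"
  shows "\<exists>m. derived m = {0}"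
proof (rule ccontr)
  assume ns: "\<nexists>m. derived m = {0}"
  obtain m where m: "m \<ge> 1" "derived (Suc m) = derived m" using derived_stabilises by blast
  define P where "P = derived m"
  have P: "lie_ideal bracket P" "bracket_span P P = P" "P \<noteq> {0}"
    using lie_ideal_derived m(2) ns unfolding P_def by auto
  note sP = lie_ideal_subspace[OF P(1)]
  have dP: "dim P \<le> 5"
    using subspace_dim_mono[OF lie_ideal_subspace[OF lie_ideal_derived] sP, of 1] derived_antimono[OF m(1)] dim
    unfolding P_def by simp
  have s0: "subspace {0}" "{0} \<subseteq> P" using sP by (auto simp: real_vector.subspace_0)
  obtain n b \<xi> where rc: "rel_coords P {0} n b \<xi>" by (rule coords[OF sP s0])
  let ?B = "trace_form n b \<xi>"
  have "invariant_form ?B" by (rule invariant_trace_form[OF rc P(1)])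
  then have lin: "\<And>x. linear (?B x)" "\<And>y. linear (\<lambda>x. ?B x y)" and sym: "\<And>x y. ?B x y = ?B y x"
    and inv: "\<And>x y z. ?B (bracket x y) z = ?B x (bracket y z)"
    unfolding invariant_form_def bilinear_def by auto
  define q where "q = {x\<in>P. \<forall>z\<in>P. ?B x z = 0}"
  have q: "lie_ideal bracket q"
    unfolding lie_ideal_def
  proof (intro conjI allI ballI)
    show "subspace q" unfolding q_def real_vector.subspace_def using sP
      by (auto simp: linear_0[OF lin(2)] linear_add[OF lin(2)] linear_cmul[OF lin(2)]
          real_vector.subspace_0 real_vector.subspace_add real_vector.subspace_scale)
    fix x y assume y: "y \<in> q"
    have "?B (bracket x y) z = 0" if "z \<in> P" for z
    proof -
      have "?B (bracket x y) z = - ?B (bracket y x) z" using br_skew[of x y] linear_neg[OF lin(2)] by simp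
      also have "\<dots> = - ?B y (bracket x z)" by (simp add: inv)
      finally show ?thesis using y lie_ideal_right[OF P(1) that] unfolding q_def by simp
    qed
    then show "bracket x y \<in> q" using y lie_ideal_right[OF P(1)] unfolding q_def by blast
  qed
  note sq = lie_ideal_subspace[OF q]
  have qP: "q \<subseteq> P" unfolding q_def by blast
  have "q \<noteq> P"
    using cartan_perfect[OF P(2,3) rc] unfolding q_def trace_form_def by blast
  moreover have "P = q" if "dim P \<le> dim q + 2"
    by (rule perfect_quotient_dim_ge_3[OF sP sq qP _ _ that])
      (auto simp: P(2) lie_ideal_right[OF q] intro: real_vector.span_base)
  ultimately have dq: "dim q + 3 \<le> dim P" by fastforce
  \<comment> \<open>The radical is not central in P; a traceless action on a space of dimension at
    most one would be zero, so q is a plane.\<close>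
  have "\<exists>x\<in>P. \<exists>y\<in>q. bracket x y \<noteq> 0"
  proof (rule ccontr)
    assume "\<not> ?thesis"
    then show False by (intro perfect_radical_not_central[OF H3 P rc]) (auto simp: q_def)
  qed
  moreover have "dim q = 2"
  proof (rule ccontr)
    assume "dim q \<noteq> 2"
    then have d1: "dim q \<le> 1" using dq dP by simp
    have "{0} \<subseteq> q" using sq by (simp add: real_vector.subspace_0)
    then obtain k c \<eta> where rq: "rel_coords q {0} k c \<eta>" "dim q = dim ({0} :: 'a set) + k" by (rule coords[OF sq s0(1)])
    then have k1: "k \<le> 1" using d1 by simp
    have "bracket x y = 0" if "x \<in> P" "y \<in> q" for x y
    proof (cases "k = 0")
      case True
      then show ?thesis using rel_coordsD(8)[OF rq(1) that(2)] by (simp add: br_zero)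
    next
      case False
      then have k: "k = 1" using k1 by simp
      have y: "y = \<eta> 0 y *\<^sub>R c 0" using rel_coordsD(8)[OF rq(1) that(2)] k by simp
      have c: "c 0 \<in> q" using rel_coordsD(4)[OF rq(1)] k by simp
      have "\<eta> 0 (bracket x (c 0)) = 0"
        using perfect_ctrace_zero[OF P(1,2) q rq(1) that(1)] k unfolding ctrace_def by simp
      moreover have "bracket x (c 0) = \<eta> 0 (bracket x (c 0)) *\<^sub>R c 0"
        using rel_coordsD(8)[OF rq(1) lie_ideal_right[OF q c]] k by simp
      ultimately have "bracket x (c 0) = 0" by (metis scaleR_zero_left)
      then have "bracket x (\<eta> 0 y *\<^sub>R c 0) = 0" by (simp add: br_scale)
      then show ?thesis using y by simp
    qed
    then show False using \<open>\<exists>x\<in>P. \<exists>y\<in>q. bracket x y \<noteq> 0\<close> by blast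
  qed
  ultimately show False using plane_not_self_centralising[OF H3 P(1,2) q qP _ dP] by blast
qed

end

section \<open>The nilradical and the derived algebra\<close>

context fd_lie_algebra
begin

section \<open>Sums of nilpotent ideals and existence of the nilradical\<close>

lemma lie_ideal_lower_central: "lie_ideal bracket I \<Longrightarrow> lie_ideal bracket (lower_central bracket I m)"
  unfolding lower_central_eq_act by (induction m) (simp_all add: lie_ideal_bracket_span)

lemma act_zero: "act I {0} m = {0}"
proof (induction m)
  case (Suc m)
  have "bracket_span I {0} \<subseteq> {0}" by (rule bracket_span_minimal) (auto simp: br_zero)
  moreover have "0 \<in> bracket_span I {0}" by (simp add: real_vector.subspace_0)
  ultimately show ?case using Suc by auto
qed simp

lemma lower_central_vanishes:
  assumes "lower_central bracket I p = {0}" "p \<le> a"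
  shows "lower_central bracket I a = {0}"
proof -
  have "act I I (p + k) = act I (act I I p) k" for k by (induction k) simp_all
  from this[of "a - p"] show ?thesis using assms unfolding lower_central_eq_act by (simp add: act_zero)
qed

text \<open>The index counts the factors from I in a bracket: none for the whole algebra, one for I
  itself. With this shift the counts for two ideals simply add up along a bracket.\<close>

definition shifted_series :: "'a set \<Rightarrow> nat \<Rightarrow> 'a set"
  where "shifted_series I a = (case a of 0 \<Rightarrow> UNIV | Suc m \<Rightarrow> lower_central bracket I m)"

lemma shifted_series_ideal: "lie_ideal bracket I \<Longrightarrow> lie_ideal bracket (shifted_series I a)"
  unfolding shifted_series_def by (auto simp: lie_ideal_UNIV lie_ideal_lower_central split: nat.split)

lemma shifted_series_bracket:
  assumes "lie_ideal bracket I" "x \<in> I" "z \<in> shifted_series I a"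
  shows "bracket x z \<in> shifted_series I (Suc a)"
proof (cases a)
  case 0
  then show ?thesis using assms lie_ideal_left by (simp add: shifted_series_def)
next
  case (Suc m)
  then have "bracket x z \<in> span {bracket x y |x y. x \<in> I \<and> y \<in> lower_central bracket I m}"
    using assms by (intro real_vector.span_base) (auto simp: shifted_series_def)
  then show ?thesis using Suc by (simp add: shifted_series_def)
qed

text \<open>A long bracket of elements of I and J contains many factors from one of the two ideals,
  and since both are ideals it lies deep in the lower central series of that one.\<close>

lemma nilpotent_ideal_sum:
  assumes I: "lie_ideal bracket I" "nilpotent_on bracket I" and J: "lie_ideal bracket J" "nilpotent_on bracket J"
  shows "lie_ideal bracket {x + y |x y. x \<in> I \<and> y \<in> J}" "nilpotent_on bracket {x + y |x y. x \<in> I \<and> y \<in> J}"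
proof -
  let ?L = "{x + y |x y. x \<in> I \<and> y \<in> J}"
  have br: "bracket x y \<in> ?L" if yL: "y \<in> ?L" for x y
  proof -
    obtain u v where "y = u + v" "u \<in> I" "v \<in> J" using yL by blast
    then have "bracket x y = bracket x u + bracket x v \<and> bracket x u \<in> I \<and> bracket x v \<in> J"
      using lie_ideal_right[OF I(1), of u x] lie_ideal_right[OF J(1), of v x] br_add(1)[of x u v] by simp
    then show ?thesis by blast
  qed
  have "subspace ?L"
    by (rule real_vector.subspace_sums[OF lie_ideal_subspace[OF I(1)] lie_ideal_subspace[OF J(1)]])
  then show L: "lie_ideal bracket ?L"
    unfolding lie_ideal_def by (intro conjI allI ballI br)
  obtain p where p: "lower_central bracket I p = {0}" using I(2) unfolding nilpotent_on_def ..
  obtain r where r: "lower_central bracket J r = {0}" using J(2) unfolding nilpotent_on_def ..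
  define G where "G m = {z. \<exists>a c. a + c = m \<and> z \<in> shifted_series I a \<and> z \<in> shifted_series J c}" for m
  have sub: "lower_central bracket ?L m \<subseteq> span (G (Suc m))" for m
  proof (induction m)
    case 0
    have "x + y \<in> span (G (Suc 0))" if "x \<in> I" "y \<in> J" for x y
    proof -
      have "x \<in> G (Suc 0)" unfolding G_def mem_Collect_eq using that
        by (intro exI[of _ "Suc 0"] exI[of _ 0]) (simp add: shifted_series_def)
      moreover have "y \<in> G (Suc 0)" unfolding G_def mem_Collect_eq using that
        by (intro exI[of _ 0] exI[of _ "Suc 0"]) (simp add: shifted_series_def)
      ultimately show ?thesis by (intro real_vector.span_add real_vector.span_base)
    qed
    then show ?case by auto
  next
    case (Suc m)
    have "bracket w z \<in> span (G (Suc (Suc m)))" if w: "w \<in> ?L" and z: "z \<in> span (G (Suc m))" for w z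
    proof -
      obtain x y where xy: "w = x + y" "x \<in> I" "y \<in> J" using w by blast
      show ?thesis using z
      proof (induction rule: real_vector.span_induct_alt)
        case base
        then show ?case by (simp add: br_zero real_vector.span_zero)
      next
        case (step c u v)
        obtain a d where ad: "a + d = Suc m" "u \<in> shifted_series I a" "u \<in> shifted_series J d"
          using step(1) unfolding G_def by blast
        have "bracket x u \<in> G (Suc (Suc m))" unfolding G_def mem_Collect_eq
          using ad shifted_series_bracket[OF I(1) xy(2) ad(2)] lie_ideal_right[OF shifted_series_ideal[OF J(1)] ad(3)]
          by (intro exI[of _ "Suc a"] exI[of _ d]) simp
        moreover have "bracket y u \<in> G (Suc (Suc m))" unfolding G_def mem_Collect_eq
          using ad shifted_series_bracket[OF J(1) xy(3) ad(3)] lie_ideal_right[OF shifted_series_ideal[OF I(1)] ad(2)]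
          by (intro exI[of _ a] exI[of _ "Suc d"]) simp
        ultimately have "bracket w u \<in> span (G (Suc (Suc m)))"
          unfolding xy(1) br_add(2) by (intro real_vector.span_add real_vector.span_base)
        then show ?case using step(2)
          by (simp add: br_add(1) br_scale(1) real_vector.span_add real_vector.span_scale)
      qed
    qed
    then have "bracket_span ?L (lower_central bracket ?L m) \<subseteq> span (G (Suc (Suc m)))"
      using Suc by (intro bracket_span_minimal) auto
    then show ?case by (simp add: bracket_span_def)
  qed
  \<comment> \<open>If a + c = p + r + 2, then a > p or c > r, so one of the two series has reached
    zero.\<close>
  have "G (Suc (Suc (p + r))) \<subseteq> {0}"
  proof
    fix z assume "z \<in> G (Suc (Suc (p + r)))"
    then obtain a c where ac: "a + c = Suc (Suc (p + r))" "z \<in> shifted_series I a" "z \<in> shifted_series J c"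
      unfolding G_def by blast
    show "z \<in> {0}"
    proof (cases "Suc p \<le> a")
      case True
      then obtain a' where "a = Suc a'" "p \<le> a'" by (cases a) auto
      then show ?thesis using ac(2) lower_central_vanishes[OF p] by (simp add: shifted_series_def)
    next
      case False
      then obtain c' where "c = Suc c'" "r \<le> c'" using ac(1) by (cases c) auto
      then show ?thesis using ac(3) lower_central_vanishes[OF r] by (simp add: shifted_series_def)
    qed
  qed
  then have "span (G (Suc (Suc (p + r)))) \<subseteq> {0}" by (intro real_vector.span_minimal) auto
  then have "lower_central bracket ?L (Suc (p + r)) \<subseteq> {0}" using sub by blast
  moreover have "0 \<in> lower_central bracket ?L (Suc (p + r))"
    using lie_ideal_subspace[OF lie_ideal_lower_central[OF L]] by (rule real_vector.subspace_0)
  ultimately show "nilpotent_on bracket ?L" unfolding nilpotent_on_def by blast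
qed

text \<open>A nilpotent ideal of largest dimension absorbs every other one, because their sum is
  again nilpotent. This makes \<open>GREATEST\<close> in \<open>nilradical\<close> denote an actual
  greatest element.\<close>

lemma nilradical_greatest:
  "lie_ideal bracket (nilradical bracket)" "nilpotent_on bracket (nilradical bracket)"
  "lie_ideal bracket M \<Longrightarrow> nilpotent_on bracket M \<Longrightarrow> M \<subseteq> nilradical bracket"
proof -
  let ?Q = "\<lambda>N. lie_ideal bracket N \<and> nilpotent_on bracket N"
  have "?Q {0}" using lie_ideal_zero unfolding nilpotent_on_def by (auto intro!: exI[of _ 0])
  moreover have "\<And>N. ?Q N \<Longrightarrow> subspace N" using lie_ideal_subspace by blast
  ultimately have "\<exists>N. ?Q N \<and> (\<forall>M. ?Q M \<longrightarrow> dim M \<le> dim N)"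
    by (rule bounded_dim_maximal[of ?Q "{0}"]) (assumption, rule exI, rule conjI, assumption, simp)
  then obtain N where N: "?Q N" and max: "\<And>M. ?Q M \<Longrightarrow> dim M \<le> dim N" by blast
  have sN: "subspace N" using N lie_ideal_subspace by blast
  have great: "M \<subseteq> N" if M: "?Q M" for M
  proof -
    let ?S = "{x + y |x y. x \<in> N \<and> y \<in> M}"
    have S: "?Q ?S" using nilpotent_ideal_sum[of N M] N M by blast
    have sM: "subspace M" using M lie_ideal_subspace by blast
    have "x \<in> ?S" if "x \<in> N" for x
      using that real_vector.subspace_0[OF sM] by (metis (mono_tags, lifting) add.right_neutral mem_Collect_eq)
    then have "N = ?S" using S max[OF S] sN by (intro subspace_dim_eq) (auto intro: lie_ideal_subspace)
    moreover have "x \<in> ?S" if "x \<in> M" for x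
      using that real_vector.subspace_0[OF sN] by (metis (mono_tags, lifting) add.left_neutral mem_Collect_eq)
    ultimately show ?thesis by blast
  qed
  have eq: "nilradical bracket = N"
    unfolding nilradical_def by (rule Greatest_equality) (use N great in auto)
  show "lie_ideal bracket (nilradical bracket)" "nilpotent_on bracket (nilradical bracket)"
    "lie_ideal bracket M \<Longrightarrow> nilpotent_on bracket M \<Longrightarrow> M \<subseteq> nilradical bracket"
    unfolding eq using N great by blast+
qed

text \<open>
  Let \<open>\<alpha>\<close> be a closed 1-form and \<open>k\<close> its kernel. For a 1-form \<open>\<beta>\<close> that is closed on \<open>k\<close>, the closed form
  \<open>\<alpha> \<and> \<beta>\<close> is exact, which makes the action of a complement of \<open>k\<close> on \<open>k / [k, k]\<close> injective.
\<close>

lemma H2_trivial_codim_derived: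
  assumes H2: "H2_trivial" and np: "derived 1 \<noteq> UNIV"
  shows "dim (UNIV :: 'a set) = dim (derived 1) + 1"
proof -
  have sd: "subspace (derived 1)" by simp
  obtain n b \<xi> where rc: "rel_coords (UNIV :: 'a set) (derived 1) n b \<xi>" and dn: "dim (UNIV :: 'a set) = dim (derived 1) + n"
    by (rule coords[OF real_vector.subspace_UNIV sd]) auto
  have n0: "0 < n" using rel_coordsD(8)[OF rc] np by (cases "n = 0") auto
  define e where "e = b 0"
  define \<alpha> where "\<alpha> = \<xi> 0"
  have \<alpha>: "linear \<alpha>" "\<alpha> e = 1" "\<And>x y. \<alpha> (bracket x y) = 0"
    using rel_coordsD(5,6,7)[OF rc] n0 bracket_in_span[of _ UNIV _ UNIV] unfolding \<alpha>_def e_def by auto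
  define k where "k = {x. \<alpha> x = 0}"
  have sk: "subspace k" unfolding k_def real_vector.subspace_def
    by (auto simp: linear_0[OF \<alpha>(1)] linear_add[OF \<alpha>(1)] linear_cmul[OF \<alpha>(1)])
  define Q where "Q = bracket_span k k"
  have sQ: "subspace Q" unfolding Q_def by simp
  have Qk: "Q \<subseteq> k" unfolding Q_def by (rule bracket_span_minimal[OF sk]) (simp add: k_def \<alpha>(3))
  have inj: "x \<in> Q" if x: "x \<in> k" "bracket e x \<in> Q" for x
  proof (rule ccontr)
    assume nx: "x \<notin> Q"
    obtain m c \<eta> where rq: "rel_coords k Q m c \<eta>" by (rule coords[OF sk sQ Qk])
    obtain i where i: "i < m" "\<eta> i x \<noteq> 0" using rel_coords_zero[OF rq x(1)] nx by blast
    define \<beta> where "\<beta> = \<eta> i"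
    have \<beta>: "linear \<beta>" "\<And>x. x \<in> Q \<Longrightarrow> \<beta> x = 0" "\<beta> x \<noteq> 0"
      using rel_coordsD(5,6)[OF rq] i unfolding \<beta>_def by auto
    define \<omega> where "\<omega> y z = \<alpha> y * \<beta> z - \<alpha> z * \<beta> y" for y z
    have a2: "alt2 \<omega>"
      unfolding alt2_def bilinear_def \<omega>_def
      by (auto intro!: linearI simp: linear_add[OF \<alpha>(1)] linear_cmul[OF \<alpha>(1)] linear_add[OF \<beta>(1)] linear_cmul[OF \<beta>(1)] algebra_simps)
    \<comment> \<open>\<beta> kills [k, k], so its differential is a multiple of \<alpha> and the
      product of \<alpha> and \<beta> is closed.\<close>
    have \<beta>br: "\<beta> (bracket y z) = \<alpha> y * \<beta> (bracket e z) - \<alpha> z * \<beta> (bracket e y)" for y z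
    proof -
      define y' z' where "y' = y - \<alpha> y *\<^sub>R e" and "z' = z - \<alpha> z *\<^sub>R e"
      have "y' \<in> k" "z' \<in> k" unfolding k_def y'_def z'_def by (auto simp: linear_diff[OF \<alpha>(1)] linear_cmul[OF \<alpha>(1)] \<alpha>(2))
      then have "\<beta> (bracket y' z') = 0" using \<beta>(2) bracket_in_span unfolding Q_def by blast
      moreover have "bracket y' z' = bracket y z - \<alpha> z *\<^sub>R bracket y e - \<alpha> y *\<^sub>R bracket e z"
        unfolding y'_def z'_def by (simp add: br_diff br_scale bracket_self)
      moreover have "\<beta> (bracket y e) = - \<beta> (bracket e y)"
        by (subst br_skew) (simp add: linear_neg[OF \<beta>(1)])
      ultimately show ?thesis
        by (simp add: linear_diff[OF \<beta>(1)] linear_cmul[OF \<beta>(1)])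
    qed
    have "d2 \<omega> x y z = 0" for x y z
      unfolding d2_def \<omega>_def \<alpha>(3) \<beta>br[of x y] \<beta>br[of x z] \<beta>br[of y z] by (simp add: algebra_simps)
    then obtain \<theta> where \<theta>: "linear \<theta>" "\<And>x y. \<omega> x y = - \<theta> (bracket x y)"
      using H2 a2 unfolding H2_trivial_def by blast
    \<comment> \<open>\<omega> vanishes on pairs from k, so \<theta> kills [k, k], which contains
      [e, x]. But \<beta>(x) = \<omega>(e, x) = - \<theta>([e, x]).\<close>
    have "\<theta> y = 0" if "y \<in> {bracket x y |x y. x \<in> k \<and> y \<in> k}" for y
    proof -
      obtain u v where "y = bracket u v" "u \<in> k" "v \<in> k" using \<open>y \<in> _\<close> by blast
      then show ?thesis using \<theta>(2)[of u v] unfolding \<omega>_def k_def by simp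
    qed
    then have "\<theta> (bracket e x) = 0"
      using linear_eq_0_on_span[OF \<theta>(1)] x(2) unfolding Q_def bracket_span_def by blast
    moreover have "\<omega> e x = \<beta> x" unfolding \<omega>_def using \<alpha>(2) x(1) by (simp add: k_def)
    ultimately show False using \<theta>(2)[of e x] \<beta>(3) by simp
  qed
  \<comment> \<open>On the finite-dimensional space k / [k, k] the injective map ad e is surjective.
    Every y in k is therefore [e, t] modulo [k, k] and lies in [g, g].\<close>
  have kd: "y \<in> derived 1" if y: "y \<in> k" for y
  proof -
    obtain m c \<eta> where rq: "rel_coords k Q m c \<eta>" by (rule coords[OF sk sQ Qk])
    have brk: "bracket e x \<in> k" for x by (simp add: k_def \<alpha>(3))
    have "\<exists>t\<in>k. \<forall>j<m. \<eta> j (bracket e t) = \<eta> j y"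
    proof (rule dual_vector_exists[OF rq])
      show "linear (\<lambda>x. \<eta> j (bracket e x))" if "j < m" for j
        using linear_compose[OF linear_br rel_coordsD(5)[OF rq that]] by (simp add: o_def)
      show "x \<in> Q" if "x \<in> k" "\<And>j. j < m \<Longrightarrow> \<eta> j (bracket e x) = 0" for x
        using inj[OF that(1)] rel_coords_zero[OF rq brk] that(2) by blast
    qed
    then obtain t where t: "t \<in> k" "\<And>j. j < m \<Longrightarrow> \<eta> j (bracket e t) = \<eta> j y" by blast
    have "y - bracket e t \<in> Q"
      using y brk sk t(2) rel_coordsD(5)[OF rq]
      by (intro rel_coords_zero[OF rq]) (auto simp: linear_diff intro: real_vector.subspace_diff)
    moreover have "Q \<subseteq> derived 1" unfolding Q_def by (simp add: bracket_span_mono)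
    moreover have "bracket e t \<in> derived 1" by (simp add: bracket_in_span)
    ultimately have "(y - bracket e t) + bracket e t \<in> derived 1" using sd by (intro real_vector.subspace_add) auto
    then show ?thesis by simp
  qed
  have "n = 1"
  proof (rule ccontr)
    assume "n \<noteq> 1"
    then have "1 < n" using n0 by simp
    then have "b 1 \<in> k" "\<xi> 1 (b 1) = 1" using rel_coordsD(7)[OF rc] unfolding k_def \<alpha>_def by auto
    then show False using kd rel_coordsD(6)[OF rc \<open>1 < n\<close>] by force
  qed
  then show ?thesis using dn by simp
qed

section \<open>Algebras whose derived algebra has codimension one\<close>

lemma codim_one_coords:
  assumes "dim (UNIV :: 'a set) = dim (derived 1) + 1"
  obtains \<alpha> :: "'a \<Rightarrow> real" and e where "linear \<alpha>" "\<alpha> e = 1" "derived 1 = {x. \<alpha> x = 0}"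
proof -
  have sd: "subspace (derived 1)" by simp
  obtain n b \<xi> where rc: "rel_coords (UNIV :: 'a set) (derived 1) n b \<xi>" and dn: "dim (UNIV :: 'a set) = dim (derived 1) + n"
    by (rule coords[OF real_vector.subspace_UNIV sd]) auto
  have n: "n = 1" using dn assms by simp
  have "x \<in> derived 1" if "\<xi> 0 x = 0" for x using rel_coordsD(8)[OF rc, of x] that n by simp
  then have "derived 1 = {x. \<xi> 0 x = 0}" using rel_coordsD(6)[OF rc] n by auto
  then show thesis using that[of "\<xi> 0" "b 0"] rel_coordsD(5,7)[OF rc] n by simp
qed

text \<open>With a single generator e modulo [g, g] every bracket lies in [g, [g, g]], so the lower
  central series is constant from its first step on. The one-dimensional algebra is the exception,
  as there [g, g] = 0.\<close>

lemma nilpotent_not_codim_one: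
  assumes cod: "dim (UNIV :: 'a set) = dim (derived 1) + 1" and "dim (UNIV :: 'a set) \<noteq> 1"
  shows "\<not> nilpotent_on bracket UNIV"
proof
  assume "nilpotent_on bracket UNIV"
  then obtain m where m: "lower_central bracket UNIV m = {0}" unfolding nilpotent_on_def ..
  obtain \<alpha> :: "'a \<Rightarrow> real" and e where e: "linear \<alpha>" "\<alpha> e = 1" "derived 1 = {x. \<alpha> x = 0}" by (rule codim_one_coords[OF cod])
  have "derived 1 \<subseteq> lower_central bracket UNIV m" for m
  proof (induction m)
    case 0
    then show ?case by simp
  next
    case (Suc m)
    let ?L = "lower_central bracket UNIV (Suc m)"
    have sL: "subspace ?L" using lie_ideal_lower_central[OF lie_ideal_UNIV] lie_ideal_subspace by blast
    have LB: "bracket x l \<in> ?L" if "l \<in> derived 1" for x l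
      using Suc that by (auto intro!: real_vector.span_base)
    have "bracket x y \<in> ?L" for x y
    proof -
      define x' y' where "x' = x - \<alpha> x *\<^sub>R e" and "y' = y - \<alpha> y *\<^sub>R e"
      have xy': "x' \<in> derived 1" "y' \<in> derived 1" unfolding x'_def y'_def e(3)
        by (simp_all add: linear_diff[OF e(1)] linear_cmul[OF e(1)] e(2))
      have "bracket x y = bracket x y' - \<alpha> y *\<^sub>R bracket e x'"
      proof -
        have "bracket x y = bracket x y' + \<alpha> y *\<^sub>R bracket x e" unfolding y'_def by (simp add: br_diff br_scale)
        also have "bracket x e = - bracket e x'" unfolding x'_def using br_skew[of x e] by (simp add: br_diff br_scale bracket_self)
        finally show ?thesis by simp
      qed
      then show ?thesis using LB xy' sL by (simp only: real_vector.subspace_diff real_vector.subspace_scale)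
    qed
    then show ?case unfolding derived.simps One_nat_def by (intro bracket_span_minimal sL)
  qed
  then have "derived 1 = {0}" using m by (auto simp: real_vector.subspace_0)
  moreover have "dim ({0} :: 'a set) = 0"
    by (metis card.empty real_vector.dim_span_eq_card_independent real_vector.independent_empty real_vector.span_empty)
  ultimately show False using cod assms(2) by simp
qed

text \<open>A nilradical strictly larger than a hyperplane would be the whole algebra, which is not
  nilpotent.\<close>

lemma nilradical_eq_derived:
  assumes cod: "dim (UNIV :: 'a set) = dim (derived 1) + 1" and "dim (UNIV :: 'a set) \<noteq> 1"
    and nil: "nilpotent_on bracket (derived 1)"
  shows "nilradical bracket = derived 1"
proof
  show sub: "derived 1 \<subseteq> nilradical bracket" using nilradical_greatest(3)[OF lie_ideal_derived nil] .
  show "nilradical bracket \<subseteq> derived 1"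
  proof (rule ccontr)
    assume "\<not> nilradical bracket \<subseteq> derived 1"
    then obtain x where x: "x \<in> nilradical bracket" "x \<notin> derived 1" by blast
    obtain \<alpha> :: "'a \<Rightarrow> real" and e where e: "linear \<alpha>" "\<alpha> e = 1" "derived 1 = {x. \<alpha> x = 0}" by (rule codim_one_coords[OF cod])
    note sN = lie_ideal_subspace[OF nilradical_greatest(1)]
    have "y \<in> nilradical bracket" for y
    proof -
      have "y - (\<alpha> y / \<alpha> x) *\<^sub>R x \<in> derived 1" using x(2) unfolding e(3) by (simp add: linear_diff[OF e(1)] linear_cmul[OF e(1)])
      then have "y - (\<alpha> y / \<alpha> x) *\<^sub>R x + (\<alpha> y / \<alpha> x) *\<^sub>R x \<in> nilradical bracket"
        using sub x(1) sN by (intro real_vector.subspace_add real_vector.subspace_scale) auto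
      then show ?thesis by simp
    qed
    then have "nilradical bracket = UNIV" by blast
    then show False using nilradical_greatest(2) nilpotent_not_codim_one[OF cod assms(2)] by simp
  qed
qed

lemma perfect_ideal_in_nilpotent:
  assumes "I = bracket_span I I" "nilpotent_on bracket (derived 1)"
  shows "I \<subseteq> {0}"
proof -
  obtain m where m: "lower_central bracket (derived 1) m = {0}" using assms(2) unfolding nilpotent_on_def ..
  have I1: "I \<subseteq> derived 1" by (subst assms(1)) (simp add: bracket_span_mono)
  have "I \<subseteq> act (derived 1) (derived 1) m" for m
  proof (induction m)
    case 0
    then show ?case using I1 by simp
  next
    case (Suc m)
    have "I = bracket_span I I" by (rule assms(1))
    also have "\<dots> \<subseteq> act (derived 1) (derived 1) (Suc m)" using bracket_span_mono[OF I1 Suc] by simp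
    finally show ?case .
  qed
  then show ?thesis using m unfolding lower_central_eq_act by blast
qed

text \<open>If g is the direct sum of I and J, then [g, g] = [I, I] + [J, J]. Neither summand is
  perfect, since a perfect ideal would lie in the nilpotent [g, g] and vanish. So [g, g] would have
  codimension at least two.\<close>

lemma codim_one_indecomposable:
  assumes cod: "dim (UNIV :: 'a set) = dim (derived 1) + 1" and nil: "nilpotent_on bracket (derived 1)"
  shows "indecomposable bracket"
  unfolding indecomposable_def
proof
  assume "\<exists>I J. lie_ideal bracket I \<and> lie_ideal bracket J \<and> I \<noteq> {0} \<and> J \<noteq> {0} \<and>
             I \<inter> J = {0} \<and> {x + y |x y. x \<in> I \<and> y \<in> J} = UNIV"
  then obtain I J where I: "lie_ideal bracket I" "I \<noteq> {0}" and J: "lie_ideal bracket J" "J \<noteq> {0}"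
    and IJ: "I \<inter> J = {0}" "{x + y |x y. x \<in> I \<and> y \<in> J} = UNIV" by blast
  obtain \<alpha> :: "'a \<Rightarrow> real" and e where e: "linear \<alpha>" "\<alpha> e = 1" "derived 1 = {x. \<alpha> x = 0}" by (rule codim_one_coords[OF cod])
  note sI = lie_ideal_subspace[OF I(1)] and sJ = lie_ideal_subspace[OF J(1)]
  have II: "bracket_span I I \<subseteq> I" "bracket_span J J \<subseteq> J"
    using bracket_span_minimal[OF sI lie_ideal_right[OF I(1)]] bracket_span_minimal[OF sJ lie_ideal_right[OF J(1)]] by simp_all
  have zero: "bracket x y = 0" if "x \<in> I" "y \<in> J" for x y
    using lie_ideal_left[OF I(1) that(1)] lie_ideal_right[OF J(1) that(2)] IJ(1) by blast
  have split: "\<exists>p\<in>bracket_span I I. \<exists>r\<in>bracket_span J J. z = p + r" if "\<alpha> z = 0" for z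
  proof -
    let ?S = "{p + r |p r. p \<in> bracket_span I I \<and> r \<in> bracket_span J J}"
    have "bracket_span UNIV UNIV \<subseteq> ?S"
    proof (rule bracket_span_minimal)
      show "subspace ?S" by (intro real_vector.subspace_sums subspace_bracket_span)
      fix x y
      obtain a c where x: "x = a + c" "a \<in> I" "c \<in> J" using IJ(2) by blast
      obtain a' c' where y: "y = a' + c'" "a' \<in> I" "c' \<in> J" using IJ(2) by blast
      have "bracket c a' = 0" using zero[OF y(2) x(3)] br_skew[of c a'] by simp
      then have "bracket x y = bracket a a' + bracket c c'" unfolding x(1) y(1) using zero x y by (simp add: br_add)
      then show "bracket x y \<in> ?S" using bracket_in_span x y by blast
    qed
    moreover have "z \<in> derived 1" unfolding e(3) using that by simp
    ultimately have "z \<in> ?S" by auto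
    then show ?thesis by blast
  qed
  have "I \<noteq> bracket_span I I" "J \<noteq> bracket_span J J"
    using perfect_ideal_in_nilpotent[OF _ nil] I(2) J(2) real_vector.subspace_0[OF sI] real_vector.subspace_0[OF sJ] by blast+
  then obtain x y where x: "x \<in> I" "x \<notin> bracket_span I I" and y: "y \<in> J" "y \<notin> bracket_span J J" using II by blast
  have ax: "\<alpha> y \<noteq> 0"
  proof
    assume "\<alpha> y = 0"
    then obtain p r where pr: "p \<in> bracket_span I I" "r \<in> bracket_span J J" "y = p + r" using split by blast
    have "p = y - r" using pr(3) by simp
    then have "p \<in> J" using y(1) pr(2) II sJ by (auto intro: real_vector.subspace_diff)
    then have "p = 0" using pr(1) II IJ(1) by blast
    then show False using pr y(2) by simp
  qed
  \<comment> \<open>The combination is chosen in the kernel of \<alpha>, which is [g, g]; comparing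
    the I-components puts x into [I, I].\<close>
  let ?c = "\<alpha> x / \<alpha> y"
  have "\<alpha> (x - ?c *\<^sub>R y) = 0" using ax by (simp add: linear_diff[OF e(1)] linear_cmul[OF e(1)])
  then obtain p r where pr: "p \<in> bracket_span I I" "r \<in> bracket_span J J" "x - ?c *\<^sub>R y = p + r" using split by blast
  have "x - p = r + ?c *\<^sub>R y" using pr(3) by (simp add: algebra_simps)
  moreover have "r + ?c *\<^sub>R y \<in> J" using y(1) pr(2) II sJ by (auto intro!: real_vector.subspace_add real_vector.subspace_scale)
  moreover have "x - p \<in> I" using x(1) pr(1) II sI by (auto intro!: real_vector.subspace_diff)
  ultimately have "x - p \<in> I \<inter> J" by simp
  then have "x = p" unfolding IJ(1) by simp
  then show False using pr(1) x(2) by simp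
qed

end

section \<open>Perfect algebras of dimension six\<close>

text \<open>
  Coordinates of exterior products of forms on a six-dimensional space: the sums run over shuffles. In
  \<open>contracted\<close>, the first argument of a product of a 2-form and a 3-form is the bracket of the basis vectors
  \<open>i\<close> and \<open>j\<close>, and \<open>wb i j\<close>, \<open>vb i j\<close> are the two forms with this bracket as first argument.
\<close>

definition wedge23 :: "(nat \<Rightarrow> nat \<Rightarrow> real) \<Rightarrow> (nat \<Rightarrow> nat \<Rightarrow> nat \<Rightarrow> real) \<Rightarrow> nat \<Rightarrow> nat \<Rightarrow> nat \<Rightarrow> nat \<Rightarrow> nat \<Rightarrow> real"
  where "wedge23 w v a b c d e =
      w a b * v c d e - w a c * v b d e + w a d * v b c e - w a e * v b c d + w b c * v a d e
      - w b d * v a c e + w b e * v a c d + w c d * v a b e - w c e * v a b d + w d e * v a b c"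

definition contracted :: "(nat \<Rightarrow> nat \<Rightarrow> real) \<Rightarrow> (nat \<Rightarrow> nat \<Rightarrow> nat \<Rightarrow> real) \<Rightarrow> (nat \<Rightarrow> nat \<Rightarrow> nat \<Rightarrow> real) \<Rightarrow>
    (nat \<Rightarrow> nat \<Rightarrow> nat \<Rightarrow> nat \<Rightarrow> real) \<Rightarrow> nat \<Rightarrow> nat \<Rightarrow> nat \<Rightarrow> nat \<Rightarrow> nat \<Rightarrow> nat \<Rightarrow> real"
  where "contracted w wb v vb i j a b c d =
      wb i j a * v b c d - wb i j b * v a c d + wb i j c * v a b d - wb i j d * v a b c + w a b * vb i j c d
      - w a c * vb i j b d + w a d * vb i j b c + w b c * vb i j a d - w b d * vb i j a c + w c d * vb i j a b"

definition wedge33 :: "(nat \<Rightarrow> nat \<Rightarrow> nat \<Rightarrow> real) \<Rightarrow> (nat \<Rightarrow> nat \<Rightarrow> nat \<Rightarrow> real) \<Rightarrow> real"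
  where "wedge33 u v =
      u 0 1 2 * v 3 4 5 - u 0 1 3 * v 2 4 5 + u 0 1 4 * v 2 3 5 - u 0 1 5 * v 2 3 4 + u 0 2 3 * v 1 4 5
      - u 0 2 4 * v 1 3 5 + u 0 2 5 * v 1 3 4 + u 0 3 4 * v 1 2 5 - u 0 3 5 * v 1 2 4 + u 0 4 5 * v 1 2 3
      - u 1 2 3 * v 0 4 5 + u 1 2 4 * v 0 3 5 - u 1 2 5 * v 0 3 4 - u 1 3 4 * v 0 2 5 + u 1 3 5 * v 0 2 4
      - u 1 4 5 * v 0 2 3 + u 2 3 4 * v 0 1 5 - u 2 3 5 * v 0 1 4 + u 2 4 5 * v 0 1 3 - u 3 4 5 * v 0 1 2"

definition wedge24 :: "(nat \<Rightarrow> nat \<Rightarrow> real) \<Rightarrow> (nat \<Rightarrow> nat \<Rightarrow> nat \<Rightarrow> nat \<Rightarrow> real) \<Rightarrow> real"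
  where "wedge24 w s =
      w 0 1 * s 2 3 4 5 - w 0 2 * s 1 3 4 5 + w 0 3 * s 1 2 4 5 - w 0 4 * s 1 2 3 5 + w 0 5 * s 1 2 3 4
      + w 1 2 * s 0 3 4 5 - w 1 3 * s 0 2 4 5 + w 1 4 * s 0 2 3 5 - w 1 5 * s 0 2 3 4 + w 2 3 * s 0 1 4 5
      - w 2 4 * s 0 1 3 5 + w 2 5 * s 0 1 3 4 + w 3 4 * s 0 1 2 5 - w 3 5 * s 0 1 2 4 + w 4 5 * s 0 1 2 3"

text \<open>The differential of a 5-form evaluated on all six basis vectors:
  \<open>g i j a b c d\<close> stands for its value on [i, j], a, b, c, d, and the sign is that of
  (-1)^(i + j).\<close>

definition pair_sum :: "(nat \<Rightarrow> nat \<Rightarrow> nat \<Rightarrow> nat \<Rightarrow> nat \<Rightarrow> nat \<Rightarrow> real) \<Rightarrow> real"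
  where "pair_sum g =
      - g 0 1 2 3 4 5 + g 0 2 1 3 4 5 - g 0 3 1 2 4 5 + g 0 4 1 2 3 5 - g 0 5 1 2 3 4
      - g 1 2 0 3 4 5 + g 1 3 0 2 4 5 - g 1 4 0 2 3 5 + g 1 5 0 2 3 4 - g 2 3 0 1 4 5
      + g 2 4 0 1 3 5 - g 2 5 0 1 3 4 - g 3 4 0 1 2 5 + g 3 5 0 1 2 4 - g 4 5 0 1 2 3"

text \<open>The Leibniz rule d(w v) = dw v + w dv for the exterior product of a 2-form and a 3-form,
  in the top degree.\<close>

lemma leibniz_coordinates:
  "pair_sum (contracted w wb v vb) =
    wedge33 (\<lambda>i j k. - wb i j k + wb i k j - wb j k i) v +
    wedge24 w (\<lambda>i j k l. - vb i j k l + vb i k j l - vb i l j k - vb j k i l + vb j l i k - vb k l i j)"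
  unfolding pair_sum_def contracted_def wedge33_def wedge24_def by (simp add: algebra_simps)

lemma sum_lessThan_6: "(\<Sum>m<(6::nat). f m) = f 0 + f 1 + f 2 + f 3 + f 4 + (f 5 :: real)"
  by (simp add: eval_nat_numeral)

lemma contracted_expand:
  assumes "\<And>k. k < 6 \<Longrightarrow> wb i j k = (\<Sum>m<6. c i j m * w m k)"
    and "\<And>k l. k < 6 \<Longrightarrow> l < 6 \<Longrightarrow> vb i j k l = (\<Sum>m<6. c i j m * v m k l)"
    and "a < 6" "b < 6" "d < 6" "e < 6"
  shows "contracted w wb v vb i j a b d e = (\<Sum>m<6. c i j m * wedge23 w v m a b d e)"
  unfolding contracted_def wedge23_def using assms(3-6)
  by (simp add: assms(1,2) sum_distrib_left sum_distrib_right distrib_left right_diff_distrib sum.distrib sum_subtractf mult_ac)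

text \<open>
  The coefficient of \<open>w \<and> v\<close> with the basis vector \<open>j\<close> left out is the trace of \<open>ad j\<close>, up to sign.
\<close>

lemma unimodular_coordinates:
  assumes w: "\<And>i. w i i = 0" "\<And>i j. j < i \<Longrightarrow> w i j = - w j (i::nat)"
    and v: "\<And>i j. v i i j = 0" "\<And>i j. v i j j = 0"
      "\<And>i j k. j < i \<Longrightarrow> v i j k = - v j i k" "\<And>i j k. k < j \<Longrightarrow> v i j k = - v i k j"
    and c: "\<And>i m. m < 6 \<Longrightarrow> c i i m = 0" "\<And>i j m. j < i \<Longrightarrow> m < 6 \<Longrightarrow> c i j m = - c j i m"
    and tr: "\<And>i. i < 6 \<Longrightarrow> (\<Sum>m<6. c i m m) = (0::real)"
  shows "pair_sum (\<lambda>i j a b d e. \<Sum>m<6. c i j m * wedge23 w v m a b d e) = 0"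
proof -
  \<comment> \<open>In each of these sums alternation leaves only m = i and m = j, as any other m
    repeats one of the remaining four indices.\<close>
  have p01: "(\<Sum>m<6. c 0 1 m * wedge23 w v m 2 3 4 5) = (c 0 1 0 * wedge23 w v 0 2 3 4 5) + c 0 1 1 * wedge23 w v 1 2 3 4 5"
    unfolding sum_lessThan_6 wedge23_def by (simp add: w v algebra_simps)
  have p02: "(\<Sum>m<6. c 0 2 m * wedge23 w v m 1 3 4 5) = (c 0 2 0 * wedge23 w v 0 1 3 4 5) - c 0 2 2 * wedge23 w v 1 2 3 4 5"
    unfolding sum_lessThan_6 wedge23_def by (simp add: w v algebra_simps)
  have p03: "(\<Sum>m<6. c 0 3 m * wedge23 w v m 1 2 4 5) = (c 0 3 0 * wedge23 w v 0 1 2 4 5) + c 0 3 3 * wedge23 w v 1 2 3 4 5"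
    unfolding sum_lessThan_6 wedge23_def by (simp add: w v algebra_simps)
  have p04: "(\<Sum>m<6. c 0 4 m * wedge23 w v m 1 2 3 5) = (c 0 4 0 * wedge23 w v 0 1 2 3 5) - c 0 4 4 * wedge23 w v 1 2 3 4 5"
    unfolding sum_lessThan_6 wedge23_def by (simp add: w v algebra_simps)
  have p05: "(\<Sum>m<6. c 0 5 m * wedge23 w v m 1 2 3 4) = (c 0 5 0 * wedge23 w v 0 1 2 3 4) + c 0 5 5 * wedge23 w v 1 2 3 4 5"
    unfolding sum_lessThan_6 wedge23_def by (simp add: w v algebra_simps)
  have p12: "(\<Sum>m<6. c 1 2 m * wedge23 w v m 0 3 4 5) = - (c 1 2 1 * wedge23 w v 0 1 3 4 5) - c 1 2 2 * wedge23 w v 0 2 3 4 5"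
    unfolding sum_lessThan_6 wedge23_def by (simp add: w v algebra_simps)
  have p13: "(\<Sum>m<6. c 1 3 m * wedge23 w v m 0 2 4 5) = - (c 1 3 1 * wedge23 w v 0 1 2 4 5) + c 1 3 3 * wedge23 w v 0 2 3 4 5"
    unfolding sum_lessThan_6 wedge23_def by (simp add: w v algebra_simps)
  have p14: "(\<Sum>m<6. c 1 4 m * wedge23 w v m 0 2 3 5) = - (c 1 4 1 * wedge23 w v 0 1 2 3 5) - c 1 4 4 * wedge23 w v 0 2 3 4 5"
    unfolding sum_lessThan_6 wedge23_def by (simp add: w v algebra_simps)
  have p15: "(\<Sum>m<6. c 1 5 m * wedge23 w v m 0 2 3 4) = - (c 1 5 1 * wedge23 w v 0 1 2 3 4) + c 1 5 5 * wedge23 w v 0 2 3 4 5"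
    unfolding sum_lessThan_6 wedge23_def by (simp add: w v algebra_simps)
  have p23: "(\<Sum>m<6. c 2 3 m * wedge23 w v m 0 1 4 5) = (c 2 3 2 * wedge23 w v 0 1 2 4 5) + c 2 3 3 * wedge23 w v 0 1 3 4 5"
    unfolding sum_lessThan_6 wedge23_def by (simp add: w v algebra_simps)
  have p24: "(\<Sum>m<6. c 2 4 m * wedge23 w v m 0 1 3 5) = (c 2 4 2 * wedge23 w v 0 1 2 3 5) - c 2 4 4 * wedge23 w v 0 1 3 4 5"
    unfolding sum_lessThan_6 wedge23_def by (simp add: w v algebra_simps)
  have p25: "(\<Sum>m<6. c 2 5 m * wedge23 w v m 0 1 3 4) = (c 2 5 2 * wedge23 w v 0 1 2 3 4) + c 2 5 5 * wedge23 w v 0 1 3 4 5"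
    unfolding sum_lessThan_6 wedge23_def by (simp add: w v algebra_simps)
  have p34: "(\<Sum>m<6. c 3 4 m * wedge23 w v m 0 1 2 5) = - (c 3 4 3 * wedge23 w v 0 1 2 3 5) - c 3 4 4 * wedge23 w v 0 1 2 4 5"
    unfolding sum_lessThan_6 wedge23_def by (simp add: w v algebra_simps)
  have p35: "(\<Sum>m<6. c 3 5 m * wedge23 w v m 0 1 2 4) = - (c 3 5 3 * wedge23 w v 0 1 2 3 4) + c 3 5 5 * wedge23 w v 0 1 2 4 5"
    unfolding sum_lessThan_6 wedge23_def by (simp add: w v algebra_simps)
  have p45: "(\<Sum>m<6. c 4 5 m * wedge23 w v m 0 1 2 3) = (c 4 5 4 * wedge23 w v 0 1 2 3 4) + c 4 5 5 * wedge23 w v 0 1 2 3 5"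
    unfolding sum_lessThan_6 wedge23_def by (simp add: w v algebra_simps)
  have t0: "(\<Sum>m<6. c 0 m m) * wedge23 w v 1 2 3 4 5 = 0" using tr[of 0] by simp
  have t1: "(\<Sum>m<6. c 1 m m) * wedge23 w v 0 2 3 4 5 = 0" using tr[of 1] by simp
  have t2: "(\<Sum>m<6. c 2 m m) * wedge23 w v 0 1 3 4 5 = 0" using tr[of 2] by simp
  have t3: "(\<Sum>m<6. c 3 m m) * wedge23 w v 0 1 2 4 5 = 0" using tr[of 3] by simp
  have t4: "(\<Sum>m<6. c 4 m m) * wedge23 w v 0 1 2 3 5 = 0" using tr[of 4] by simp
  have t5: "(\<Sum>m<6. c 5 m m) * wedge23 w v 0 1 2 3 4 = 0" using tr[of 5] by simp
  show ?thesis
    unfolding pair_sum_def p01 p02 p03 p04 p05 p12 p13 p14 p15 p23 p24 p25 p34 p35 p45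
    using t0 t1 t2 t3 t4 t5
    unfolding sum_lessThan_6 by (simp add: c algebra_simps)
qed

lemma independent_card_le_functionals_indexed:
  fixes E T :: "'a::real_vector set" and f :: "'i \<Rightarrow> 'a \<Rightarrow> real"
  assumes "independent E" "finite T" "finite I"
    and "\<And>i. i \<in> I \<Longrightarrow> linear (f i)"
    and "\<And>x. x \<in> span E \<Longrightarrow> (\<And>i. i \<in> I \<Longrightarrow> f i x = 0) \<Longrightarrow> x \<in> span T"
  shows "card E \<le> card I + card T \<and> finite E"
proof -
  obtain h where h: "bij_betw h {..<card I} I"
    unfolding lessThan_atLeast0 using ex_bij_betw_nat_finite[OF assms(3)] by blast
  have hI: "h k \<in> I" if "k < card I" for k using h that by (auto simp: bij_betw_def)
  show ?thesis
  proof (rule independent_card_le_functionals[OF assms(1,2), of "card I" "\<lambda>k. f (h k)"])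
    fix x assume x: "x \<in> span E" "\<And>k. k < card I \<Longrightarrow> f (h k) x = 0"
    have "f i x = 0" if "i \<in> I" for i
    proof -
      have "i \<in> h ` {..<card I}" using h that by (simp add: bij_betw_def)
      then show ?thesis using x(2) by auto
    qed
    then show "x \<in> span T" using assms(5) x(1) by blast
  qed (use assms(4) hI in auto)
qed

lemma independent_dual_family:
  fixes v :: "'i \<Rightarrow> 'a::real_vector" and g :: "'i \<Rightarrow> 'a \<Rightarrow> real"
  assumes "\<And>i. i \<in> I \<Longrightarrow> linear (g i)" "\<And>i j. i \<in> I \<Longrightarrow> j \<in> I \<Longrightarrow> g i (v j) = (if i = j then 1 else 0)"
  shows "independent (v ` I)" "inj_on v I"
proof -
  show inj: "inj_on v I"
  proof (rule inj_onI)
    fix i j assume ij: "i \<in> I" "j \<in> I" "v i = v j"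
    then show "i = j" using assms(2)[OF ij(1) ij(1)] assms(2)[OF ij(1,2)] by (auto split: if_splits)
  qed
  show "independent (v ` I)"
    unfolding real_vector.dependent_def
  proof
    assume "\<exists>a\<in>v ` I. a \<in> span (v ` I - {a})"
    then obtain i where i: "i \<in> I" "v i \<in> span (v ` I - {v i})" by blast
    have "g i (v i) = 0"
      by (rule linear_eq_0_on_span[OF assms(1)[OF i(1)] _ i(2)]) (use assms(2) i(1) in auto)
    then show False using assms(2) i(1) by simp
  qed
qed

lemma alt3_linear:
  assumes "alt3 \<phi>"
  shows "linear (\<phi> x y)" "linear (\<lambda>y. \<phi> x y z)" "linear (\<lambda>x. \<phi> x y z)" "\<phi> x x y = 0" "\<phi> x y y = 0"
  using assms unfolding alt3_def by auto

lemma alt3_swap: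
  assumes "alt3 \<phi>"
  shows "\<phi> y x z = - \<phi> x y z" "\<phi> x z y = - \<phi> x y z"
proof -
  note l = alt3_linear[OF assms]
  have "\<phi> (x + y) (x + y) z = \<phi> x y z + \<phi> y x z"
    unfolding linear_add[OF l(2)] linear_add[OF l(3)] by (simp add: l(4))
  then show "\<phi> y x z = - \<phi> x y z" using l(4)[of "x + y" z] by simp
  have "\<phi> x (y + z) (y + z) = \<phi> x y z + \<phi> x z y"
    unfolding linear_add[OF l(2)] linear_add[OF l(1)] by (simp add: l(5))
  then show "\<phi> x z y = - \<phi> x y z" using l(5)[of x "y + z"] by simp
qed

text \<open>Insertion sort by adjacent transpositions. It serves to reduce the vanishing of an
  alternating 4-form to increasing index tuples.\<close>

lemma adjacent_swaps_sorted:
  fixes P :: "nat \<Rightarrow> nat \<Rightarrow> nat \<Rightarrow> nat \<Rightarrow> bool"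
  assumes s12: "\<And>a b c d. P a b c d \<Longrightarrow> P b a c d" and s23: "\<And>a b c d. P a b c d \<Longrightarrow> P a c b d"
    and s34: "\<And>a b c d. P a b c d \<Longrightarrow> P a b d c"
    and sorted: "\<And>a b c d. a \<le> b \<Longrightarrow> b \<le> c \<Longrightarrow> c \<le> d \<Longrightarrow> P a b c d"
  shows "P a b c d"
proof -
  have 3: "P a b c d" if "b \<le> c" "c \<le> d" for a b c d
  proof -
    consider "a \<le> b" | "b \<le> a" "a \<le> c" | "c \<le> a" "a \<le> d" | "d \<le> a" by linarith
    then show ?thesis
    proof cases
      case 1
      then show ?thesis using that by (intro sorted)
    next
      case 2
      then have "P b a c d" using that by (intro sorted)
      then show ?thesis by (rule s12)
    next
      case 3
      then have "P b c a d" using that by (intro sorted)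
      then have "P b a c d" by (rule s23)
      then show ?thesis by (rule s12)
    next
      case 4
      then have "P b c d a" using that by (intro sorted)
      then have "P b c a d" by (rule s34)
      then have "P b a c d" by (rule s23)
      then show ?thesis by (rule s12)
    qed
  qed
  have 2: "P a b c d" if "c \<le> d" for a b c d
  proof -
    consider "b \<le> c" | "c \<le> b" "b \<le> d" | "d \<le> b" by linarith
    then show ?thesis
    proof cases
      case 1
      then show ?thesis using that by (intro 3)
    next
      case 2
      then have "P a c b d" by (intro 3)
      then show ?thesis by (rule s23)
    next
      case 3
      then have "P a c d b" using that by (intro \<open>\<And>d c b a. b \<le> c \<Longrightarrow> c \<le> d \<Longrightarrow> P a b c d\<close>)
      then have "P a c b d" by (rule s34)
      then show ?thesis by (rule s23)
    qed
  qed
  show ?thesis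
  proof (cases "c \<le> d")
    case True
    then show ?thesis by (rule 2)
  next
    case False
    then have "P a b d c" by (intro 2) simp
    then show ?thesis by (rule s34)
  qed
qed

context fd_lie_algebra
begin

section \<open>Closedness on a basis and the pairing of 2-forms with 4-forms\<close>

lemma d3_swap:
  assumes "alt3 \<phi>"
  shows "d3 \<phi> y x z w = - d3 \<phi> x y z w" "d3 \<phi> x z y w = - d3 \<phi> x y z w" "d3 \<phi> x y w z = - d3 \<phi> x y z w"
proof -
  have n: "\<phi> (bracket v u) s t = - \<phi> (bracket u v) s t" for u v s t
    by (subst br_skew) (simp add: linear_neg[OF alt3_linear(3)[OF assms]])
  show "d3 \<phi> y x z w = - d3 \<phi> x y z w"
    unfolding d3_def using n[of x y z w] alt3_swap(2)[OF assms, of "bracket z w" x y] by simp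
  show "d3 \<phi> x z y w = - d3 \<phi> x y z w"
    unfolding d3_def using n[of y z x w] alt3_swap(2)[OF assms, of "bracket x w" y z] by simp
  show "d3 \<phi> x y w z = - d3 \<phi> x y z w"
    unfolding d3_def using n[of z w x y] alt3_swap(2)[OF assms, of "bracket x y" z w] by simp
qed

lemma linear_d3:
  assumes "alt3 \<phi>"
  shows "linear (d3 \<phi> x y z)" "linear (\<lambda>z. d3 \<phi> x y z w)" "linear (\<lambda>y. d3 \<phi> x y z w)" "linear (\<lambda>x. d3 \<phi> x y z w)"
proof -
  note l = alt3_linear[OF assms]
  note simps = br_add br_scale linear_add[OF l(1)] linear_add[OF l(2)] linear_add[OF l(3)]
    linear_cmul[OF l(1)] linear_cmul[OF l(2)] linear_cmul[OF l(3)]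
  show "linear (d3 \<phi> x y z)" "linear (\<lambda>z. d3 \<phi> x y z w)" "linear (\<lambda>y. d3 \<phi> x y z w)" "linear (\<lambda>x. d3 \<phi> x y z w)"
    unfolding d3_def by (rule linearI; simp only: simps real_scaleR_def; simp only: algebra_simps add_uminus_conv_diff minus_add_distrib mult_minus_right)+
qed

lemma linear_zero_on_basis:
  assumes rc: "rel_coords UNIV {0} n b \<xi>" and "linear f" "\<And>i. i < n \<Longrightarrow> f (b i) = (0::real)"
  shows "f x = 0"
proof -
  have "x = (\<Sum>i<n. \<xi> i x *\<^sub>R b i)" using rel_coordsD(8)[OF rc, of x] by simp
  then have "f x = f (\<Sum>i<n. \<xi> i x *\<^sub>R b i)" by (rule arg_cong)
  then show ?thesis using assms(2,3) by (simp add: linear_sum linear_cmul)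
qed

lemma d3_zero_of_sorted:
  assumes a: "alt3 \<phi>" and rc: "rel_coords UNIV {0} n b \<xi>"
    and z: "\<And>i j k l. i < j \<Longrightarrow> j < k \<Longrightarrow> k < l \<Longrightarrow> l < n \<Longrightarrow> d3 \<phi> (b i) (b j) (b k) (b l) = 0"
  shows "d3 \<phi> x y u v = 0"
proof -
  have basis: "i < n \<longrightarrow> j < n \<longrightarrow> k < n \<longrightarrow> l < n \<longrightarrow> d3 \<phi> (b i) (b j) (b k) (b l) = 0" for i j k l
  proof (rule adjacent_swaps_sorted[of "\<lambda>i j k l. i < n \<longrightarrow> j < n \<longrightarrow> k < n \<longrightarrow> l < n \<longrightarrow> d3 \<phi> (b i) (b j) (b k) (b l) = 0"])
    fix i j k l :: nat assume le: "i \<le> j" "j \<le> k" "k \<le> l"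
    have diag: "d3 \<phi> x x y z = 0" "d3 \<phi> x y y z = 0" "d3 \<phi> x y z z = 0" for x y z
      using d3_swap(1)[OF a, of x x y z] d3_swap(2)[OF a, of x y y z] d3_swap(3)[OF a, of x y z z] by auto
    show "i < n \<longrightarrow> j < n \<longrightarrow> k < n \<longrightarrow> l < n \<longrightarrow> d3 \<phi> (b i) (b j) (b k) (b l) = 0"
    proof (cases "i < j \<and> j < k \<and> k < l")
      case True
      then show ?thesis using z by blast
    next
      case False
      then have "i = j \<or> j = k \<or> k = l" using le by linarith
      then show ?thesis using diag by auto
    qed
  next
    fix i j k l :: nat
    assume h: "i < n \<longrightarrow> j < n \<longrightarrow> k < n \<longrightarrow> l < n \<longrightarrow> d3 \<phi> (b i) (b j) (b k) (b l) = 0"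
    show "j < n \<longrightarrow> i < n \<longrightarrow> k < n \<longrightarrow> l < n \<longrightarrow> d3 \<phi> (b j) (b i) (b k) (b l) = 0"
      using h d3_swap(1)[OF a, of "b j" "b i" "b k" "b l"] by auto
    show "i < n \<longrightarrow> k < n \<longrightarrow> j < n \<longrightarrow> l < n \<longrightarrow> d3 \<phi> (b i) (b k) (b j) (b l) = 0"
      using h d3_swap(2)[OF a, of "b i" "b k" "b j" "b l"] by auto
    show "i < n \<longrightarrow> j < n \<longrightarrow> l < n \<longrightarrow> k < n \<longrightarrow> d3 \<phi> (b i) (b j) (b l) (b k) = 0"
      using h d3_swap(3)[OF a, of "b i" "b j" "b l" "b k"] by auto
  qed
  note lin = linear_d3[OF a] and zb = linear_zero_on_basis[OF rc]
  have 3: "d3 \<phi> (b i) (b j) (b k) v = 0" if "i < n" "j < n" "k < n" for i j k v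
    by (rule zb[OF lin(1)]) (use basis that in simp)
  have 2: "d3 \<phi> (b i) (b j) u v = 0" if "i < n" "j < n" for i j u v
    by (rule zb[OF lin(2)]) (use 3 that in simp)
  have 1: "d3 \<phi> (b i) y u v = 0" if "i < n" for i y u v
    by (rule zb[OF lin(3)]) (use 2 that in simp)
  show ?thesis by (rule zb[OF lin(4)]) (use 1 in simp)
qed

text \<open>A perfect algebra is unimodular, so the differential of the 5-form \<omega> \<beta>
  vanishes, and the Leibniz rule moves d from one factor to the other.\<close>

lemma perfect_wedge_duality:
  assumes rc: "rel_coords UNIV {0} 6 b \<xi>" and perf: "derived 1 = UNIV" and \<omega>: "alt2 \<omega>" and \<beta>: "alt3 \<beta>"
  shows "wedge33 (\<lambda>i j k. d2 \<omega> (b i) (b j) (b k)) (\<lambda>i j k. \<beta> (b i) (b j) (b k)) =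
    - wedge24 (\<lambda>i j. \<omega> (b i) (b j)) (\<lambda>i j k l. d3 \<beta> (b i) (b j) (b k) (b l))"
proof -
  define c where "c i j m = \<xi> m (bracket (b i) (b j))" for i j m
  let ?w = "\<lambda>i j. \<omega> (b i) (b j)" and ?v = "\<lambda>i j k. \<beta> (b i) (b j) (b k)"
  let ?wb = "\<lambda>i j k. \<omega> (bracket (b i) (b j)) (b k)" and ?vb = "\<lambda>i j k l. \<beta> (bracket (b i) (b j)) (b k) (b l)"
  have ex: "bracket (b i) (b j) = (\<Sum>m<6. c i j m *\<^sub>R b m)" for i j
    using rel_coordsD(8)[OF rc, of "bracket (b i) (b j)"] by (simp add: c_def)
  have lin: "\<And>m. m < 6 \<Longrightarrow> linear (\<xi> m)" using rel_coordsD(5)[OF rc] .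
  have wb: "?wb i j k = (\<Sum>m<6. c i j m * ?w m k)" for i j k
    by (subst ex) (simp add: linear_sum[OF alt2_linear(2)[OF \<omega>]] linear_cmul[OF alt2_linear(2)[OF \<omega>]])
  have vb: "?vb i j k l = (\<Sum>m<6. c i j m * ?v m k l)" for i j k l
    by (subst ex) (simp add: linear_sum[OF alt3_linear(3)[OF \<beta>]] linear_cmul[OF alt3_linear(3)[OF \<beta>]])
  have "pair_sum (contracted ?w ?wb ?v ?vb) = pair_sum (\<lambda>i j a b d e. \<Sum>m<6. c i j m * wedge23 ?w ?v m a b d e)"
  proof -
    have "contracted ?w ?wb ?v ?vb i j p q r s = (\<Sum>m<6. c i j m * wedge23 ?w ?v m p q r s)"
      if "p < 6" "q < 6" "r < 6" "s < 6" for i j p q r s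
      by (rule contracted_expand[OF wb vb that])
    then show ?thesis unfolding pair_sum_def by simp
  qed
  also have "\<dots> = 0"
  proof (rule unimodular_coordinates)
    show "?w i j = - ?w j i" for i j by (rule alt2_skew[OF \<omega>])
    show "?v i j k = - ?v j i k" "?v i j k = - ?v i k j" for i j k by (rule alt3_swap[OF \<beta>])+
    show "(\<Sum>m<6. c i m m) = 0" for i
      using perfect_ctrace_zero[OF lie_ideal_UNIV _ lie_ideal_UNIV rc, of "b i"] perf
      unfolding ctrace_def c_def by simp
    show "c i i m = 0" if "m < 6" for i m using lin[OF that] by (simp add: c_def bracket_self linear_0)
    show "c i j m = - c j i m" if "m < 6" for i j m
      using linear_neg[OF lin[OF that], of "bracket (b j) (b i)"] br_skew[of "b i" "b j"] by (simp add: c_def)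
  qed (use alt2_linear(3)[OF \<omega>] alt3_linear(4,5)[OF \<beta>] in auto)
  finally show ?thesis
    unfolding leibniz_coordinates d2_def d3_def by simp
qed


lemma alt2_subspace: "subspace {\<omega> :: 'a \<Rightarrow> 'a \<Rightarrow> real. alt2 \<omega>}"
  unfolding real_vector.subspace_def alt2_def bilinear_def linear_iff scaleR_fun_def plus_fun_def zero_fun_def
  by (auto simp: algebra_simps)

lemma alt3_subspace: "subspace {\<phi> :: 'a \<Rightarrow> 'a \<Rightarrow> 'a \<Rightarrow> real. alt3 \<phi>}"
  unfolding real_vector.subspace_def alt3_def linear_iff scaleR_fun_def plus_fun_def zero_fun_def
  by (auto simp: algebra_simps)

lemma linear_d2: "linear d2"
  by (rule linearI) (simp_all add: fun_eq_iff d2_def plus_fun_def scaleR_fun_def algebra_simps)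

definition wedge2 :: "('a \<Rightarrow> real) \<Rightarrow> ('a \<Rightarrow> real) \<Rightarrow> 'a \<Rightarrow> 'a \<Rightarrow> real"
  where "wedge2 f g x y = f x * g y - g x * f y"

definition wedge3 :: "('a \<Rightarrow> real) \<Rightarrow> ('a \<Rightarrow> real) \<Rightarrow> ('a \<Rightarrow> real) \<Rightarrow> 'a \<Rightarrow> 'a \<Rightarrow> 'a \<Rightarrow> real"
  where "wedge3 f g h x y z = f x * wedge2 g h y z - f y * wedge2 g h x z + f z * wedge2 g h x y"

lemma alt2_wedge2: "linear f \<Longrightarrow> linear g \<Longrightarrow> alt2 (wedge2 f g)"
  unfolding alt2_def bilinear_def wedge2_def by (auto intro!: linearI simp: linear_add linear_cmul algebra_simps)

lemma alt3_wedge3: "linear f \<Longrightarrow> linear g \<Longrightarrow> linear h \<Longrightarrow> alt3 (wedge3 f g h)"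
  unfolding alt3_def wedge3_def wedge2_def by (auto intro!: linearI simp: linear_add linear_cmul algebra_simps)

text \<open>Let R complete the exact 2-forms to a basis of all 2-forms; it has at most 15 - 6 = 9
  elements. A 3-form orthogonal to d R is closed by duality, hence exact, hence in the span of d R.
  So the space of 3-forms would have dimension at most 9 + 9, but it has dimension 20.\<close>

lemma perfect_dim_6:
  assumes H3: "H3_trivial" and dim6: "dim (UNIV :: 'a set) = 6"
  shows "derived 1 \<noteq> UNIV"
proof
  assume perf: "derived 1 = UNIV"
  have "dim ({0} :: 'a set) = 0"
    by (metis card.empty real_vector.dim_span_eq_card_independent real_vector.independent_empty real_vector.span_empty)
  moreover obtain n b \<xi> where "rel_coords (UNIV :: 'a set) {0} n b \<xi>" "dim (UNIV :: 'a set) = dim ({0} :: 'a set) + n"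
    by (rule coords[of UNIV "{0}"]) auto
  ultimately have rc: "rel_coords (UNIV :: 'a set) {0} 6 b \<xi>" using dim6 by simp
  have lin: "\<And>m. m < 6 \<Longrightarrow> linear (\<xi> m)" using rel_coordsD(5)[OF rc] .
  have \<xi>b: "\<And>i j. i < 6 \<Longrightarrow> j < 6 \<Longrightarrow> \<xi> i (b j) = (if i = j then 1 else 0)" using rel_coordsD(7)[OF rc] .
  \<comment> \<open>The largest index comes first, so that the bounds on the others can depend on
    it; forms are still evaluated on increasing indices.\<close>
  define I2 where "I2 = (SIGMA j:{..<6::nat}. {..<j})"
  define I3 where "I3 = (SIGMA k:{..<6::nat}. SIGMA j:{..<k}. {..<j})"
  have card2: "card I2 = 15" and card3: "card I3 = 20" and fin: "finite I2" "finite I3"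
    unfolding I2_def I3_def by (simp_all add: eval_nat_numeral)
  let ?A2 = "{\<omega> :: 'a \<Rightarrow> 'a \<Rightarrow> real. alt2 \<omega>}" and ?A3 = "{\<phi> :: 'a \<Rightarrow> 'a \<Rightarrow> 'a \<Rightarrow> real. alt3 \<phi>}"
  define d1 where "d1 \<theta> = (\<lambda>x y. - \<theta> (bracket x y))" for \<theta> :: "'a \<Rightarrow> real"
  have lind1: "linear d1" unfolding d1_def by (rule linearI) (auto simp: plus_fun_def scaleR_fun_def)
  have sub_lin: "linear \<theta>" if "\<theta> \<in> span (\<xi> ` {..<6})" for \<theta>
    using that
  proof (induction rule: real_vector.span_induct_alt)
    case base
    then show ?case by (simp add: zero_fun_def linear_iff)
  next
    case (step c x y)
    then have "linear x" using lin by auto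
    then show ?case using step(2) unfolding linear_iff plus_fun_def scaleR_fun_def by (simp add: algebra_simps)
  qed
  define E1 where "E1 = d1 ` \<xi> ` {..<6}"
  have linev: "linear (\<lambda>\<theta>. \<theta> (b i))" for i :: nat
    by (rule linearI) (simp_all add: plus_fun_def scaleR_fun_def)
  have ind1: "independent (\<xi> ` {..<6})" and inj1: "inj_on \<xi> {..<6}"
    by (rule independent_dual_family[of "{..<6}" "\<lambda>i \<theta>. \<theta> (b i)"]; use \<xi>b linev in auto)+
  have injd1: "inj_on d1 (span (\<xi> ` {..<6}))"
  proof (rule inj_onI)
    fix \<theta> \<theta>' assume \<theta>: "\<theta> \<in> span (\<xi> ` {..<6})" "\<theta>' \<in> span (\<xi> ` {..<6})" "d1 \<theta> = d1 \<theta>'"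
    have l: "linear (\<lambda>x. \<theta> x - \<theta>' x)" using sub_lin[OF \<theta>(1)] sub_lin[OF \<theta>(2)] by (rule linear_compose_sub)
    have "\<theta> x - \<theta>' x = 0" for x
    proof (rule linear_eq_0_on_span[OF l])
      show "x \<in> span {bracket x y |x y. x \<in> UNIV \<and> y \<in> UNIV}" using perf by (simp add: bracket_span_def)
      show "\<theta> y - \<theta>' y = 0" if "y \<in> {bracket x y |x y. x \<in> UNIV \<and> y \<in> UNIV}" for y
        using that \<theta>(3) unfolding d1_def fun_eq_iff by auto
    qed
    then show "\<theta> = \<theta>'" by (simp add: fun_eq_iff)
  qed
  have indE1: "independent E1" unfolding E1_def using linear_independent_injective_image[OF lind1 ind1 injd1] .
  have cardE1: "card E1 = 6" unfolding E1_def
    using card_image[OF inj1] card_image[OF inj_on_subset[OF injd1 real_vector.span_superset]] by simp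
  have E1A: "E1 \<subseteq> ?A2"
    unfolding E1_def d1_def alt2_def bilinear_def
    by (auto intro!: linearI simp: br_add br_scale bracket_self linear_add[OF lin] linear_cmul[OF lin] linear_0[OF lin])
  have d2E1: "d2 \<omega> = 0" if \<omega>: "\<omega> \<in> E1" for \<omega>
  proof -
    obtain i where i: "i < 6" "\<omega> = (\<lambda>x y. - \<xi> i (bracket x y))" using \<omega> unfolding E1_def d1_def by auto
    have "d2 \<omega> x y z = 0" for x y z
    proof -
      have "\<xi> i (bracket (bracket x y) z - bracket (bracket x z) y + bracket (bracket y z) x) = 0"
      proof -
        have "bracket (bracket x y) z - bracket (bracket x z) y + bracket (bracket y z) x = 0"
          using jacobi[of x y z] br_skew[of z "bracket x y"] br_skew[of z x] br_skew[of y "bracket x z"] br_skew[of x "bracket y z"]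
          by (simp add: br_minus algebra_simps)
        then show ?thesis using linear_0[OF lin[OF i(1)]] by simp
      qed
      then show ?thesis unfolding d2_def i(2) by (simp add: linear_add[OF lin[OF i(1)]] linear_diff[OF lin[OF i(1)]])
    qed
    then show ?thesis by (simp add: fun_eq_iff zero_fun_def)
  qed
  obtain B where B: "E1 \<subseteq> B" "B \<subseteq> ?A2" "independent B" "?A2 \<subseteq> span B"
    using real_vector.maximal_independent_subset_extend[OF E1A indE1] by blast
  have spB: "span B \<subseteq> ?A2" using B(2) alt2_subspace by (rule real_vector.span_minimal)
  have cardB: "card B \<le> card I2 + card ({} :: ('a \<Rightarrow> 'a \<Rightarrow> real) set) \<and> finite B"
  proof (rule independent_card_le_functionals_indexed[OF B(3) _ fin(1), of _ "\<lambda>(j, i) \<omega>. \<omega> (b i) (b j)"])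
    show "linear (case p of (j, i) \<Rightarrow> \<lambda>\<omega>. \<omega> (b i) (b j))" for p
      by (cases p) (auto intro!: linearI simp: plus_fun_def scaleR_fun_def)
    fix \<omega> assume \<omega>: "\<omega> \<in> span B" "\<And>p. p \<in> I2 \<Longrightarrow> (case p of (j, i) \<Rightarrow> \<lambda>\<omega>. \<omega> (b i) (b j)) \<omega> = 0"
    have a: "alt2 \<omega>" using \<omega>(1) spB by blast
    have lt: "\<omega> (b i) (b j) = 0" if "i < j" "j < 6" for i j using \<omega>(2)[of "(j, i)"] that by (auto simp: I2_def)
    have bb: "\<omega> (b i) (b j) = 0" if "i < 6" "j < 6" for i j
    proof -
      consider "i < j" | "i = j" | "j < i" by linarith
      then show ?thesis
      proof cases
        case 3
        then show ?thesis using lt[OF 3 that(1)] alt2_skew[OF a, of "b i" "b j"] by simp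
      qed (use lt that alt2_linear(3)[OF a] in auto)
    qed
    have b1: "\<omega> (b i) y = 0" if "i < 6" for i y
      by (rule linear_zero_on_basis[OF rc alt2_linear(1)[OF a]]) (rule bb[OF that])
    have "\<omega> x y = 0" for x y
      by (rule linear_zero_on_basis[OF rc alt2_linear(2)[OF a]]) (rule b1)
    then have "\<omega> = 0" by (simp add: fun_eq_iff zero_fun_def)
    then show "\<omega> \<in> span {}" by (simp add: real_vector.span_zero)
  qed simp
  \<comment> \<open>Since d kills the exact forms E1, the images of R already span all exact
    3-forms.\<close>
  define R where "R = B - E1"
  have finE1: "finite E1" unfolding E1_def by simp
  have finR: "finite R" using cardB unfolding R_def by simp
  have cardR: "card R \<le> 9"
  proof -
    have "card B \<le> 15" using cardB card2 by simp
    then show ?thesis using card_Diff_subset[OF finE1 B(1)] cardE1 unfolding R_def by linarith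
  qed
  define T where "T = d2 ` R"
  have d2T: "d2 \<omega> \<in> span T" if "alt2 \<omega>" for \<omega>
  proof -
    have "\<omega> \<in> span B" using that B(4) by blast
    then have "d2 \<omega> \<in> span (d2 ` B)" unfolding linear_span_image[OF linear_d2] by (rule imageI)
    moreover have "d2 ` B \<subseteq> span T"
    proof
      fix y assume "y \<in> d2 ` B"
      then obtain r where r: "r \<in> B" "y = d2 r" by blast
      show "y \<in> span T"
      proof (cases "r \<in> E1")
        case True
        then show ?thesis using d2E1 r by (simp add: real_vector.span_zero)
      next
        case False
        then show ?thesis using r unfolding T_def R_def by (intro real_vector.span_base) blast
      qed
    qed
    ultimately show ?thesis using real_vector.span_minimal[of "d2 ` B" "span T"] by auto
  qed
  define ev :: "('a \<Rightarrow> 'a \<Rightarrow> 'a \<Rightarrow> real) \<Rightarrow> nat \<Rightarrow> nat \<Rightarrow> nat \<Rightarrow> real"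
    where "ev \<phi> i j k = \<phi> (b i) (b j) (b k)" for \<phi> i j k
  have evlin: "ev (\<phi> + \<psi>) i j k = ev \<phi> i j k + ev \<psi> i j k" "ev (c *\<^sub>R \<phi>) i j k = c * ev \<phi> i j k" for \<phi> \<psi> c i j k
    by (simp_all add: ev_def plus_fun_def scaleR_fun_def)
  define \<epsilon> where "\<epsilon> p = (case p of (k, j, i) \<Rightarrow> wedge3 (\<xi> i) (\<xi> j) (\<xi> k))" for p
  have \<epsilon>A: "\<epsilon> p \<in> ?A3" if "p \<in> I3" for p
    using that lin unfolding \<epsilon>_def I3_def by (auto intro!: alt3_wedge3)
  have ind3: "independent (\<epsilon> ` I3)" and inj3: "inj_on \<epsilon> I3"
  proof -
    have l: "linear ((\<lambda>p \<phi>. case p of (k, j, i) \<Rightarrow> ev \<phi> i j k) p)" for p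
      by (cases p) (auto intro!: linearI simp: evlin)
    have d: "(\<lambda>p \<phi>. case p of (k, j, i) \<Rightarrow> ev \<phi> i j k) p (\<epsilon> p') = (if p = p' then 1 else 0)"
      if "p \<in> I3" "p' \<in> I3" for p p'
    proof -
      obtain k j i k' j' i' where p: "p = (k, j, i)" "p' = (k', j', i')" by (cases p, cases p') auto
      have "i < j" "j < k" "k < 6" "i' < j'" "j' < k'" "k' < 6" using that unfolding p I3_def by auto
      then have "wedge3 (\<xi> i') (\<xi> j') (\<xi> k') (b i) (b j) (b k) = (if i = i' \<and> j = j' \<and> k = k' then 1 else 0)"
        unfolding wedge3_def wedge2_def by (simp add: \<xi>b)
      then show ?thesis unfolding p \<epsilon>_def ev_def by simp
    qed
    show "independent (\<epsilon> ` I3)" "inj_on \<epsilon> I3"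
      by (rule independent_dual_family[of I3 "\<lambda>p \<phi>. case p of (k, j, i) \<Rightarrow> ev \<phi> i j k", OF l d]; assumption)+
  qed
  have "card (\<epsilon> ` I3) \<le> card R + card T \<and> finite (\<epsilon> ` I3)"
  proof (rule independent_card_le_functionals_indexed[OF ind3 _ finR, of T "\<lambda>r \<phi>. wedge33 (ev (d2 r)) (ev \<phi>)"])
    show "finite T" unfolding T_def using finR by simp
    show lw: "linear (\<lambda>\<phi>. wedge33 (ev (d2 r)) (ev \<phi>))" for r
      unfolding wedge33_def by (rule linearI) (simp_all add: evlin algebra_simps)
    fix \<phi> assume \<phi>: "\<phi> \<in> span (\<epsilon> ` I3)" "\<And>r. r \<in> R \<Longrightarrow> wedge33 (ev (d2 r)) (ev \<phi>) = 0"
    have a: "alt3 \<phi>" using \<phi>(1) real_vector.span_minimal[of "\<epsilon> ` I3" ?A3, OF _ alt3_subspace] \<epsilon>A by blast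
    have lw': "linear (\<lambda>\<psi>. wedge33 (ev \<psi>) (ev \<phi>))"
      unfolding wedge33_def by (rule linearI) (simp_all add: evlin algebra_simps)
    have "wedge33 (ev \<psi>) (ev \<phi>) = 0" if "\<psi> \<in> span T" for \<psi>
      by (rule linear_eq_0_on_span[OF lw' _ that]) (use \<phi>(2) in \<open>auto simp: T_def\<close>)
    then have w33: "wedge33 (ev (d2 \<omega>)) (ev \<phi>) = 0" if "alt2 \<omega>" for \<omega> using d2T that by blast
    have w24: "wedge24 (\<lambda>i j. \<omega> (b i) (b j)) (\<lambda>i j k l. d3 \<phi> (b i) (b j) (b k) (b l)) = 0" if "alt2 \<omega>" for \<omega>
      using perfect_wedge_duality[OF rc perf that a] w33[OF that] unfolding ev_def by simp
    define s where "s i j k l = d3 \<phi> (b i) (b j) (b k) (b l)" for i j k l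
    \<comment> \<open>Pairing with an elementary 2-form picks out the coordinate of s at the four
      complementary indices, up to sign.\<close>
    have w: "wedge24 (\<lambda>i j. wedge2 (\<xi> p) (\<xi> q) (b i) (b j)) s = 0" if "p < 6" "q < 6" for p q
      unfolding s_def using that lin by (intro w24 alt2_wedge2) auto
    have s0: "s 2 3 4 5 = 0" "s 1 3 4 5 = 0" "s 1 2 4 5 = 0" "s 1 2 3 5 = 0" "s 1 2 3 4 = 0"
      "s 0 3 4 5 = 0" "s 0 2 4 5 = 0" "s 0 2 3 5 = 0" "s 0 2 3 4 = 0" "s 0 1 4 5 = 0"
      "s 0 1 3 5 = 0" "s 0 1 3 4 = 0" "s 0 1 2 5 = 0" "s 0 1 2 4 = 0" "s 0 1 2 3 = 0"
      using w[of 0 1] w[of 0 2] w[of 0 3] w[of 0 4] w[of 0 5] w[of 1 2] w[of 1 3] w[of 1 4] w[of 1 5]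
        w[of 2 3] w[of 2 4] w[of 2 5] w[of 3 4] w[of 3 5] w[of 4 5]
      unfolding wedge24_def wedge2_def by (simp_all add: \<xi>b)
    have sz: "s i j k l = 0" if "i < j" "j < k" "k < l" "l < 6" for i j k l
    proof -
      have "i \<in> {0, 1, 2}" "j \<in> {1, 2, 3}" "k \<in> {2, 3, 4}" "l \<in> {3, 4, 5}" using that by auto
      then show ?thesis using that s0 by auto
    qed
    have "d3 \<phi> x y z u = 0" for x y z u
      by (rule d3_zero_of_sorted[OF a rc]) (rule sz[unfolded s_def])
    then have "\<exists>\<omega>. alt2 \<omega> \<and> (\<forall>x y z. \<phi> x y z = d2 \<omega> x y z)" using H3 a unfolding H3_trivial_def by simp
    then obtain \<omega> where \<omega>: "alt2 \<omega>" "\<forall>x y z. \<phi> x y z = d2 \<omega> x y z" by blast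
    then have "\<phi> = d2 \<omega>" by (simp add: fun_eq_iff)
    then show "\<phi> \<in> span T" using d2T[OF \<omega>(1)] by simp
  qed
  moreover have "card T \<le> card R" unfolding T_def by (rule card_image_le[OF finR])
  ultimately show False using cardR card_image[OF inj3] card3 by simp
qed

end

section \<open>Cochains of low degree and quotient spaces\<close>

lemma quotient_space_trivial_iff:
  assumes "subspace V" "subspace W" "W \<subseteq> V"
  shows "quotient_space V W = {W} \<longleftrightarrow> V = W"
proof
  have im: "quotient_rel V W `` {x} = {y \<in> V. x - y \<in> W}" if "x \<in> V" for x
    using that by (auto simp: quotient_rel_def)
  show "V = W" if q: "quotient_space V W = {W}"
  proof -
    have "x \<in> W" if "x \<in> V" for x
    proof -
      have "quotient_rel V W `` {x} \<in> quotient_space V W" unfolding quotient_space_def using that by (rule quotientI)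
      then have "{y \<in> V. x - y \<in> W} = W" using q im[OF that] by simp
      moreover have "x \<in> {y \<in> V. x - y \<in> W}" using that assms(2) by (simp add: real_vector.subspace_0)
      ultimately show ?thesis by blast
    qed
    then show ?thesis using assms(3) by blast
  qed
  show "quotient_space V W = {W}" if "V = W"
  proof -
    have "quotient_rel V W `` {x} = W" if x: "x \<in> V" for x
    proof -
      have "{y \<in> V. x - y \<in> W} = W" using x real_vector.subspace_diff[OF assms(2)] unfolding \<open>V = W\<close> by blast
      then show ?thesis using im[OF x] by simp
    qed
    moreover have "0 \<in> V" using assms(1) by (rule real_vector.subspace_0)
    ultimately show ?thesis unfolding quotient_space_def quotient_def by blast
  qed
qed

text \<open>The exchange lemma modulo W, on coefficient vectors: for m > n the n linear conditions
  on t would have a nonzero solution, and the corresponding combination of the b j would lie in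
  W.\<close>

lemma quotient_basis_card_le:
  fixes z :: "nat \<Rightarrow> 'a::real_vector" and b :: "nat \<Rightarrow> 'a"
  assumes W: "subspace W" and span: "\<And>j. j < m \<Longrightarrow> \<exists>a. b j - (\<Sum>i<n. a i *\<^sub>R z i) \<in> W"
    and indep: "\<And>t j. (\<Sum>j<m. t j *\<^sub>R b j) \<in> W \<Longrightarrow> j < m \<Longrightarrow> t j = 0"
  shows "m \<le> n"
proof -
  obtain c where c: "\<And>j. j < m \<Longrightarrow> b j - (\<Sum>i<n. c j i *\<^sub>R z i) \<in> W" using span by metis
  define v :: "nat \<Rightarrow> nat \<Rightarrow> real" where "v j k = (if j = k then 1 else 0)" for j k
  have lin: "linear (\<lambda>t :: nat \<Rightarrow> real. t j)" for j
    by (rule linearI) (simp_all add: plus_fun_def scaleR_fun_def)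
  have ind: "independent (v ` {..<m})" and inj: "inj_on v {..<m}"
    by (rule independent_dual_family[of "{..<m}" "\<lambda>j t. t j"]; use lin in \<open>auto simp: v_def\<close>)+
  have "card (v ` {..<m}) \<le> n + card ({} :: (nat \<Rightarrow> real) set) \<and> finite (v ` {..<m})"
  proof (rule independent_card_le_functionals[OF ind, of "{}" n "\<lambda>i t. \<Sum>j<m. t j * c j i"])
    show "linear (\<lambda>t. \<Sum>j<m. t j * c j i)" for i
      by (rule linearI) (simp_all add: plus_fun_def scaleR_fun_def distrib_right sum.distrib sum_distrib_left mult.assoc)
    fix t assume t: "t \<in> span (v ` {..<m})" "\<And>i. i < n \<Longrightarrow> (\<Sum>j<m. t j * c j i) = 0"
    have "(\<Sum>j<m. t j *\<^sub>R (b j - (\<Sum>i<n. c j i *\<^sub>R z i))) \<in> W"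
      using c by (intro real_vector.subspace_sum[OF W] real_vector.subspace_scale[OF W]) auto
    also have "(\<Sum>j<m. t j *\<^sub>R (b j - (\<Sum>i<n. c j i *\<^sub>R z i))) =
        (\<Sum>j<m. t j *\<^sub>R b j) - (\<Sum>j<m. \<Sum>i<n. (t j * c j i) *\<^sub>R z i)"
      by (simp add: scaleR_right_diff_distrib sum_subtractf scaleR_sum_right)
    also have "(\<Sum>j<m. \<Sum>i<n. (t j * c j i) *\<^sub>R z i) = (\<Sum>i<n. (\<Sum>j<m. t j * c j i) *\<^sub>R z i)"
      by (subst sum.swap) (simp add: scaleR_left.sum)
    also have "\<dots> = 0" using t(2) by simp
    finally have z: "t j = 0" if "j < m" for j using indep that by simp
    have "t j = 0" if "\<not> j < m" for j
      by (rule linear_eq_0_on_span[OF lin _ t(1)]) (use that in \<open>auto simp: v_def\<close>)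
    then have "t = 0" using z by (auto simp: fun_eq_iff zero_fun_def)
    then show "t \<in> span {}" by simp
  qed simp
  then show ?thesis using card_image[OF inj] by simp
qed

text \<open>The \<open>THE\<close> in \<open>quotient_dim\<close> needs a unique n. Relative
  coordinates provide one value m, and comparing bases modulo W in both directions shows that every
  other value equals it.\<close>

lemma quotient_dim_zero_iff:
  assumes V: "subspace V" and W: "subspace W" and WV: "W \<subseteq> V" and fin: "V \<subseteq> span F" "finite F"
  shows "quotient_dim V W = 0 \<longleftrightarrow> V = W"
proof -
  define Q where "Q n \<longleftrightarrow> (\<exists>z :: nat \<Rightarrow> 'a. (\<forall>i<n. z i \<in> V) \<and>
       (\<forall>C \<in> quotient_space V W. \<exists>!a :: nat \<Rightarrow> real. (\<forall>i\<ge>n. a i = 0) \<and> (\<Sum>i<n. a i *\<^sub>R z i) \<in> C))" for n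
  have cls: "C \<in> quotient_space V W \<longleftrightarrow> (\<exists>x\<in>V. C = {y \<in> V. x - y \<in> W})" for C
  proof -
    have "quotient_rel V W `` {x} = {y \<in> V. x - y \<in> W}" if "x \<in> V" for x
      using that by (auto simp: quotient_rel_def)
    then show ?thesis unfolding quotient_space_def quotient_def by auto
  qed
  obtain m b \<xi> where rc: "rel_coords V W m b \<xi>" "dim V = dim W + m"
    by (rule rel_coords_exists[OF V W WV fin])
  note r = rel_coordsD[OF rc(1)]
  have bV: "(\<Sum>i<m. a i *\<^sub>R b i) \<in> V" for a
    using r(4) by (intro real_vector.subspace_sum[OF V] real_vector.subspace_scale[OF V]) auto
  have \<xi>sum: "\<xi> j (\<Sum>i<m. a i *\<^sub>R b i) = a j" if "j < m" for j a
    using r(5,7) that by (simp add: linear_sum linear_cmul if_distrib[of "\<lambda>x. _ * x"] cong: if_cong)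
  have Qm: "Q m"
    unfolding Q_def
  proof (intro exI[of _ b] conjI allI impI ballI r(4))
    fix C assume "C \<in> quotient_space V W"
    then obtain x where x: "x \<in> V" "C = {y \<in> V. x - y \<in> W}" using cls by blast
    show "\<exists>!a. (\<forall>i\<ge>m. a i = 0) \<and> (\<Sum>i<m. a i *\<^sub>R b i) \<in> C"
    proof (rule ex1I[of _ "\<lambda>i. if i < m then \<xi> i x else 0"])
      show "(\<forall>i\<ge>m. (if i < m then \<xi> i x else 0) = 0) \<and> (\<Sum>i<m. (if i < m then \<xi> i x else 0) *\<^sub>R b i) \<in> C"
        using r(8)[OF x(1)] bV[of "\<lambda>i. \<xi> i x"] x(2) by simp
      fix a assume a: "(\<forall>i\<ge>m. a i = 0) \<and> (\<Sum>i<m. a i *\<^sub>R b i) \<in> C"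
      have "\<xi> j x = a j" if "j < m" for j
      proof -
        have "\<xi> j (x - (\<Sum>i<m. a i *\<^sub>R b i)) = 0" using a x(2) r(6)[OF that] by blast
        then show ?thesis using \<xi>sum[OF that] r(5)[OF that] by (simp add: linear_diff)
      qed
      then show "a = (\<lambda>i. if i < m then \<xi> i x else 0)" using a by (auto simp: fun_eq_iff)
    qed
  qed
  have uniq: "n = m" if Qn: "Q n" for n
  proof -
    obtain z where zQ: "(\<forall>i<n. z i \<in> V) \<and>
        (\<forall>C \<in> quotient_space V W. \<exists>!a :: nat \<Rightarrow> real. (\<forall>i\<ge>n. a i = 0) \<and> (\<Sum>i<n. a i *\<^sub>R z i) \<in> C)"
      using Qn unfolding Q_def ..
    have z: "\<And>i. i < n \<Longrightarrow> z i \<in> V" using zQ by simp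
    note ex1 = bspec[OF conjunct2[OF zQ]]
    have "m \<le> n"
    proof (rule quotient_basis_card_le[OF W])
      fix j assume "j < m"
      then have "{y \<in> V. b j - y \<in> W} \<in> quotient_space V W" using cls r(4) by blast
      then have "\<exists>!a. (\<forall>i\<ge>n. a i = 0) \<and> (\<Sum>i<n. a i *\<^sub>R z i) \<in> {y \<in> V. b j - y \<in> W}" by (rule ex1)
      then obtain a where "(\<Sum>i<n. a i *\<^sub>R z i) \<in> {y \<in> V. b j - y \<in> W}" by (elim ex1E conjE)
      then show "\<exists>a. b j - (\<Sum>i<n. a i *\<^sub>R z i) \<in> W" by auto
    next
      fix t j assume "(\<Sum>j<m. t j *\<^sub>R b j) \<in> W" "j < m"
      then show "t j = 0" using \<xi>sum[of j t] r(6)[of j] by simp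
    qed
    moreover have "n \<le> m"
    proof (rule quotient_basis_card_le[OF W])
      fix j assume "j < n"
      then have "z j - (\<Sum>i<m. \<xi> i (z j) *\<^sub>R b i) \<in> W" by (intro r(8) z)
      then show "\<exists>a. z j - (\<Sum>i<m. a i *\<^sub>R b i) \<in> W" by (rule exI[of _ "\<lambda>i. \<xi> i (z j)"])
    next
      fix t j assume t: "(\<Sum>j<n. t j *\<^sub>R z j) \<in> W" "j < n"
      have zV: "(\<Sum>i<n. a i *\<^sub>R z i) \<in> V" for a
        using z by (intro real_vector.subspace_sum[OF V] real_vector.subspace_scale[OF V]) auto
      let ?C = "{y \<in> V. 0 - y \<in> W}"
      have C: "?C \<in> quotient_space V W" using cls real_vector.subspace_0[OF V] by blast
      \<comment> \<open>Cut off at n, because uniqueness concerns coefficient functions that vanish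
        from n on. Both t' and 0 represent the zero class, hence they agree.\<close>
      define t' where "t' i = (if i < n then t i else 0)" for i
      have "(\<Sum>i<n. t' i *\<^sub>R z i) = (\<Sum>i<n. t i *\<^sub>R z i)" by (simp add: t'_def)
      then have 1: "(\<forall>i\<ge>n. t' i = 0) \<and> (\<Sum>i<n. t' i *\<^sub>R z i) \<in> ?C"
        using t(1) zV real_vector.subspace_neg[OF W] by (simp add: t'_def)
      have 2: "(\<forall>i\<ge>n. (\<lambda>_. 0::real) i = 0) \<and> (\<Sum>i<n. (\<lambda>_. 0::real) i *\<^sub>R z i) \<in> ?C"
        using real_vector.subspace_0[OF V] real_vector.subspace_0[OF W] by simp
      have "t' = (\<lambda>_. 0)"
      proof (rule ex1E[OF ex1[OF C]])
        fix u assume u: "\<forall>a. (\<forall>i\<ge>n. a i = 0) \<and> (\<Sum>i<n. a i *\<^sub>R z i) \<in> ?C \<longrightarrow> a = u"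
        have "t' = u" using 1 by (rule mp[OF spec[OF u]])
        moreover have "(\<lambda>_. 0) = u" using 2 by (rule mp[OF spec[OF u]])
        ultimately show ?thesis by simp
      qed
      then have "t' j = 0" by simp
      then show "t j = 0" using t(2) by (simp add: t'_def)
    qed
    ultimately show ?thesis by simp
  qed
  have "quotient_dim V W = (THE n. Q n)" unfolding quotient_dim_def Q_def ..
  also have "\<dots> = m" using Qm uniq by (rule the_equality)
  finally have "quotient_dim V W = m" .
  moreover have "m = 0 \<longleftrightarrow> V = W"
  proof
    assume "m = 0"
    then show "V = W" using r(8) WV by auto
  next
    assume "V = W"
    then show "m = 0" using rc(2) by simp
  qed
  ultimately show ?thesis by simp
qed

lemma finite_span_of_functionals:
  fixes S :: "'a::real_vector set" and f :: "'i \<Rightarrow> 'a \<Rightarrow> real"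
  assumes "subspace S" "finite I" "\<And>i. i \<in> I \<Longrightarrow> linear (f i)"
    and "\<And>x. x \<in> S \<Longrightarrow> (\<And>i. i \<in> I \<Longrightarrow> f i x = 0) \<Longrightarrow> x = 0"
  obtains F where "finite F" "S \<subseteq> span F"
proof -
  obtain B where B: "B \<subseteq> S" "independent B" "S \<subseteq> span B"
    using real_vector.maximal_independent_subset by blast
  have sp: "span B \<subseteq> S" using B assms(1) by (simp add: real_vector.span_minimal)
  have "card B \<le> card I + card ({} :: 'a set) \<and> finite B"
    by (rule independent_card_le_functionals_indexed[OF B(2) _ assms(2,3)]) (use assms(4) sp in auto)
  then show thesis using that B(3) by blast
qed

section \<open>Cochains on lists and curried alternating forms\<close>

lemma subspace_cochains: "subspace (cochains k)"
proof -
  have "linear (\<lambda>x. c * f x)" if "linear f" for f :: "'a::real_vector \<Rightarrow> real" and c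
    using that by (intro linearI) (simp_all add: linear_add linear_cmul distrib_left)
  then show ?thesis
    unfolding real_vector.subspace_def cochains_def
    by (auto simp: plus_fun_def scaleR_fun_def zero_fun_def linear_compose_add intro: linear_zero[unfolded zero_fun_def])
qed

lemma linear_ce_d: "linear (ce_d br)"
  by (rule linearI) (simp_all add: fun_eq_iff ce_d_def plus_fun_def scaleR_fun_def distrib_left sum.distrib
      sum_distrib_left mult.left_commute)

text \<open>Arguments are replaced by elements of B one position at a time; in the induction m
  counts the leading positions that are still arbitrary.\<close>

lemma cochain_zero_on_basis:
  assumes f: "f \<in> cochains k" and B: "span B = UNIV"
    and z: "\<And>xs. length xs = k \<Longrightarrow> set xs \<subseteq> B \<Longrightarrow> f xs = 0"
  shows "f = 0"
proof -
  have "f xs = 0" if "m \<le> k" "length xs = k" "\<And>i. m \<le> i \<Longrightarrow> i < k \<Longrightarrow> xs ! i \<in> B" for m xs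
    using that
  proof (induction m arbitrary: xs)
    case 0
    then show ?case by (intro z) (auto simp: set_conv_nth)
  next
    case (Suc m)
    have lin: "linear (\<lambda>x. f (xs[m := x]))" using f Suc.prems unfolding cochains_def by auto
    have "f (xs[m := xs ! m]) = 0"
    proof (rule linear_eq_0_on_span[OF lin, of B])
      fix x assume "x \<in> B"
      then show "f (xs[m := x]) = 0" using Suc.prems by (intro Suc.IH) (auto simp: nth_list_update)
    qed (simp add: B)
    then show ?case by simp
  qed
  from this[of k] have "f xs = 0" if "length xs = k" for xs using that by simp
  moreover have "f xs = 0" if "length xs \<noteq> k" for xs using f that unfolding cochains_def by blast
  ultimately show ?thesis by (auto simp: fun_eq_iff zero_fun_def)
qed

lemma cochains_finite_span:
  assumes "finite B" "span B = (UNIV :: 'a::real_vector set)"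
  obtains F where "finite F" "(cochains k :: ('a list \<Rightarrow> real) set) \<subseteq> span F"
proof (rule finite_span_of_functionals[OF subspace_cochains, of "{xs. set xs \<subseteq> B \<and> length xs = k}" "\<lambda>xs f. f xs" k])
  show "finite {xs. set xs \<subseteq> B \<and> length xs = k}" using assms(1) by (rule finite_lists_length_eq)
  show "linear (\<lambda>f :: 'a list \<Rightarrow> real. f xs)" for xs
    by (rule linearI) (simp_all add: plus_fun_def scaleR_fun_def)
qed (use cochain_zero_on_basis[OF _ assms(2)] that in auto)

text \<open>Curried forms as functions of lists, with the value 0 that \<open>cochains\<close>
  prescribes on lists of any other length.\<close>

definition form1 :: "('a \<Rightarrow> real) \<Rightarrow> 'a list \<Rightarrow> real"
  where "form1 \<theta> xs = (if length xs = 1 then \<theta> (xs ! 0) else 0)"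

definition form2 :: "('a \<Rightarrow> 'a \<Rightarrow> real) \<Rightarrow> 'a list \<Rightarrow> real"
  where "form2 \<omega> xs = (if length xs = 2 then \<omega> (xs ! 0) (xs ! 1) else 0)"

definition form3 :: "('a \<Rightarrow> 'a \<Rightarrow> 'a \<Rightarrow> real) \<Rightarrow> 'a list \<Rightarrow> real"
  where "form3 \<phi> xs = (if length xs = 3 then \<phi> (xs ! 0) (xs ! 1) (xs ! 2) else 0)"

lemma form_simps [simp]: "form1 \<theta> [x] = \<theta> x" "form2 \<omega> [x, y] = \<omega> x y" "form3 \<phi> [x, y, z] = \<phi> x y z"
  by (simp_all add: form1_def form2_def form3_def)

lemma length_2_conv: "length xs = 2 \<longleftrightarrow> (\<exists>x y. xs = [x, y])"
  and length_3_conv: "length xs = 3 \<longleftrightarrow> (\<exists>x y z. xs = [x, y, z])"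
  and length_4_conv: "length xs = 4 \<longleftrightarrow> (\<exists>x y z w. xs = [x, y, z, w])"
  by (auto simp: length_Suc_conv eval_nat_numeral)

lemma form1_inj: "form1 \<theta> = form1 \<theta>' \<longleftrightarrow> \<theta> = \<theta>'"
  by (metis ext form_simps(1))

lemma form2_inj: "form2 \<omega> = form2 \<omega>' \<longleftrightarrow> \<omega> = \<omega>'"
  by (metis ext form_simps(2))

lemma form3_inj: "form3 \<phi> = form3 \<phi>' \<longleftrightarrow> \<phi> = \<phi>'"
  by (metis ext form_simps(3))

lemma injective_image_subset_iff:
  assumes "\<And>a b. f a = f b \<longleftrightarrow> a = b"
  shows "{f x |x. P x} \<subseteq> {f (g y) |y. Q y} \<longleftrightarrow> (\<forall>x. P x \<longrightarrow> (\<exists>y. Q y \<and> x = g y))"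
proof
  assume sub: "{f x |x. P x} \<subseteq> {f (g y) |y. Q y}"
  show "\<forall>x. P x \<longrightarrow> (\<exists>y. Q y \<and> x = g y)"
  proof (intro allI impI)
    fix x assume "P x"
    then obtain y where "f x = f (g y)" "Q y" using sub by blast
    then show "\<exists>y. Q y \<and> x = g y" using assms by blast
  qed
qed blast

lemma cochains_1: "cochains 1 = form1 ` {\<theta> :: 'a::real_vector \<Rightarrow> real. linear \<theta>}"
proof (intro Set.set_eqI iffI)
  fix f :: "'a list \<Rightarrow> real" assume f: "f \<in> cochains 1"
  have "f = form1 (\<lambda>x. f [x])"
    using f unfolding cochains_def by (auto simp: fun_eq_iff form1_def length_Suc_conv)
  moreover have "linear (\<lambda>x. f [x])"
  proof -
    have "linear (\<lambda>x. f ([0][0 := x]))" using f unfolding cochains_def by (auto simp del: list_update.simps)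
    then show ?thesis by simp
  qed
  ultimately show "f \<in> form1 ` {\<theta>. linear \<theta>}" by blast
next
  fix f :: "'a list \<Rightarrow> real" assume "f \<in> form1 ` {\<theta>. linear \<theta>}"
  then show "f \<in> cochains 1" unfolding cochains_def by (auto simp: form1_def length_Suc_conv)
qed

lemma cochains_2: "cochains 2 = form2 ` {\<omega> :: 'a::real_vector \<Rightarrow> 'a \<Rightarrow> real. alt2 \<omega>}"
proof (intro Set.set_eqI iffI)
  fix f :: "'a list \<Rightarrow> real" assume f: "f \<in> cochains 2"
  have lin: "linear (\<lambda>x. f (xs[i := x]))" if "length xs = 2" "i < 2" for xs i
    using f that unfolding cochains_def by blast
  have "f = form2 (\<lambda>x y. f [x, y])"
    using f unfolding cochains_def by (auto simp: fun_eq_iff form2_def length_2_conv)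
  moreover have "alt2 (\<lambda>x y. f [x, y])"
    unfolding alt2_def bilinear_def
  proof (intro conjI allI)
    show "linear (\<lambda>y. f [x, y])" for x using lin[of "[x, 0]" 1] by simp
    show "linear (\<lambda>x. f [x, y])" for y using lin[of "[0, y]" 0] by simp
    show "f [x, x] = 0" for x using f unfolding cochains_def by simp
  qed
  ultimately show "f \<in> form2 ` {\<omega>. alt2 \<omega>}" by blast
next
  fix f :: "'a list \<Rightarrow> real" assume "f \<in> form2 ` {\<omega>. alt2 \<omega>}"
  then obtain \<omega> where \<omega>: "f = form2 \<omega>" "alt2 \<omega>" by blast
  have "linear (\<lambda>x. form2 \<omega> (xs[i := x]))" if "length xs = 2" "i < 2" for xs i
    using that alt2_linear[OF \<omega>(2)] by (auto simp: length_2_conv less_2_cases_iff)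
  then show "f \<in> cochains 2"
    unfolding cochains_def \<omega>(1) using alt2_linear(3)[OF \<omega>(2)] by (auto simp: form2_def length_2_conv)
qed

lemma cochains_3: "cochains 3 = form3 ` {\<phi> :: 'a::real_vector \<Rightarrow> 'a \<Rightarrow> 'a \<Rightarrow> real. alt3 \<phi>}"
proof (intro Set.set_eqI iffI)
  fix f :: "'a list \<Rightarrow> real" assume f: "f \<in> cochains 3"
  have lin: "linear (\<lambda>x. f (xs[i := x]))" if "length xs = 3" "i < 3" for xs i
    using f that unfolding cochains_def by blast
  have "f = form3 (\<lambda>x y z. f [x, y, z])"
    using f unfolding cochains_def by (auto simp: fun_eq_iff form3_def length_3_conv)
  moreover have "alt3 (\<lambda>x y z. f [x, y, z])"
    unfolding alt3_def
  proof (intro conjI allI)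
    show "linear (\<lambda>z. f [x, y, z])" for x y using lin[of "[x, y, 0]" 2] by simp
    show "linear (\<lambda>y. f [x, y, z])" for x z using lin[of "[x, 0, z]" 1] by simp
    show "linear (\<lambda>x. f [x, y, z])" for y z using lin[of "[0, y, z]" 0] by simp
    show "f [x, x, y] = 0" "f [x, y, y] = 0" "f [x, y, x] = 0" for x y using f unfolding cochains_def by simp_all
  qed
  ultimately show "f \<in> form3 ` {\<phi>. alt3 \<phi>}" by blast
next
  fix f :: "'a list \<Rightarrow> real" assume "f \<in> form3 ` {\<phi>. alt3 \<phi>}"
  then obtain \<phi> where \<phi>: "f = form3 \<phi>" "alt3 \<phi>" by blast
  have "linear (\<lambda>x. form3 \<phi> (xs[i := x]))" if "length xs = 3" "i < 3" for xs i
  proof -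
    have "i = 0 \<or> i = 1 \<or> i = 2" using that by auto
    then show ?thesis using that alt3_linear(1-3)[OF \<phi>(2)] by (auto simp: length_3_conv)
  qed
  then show "f \<in> cochains 3"
    unfolding cochains_def \<phi>(1) using \<phi>(2) unfolding alt3_def by (auto simp: form3_def length_3_conv)
qed

context lie_algebra
begin

lemma length_nths_pair: "i < j \<Longrightarrow> j < length xs \<Longrightarrow> length (nths xs (- {i, j})) = length xs - 2"
proof -
  assume ij: "i < j" "j < length xs"
  have "{k. k < length xs \<and> k \<in> - {i, j}} = {..<length xs} - {i, j}" by auto
  moreover have "card ({..<length xs} - {i, j}) = length xs - 2" using ij by (subst card_Diff_subset) auto
  ultimately show ?thesis by (simp add: length_nths)
qed

lemma ce_d_length:
  assumes "\<And>ys. length ys \<noteq> k \<Longrightarrow> f ys = 0" "length xs \<noteq> Suc k"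
  shows "ce_d bracket f xs = 0"
  unfolding ce_d_def using assms by (intro sum.neutral ballI) (auto simp: length_nths_pair)

lemma ce_d_form1: "ce_d bracket (form1 \<theta>) = form2 (\<lambda>x y. - \<theta> (bracket x y))"
proof
  fix xs
  show "ce_d bracket (form1 \<theta>) xs = form2 (\<lambda>x y. - \<theta> (bracket x y)) xs"
  proof (cases "length xs = 2")
    case True
    then obtain x y where "xs = [x, y]" unfolding length_2_conv by blast
    then show ?thesis by (simp add: ce_d_def eval_nat_numeral nths_Cons form1_def form2_def)
  next
    case False
    then show ?thesis using ce_d_length[of 1 "form1 \<theta>" xs] by (simp add: form1_def form2_def)
  qed
qed

lemma ce_d_form2: "ce_d bracket (form2 \<omega>) = form3 (d2 \<omega>)"
proof
  fix xs
  show "ce_d bracket (form2 \<omega>) xs = form3 (d2 \<omega>) xs"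
  proof (cases "length xs = 3")
    case True
    then obtain x y z where "xs = [x, y, z]" unfolding length_3_conv by blast
    then show ?thesis by (simp add: ce_d_def eval_nat_numeral nths_Cons form2_def form3_def d2_def)
  next
    case False
    then show ?thesis using ce_d_length[of 2 "form2 \<omega>" xs] by (simp add: form2_def form3_def)
  qed
qed

lemma ce_d_form3: "ce_d bracket (form3 \<phi>) xs = (if length xs = 4 then d3 \<phi> (xs ! 0) (xs ! 1) (xs ! 2) (xs ! 3) else 0)"
proof (cases "length xs = 4")
  case True
  then obtain x y z w where "xs = [x, y, z, w]" unfolding length_4_conv by blast
    then show ?thesis by (simp add: ce_d_def eval_nat_numeral nths_Cons form3_def d3_def)
next
  case False
  then show ?thesis using ce_d_length[of 3 "form3 \<phi>" xs] by (simp add: form3_def)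
qed

lemma ce_d_form3_zero: "ce_d bracket (form3 \<phi>) = 0 \<longleftrightarrow> (\<forall>x y z w. d3 \<phi> x y z w = 0)"
proof
  assume "ce_d bracket (form3 \<phi>) = 0"
  then have "ce_d bracket (form3 \<phi>) [x, y, z, w] = 0" for x y z w by (simp add: zero_fun_def)
  then show "\<forall>x y z w. d3 \<phi> x y z w = 0" by (simp add: ce_d_form3)
qed (auto simp: ce_d_form3 fun_eq_iff zero_fun_def)

lemma ce_d_form2_zero: "ce_d bracket (form2 \<omega>) = 0 \<longleftrightarrow> (\<forall>x y z. d2 \<omega> x y z = 0)"
proof
  assume "ce_d bracket (form2 \<omega>) = 0"
  then have "form3 (d2 \<omega>) [x, y, z] = 0" for x y z by (simp add: ce_d_form2 zero_fun_def)
  then show "\<forall>x y z. d2 \<omega> x y z = 0" by simp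
qed (auto simp: ce_d_form2 form3_def fun_eq_iff zero_fun_def)

lemma jacobi_left: "bracket (bracket x y) z - bracket (bracket x z) y + bracket (bracket y z) x = 0"
  using jacobi[of x y z] br_skew[of z "bracket x y"] br_skew[of z x] br_skew[of y "bracket x z"] br_skew[of x "bracket y z"]
  by (simp add: br_minus algebra_simps)

lemma d2_exact_zero:
  assumes "linear \<theta>"
  shows "d2 (\<lambda>x y. - \<theta> (bracket x y)) x y z = 0"
proof -
  have "\<theta> (bracket (bracket x y) z - bracket (bracket x z) y + bracket (bracket y z) x) = 0"
    unfolding jacobi_left by (rule linear_0[OF assms])
  then show ?thesis unfolding d2_def by (simp add: linear_add[OF assms] linear_diff[OF assms])
qed

lemma alt2_exact: "linear \<theta> \<Longrightarrow> alt2 (\<lambda>x y. - \<theta> (bracket x y))"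
  unfolding alt2_def bilinear_def
  by (auto intro!: linearI simp: br_add br_scale bracket_self linear_add linear_cmul linear_0)

lemma alt3_d2:
  assumes "alt2 \<omega>"
  shows "alt3 (d2 \<omega>)"
proof -
  note l = alt2_linear[OF assms]
  have n: "\<omega> (bracket y x) z = - \<omega> (bracket x y) z" for x y z
    by (subst br_skew) (simp add: linear_neg[OF l(2)])
  show ?thesis
    unfolding alt3_def
  proof (intro conjI allI)
    show "linear (d2 \<omega> x y)" "linear (\<lambda>z. d2 \<omega> x z y)" "linear (\<lambda>z. d2 \<omega> z x y)" for x y
      unfolding d2_def by (rule linearI; simp add: br_add br_scale linear_add[OF l(1)] linear_add[OF l(2)]
          linear_cmul[OF l(1)] linear_cmul[OF l(2)] algebra_simps)+
    show "d2 \<omega> x x y = 0" "d2 \<omega> x y y = 0" "d2 \<omega> x y x = 0" for x y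
      unfolding d2_def using n[of x y x] by (simp_all add: bracket_self linear_0[OF l(2)])
  qed
qed

text \<open>Terms of the shape \<omega>([[x, y], z], w) cancel by the Jacobi identity
  (\<open>J\<close>), those of the shape \<omega>([x, y], [z, w]) by skew symmetry
  (\<open>S\<close>).\<close>

lemma d3_d2:
  assumes "alt2 \<omega>"
  shows "d3 (d2 \<omega>) x y z w = 0"
proof -
  note l = alt2_linear[OF assms]
  have J: "\<omega> (bracket (bracket x y) z) w - \<omega> (bracket (bracket x z) y) w + \<omega> (bracket (bracket y z) x) w = 0" for x y z w
  proof -
    have "\<omega> (bracket (bracket x y) z - bracket (bracket x z) y + bracket (bracket y z) x) w = 0"
      unfolding jacobi_left by (rule linear_0[OF l(2)])
    then show ?thesis by (simp add: linear_add[OF l(2)] linear_diff[OF l(2)])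
  qed
  have S: "\<omega> (bracket z w) (bracket x y) = - \<omega> (bracket x y) (bracket z w)" for x y z w
    by (rule alt2_skew[OF assms])
  show ?thesis
    unfolding d3_def d2_def
    using J[of x y z w] J[of x y w z] J[of x z w y] J[of y z w x] S[of x y z w] S[of x z y w] S[of x w y z]
    by (simp add: algebra_simps)
qed

lemma subspace_cocycles: "subspace (cocycles bracket k)"
  using subspace_cochains[of k] unfolding cocycles_def real_vector.subspace_def
  by (auto simp: linear_0[OF linear_ce_d] linear_add[OF linear_ce_d] linear_cmul[OF linear_ce_d])

lemma subspace_coboundaries: "0 < k \<Longrightarrow> subspace (coboundaries bracket k)"
  using linear_subspace_image[OF linear_ce_d subspace_cochains] by (cases k) (simp_all add: coboundaries_def)

lemma coboundaries_2: "coboundaries bracket 2 = {form2 (\<lambda>x y. - \<theta> (bracket x y)) |\<theta>. linear \<theta>}"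
proof -
  have "coboundaries bracket 2 = ce_d bracket ` cochains 1" unfolding coboundaries_def by (simp add: numeral_2_eq_2)
  then show ?thesis unfolding cochains_1 image_image ce_d_form1 by auto
qed

lemma coboundaries_3: "coboundaries bracket 3 = {form3 (d2 \<omega>) |\<omega>. alt2 \<omega>}"
proof -
  have "coboundaries bracket 3 = ce_d bracket ` cochains 2" unfolding coboundaries_def by (simp add: numeral_3_eq_3 numeral_2_eq_2)
  then show ?thesis unfolding cochains_2 image_image ce_d_form2 by auto
qed

lemma cocycles_2: "cocycles bracket 2 = {form2 \<omega> |\<omega>. alt2 \<omega> \<and> (\<forall>x y z. d2 \<omega> x y z = 0)}"
  unfolding cocycles_def cochains_2 by (auto simp: ce_d_form2_zero)

lemma cocycles_3: "cocycles bracket 3 = {form3 \<phi> |\<phi>. alt3 \<phi> \<and> (\<forall>x y z w. d3 \<phi> x y z w = 0)}"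
  unfolding cocycles_def cochains_3 by (auto simp: ce_d_form3_zero)

lemma coboundaries_subset: "coboundaries bracket 2 \<subseteq> cocycles bracket 2" "coboundaries bracket 3 \<subseteq> cocycles bracket 3"
  unfolding coboundaries_2 cocycles_2 coboundaries_3 cocycles_3 using d2_exact_zero alt2_exact alt3_d2 d3_d2 by blast+

lemma trivial_cohomology_iff_cocycles:
  "k = 2 \<or> k = 3 \<Longrightarrow> trivial_cohomology bracket k \<longleftrightarrow> cocycles bracket k = coboundaries bracket k"
proof -
  assume k: "k = 2 \<or> k = 3"
  then have "coboundaries bracket k \<subseteq> cocycles bracket k" "0 < k" using coboundaries_subset by auto
  then show ?thesis
    unfolding trivial_cohomology_def cohomology_def
    by (intro quotient_space_trivial_iff subspace_cocycles subspace_coboundaries)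
qed

lemma trivial_cohomology_2: "trivial_cohomology bracket 2 \<longleftrightarrow> H2_trivial"
proof -
  have "trivial_cohomology bracket 2 \<longleftrightarrow> cocycles bracket 2 \<subseteq> coboundaries bracket 2"
    using trivial_cohomology_iff_cocycles[of 2] coboundaries_subset(1) by auto
  also have "\<dots> \<longleftrightarrow> (\<forall>\<omega>. alt2 \<omega> \<and> (\<forall>x y z. d2 \<omega> x y z = 0) \<longrightarrow> (\<exists>\<theta>. linear \<theta> \<and> \<omega> = (\<lambda>x y. - \<theta> (bracket x y))))"
    unfolding cocycles_2 coboundaries_2 by (rule injective_image_subset_iff[OF form2_inj])
  also have "\<dots> \<longleftrightarrow> H2_trivial" unfolding H2_trivial_def fun_eq_iff ..
  finally show ?thesis .
qed

lemma trivial_cohomology_3: "trivial_cohomology bracket 3 \<longleftrightarrow> H3_trivial"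
proof -
  have "trivial_cohomology bracket 3 \<longleftrightarrow> cocycles bracket 3 \<subseteq> coboundaries bracket 3"
    using trivial_cohomology_iff_cocycles[of 3] coboundaries_subset(2) by auto
  also have "\<dots> \<longleftrightarrow> (\<forall>\<phi>. alt3 \<phi> \<and> (\<forall>x y z w. d3 \<phi> x y z w = 0) \<longrightarrow> (\<exists>\<omega>. alt2 \<omega> \<and> \<phi> = d2 \<omega>))"
    unfolding cocycles_3 coboundaries_3 by (rule injective_image_subset_iff[OF form3_inj])
  also have "\<dots> \<longleftrightarrow> H3_trivial" unfolding H3_trivial_def fun_eq_iff ..
  finally show ?thesis .
qed

end

lemma (in fd_lie_algebra) cohomology_dim_zero_iff:
  assumes "k = 2 \<or> k = 3"
  shows "cohomology_dim bracket k = 0 \<longleftrightarrow> trivial_cohomology bracket k"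
proof -
  obtain B where "finite B" "span B = (UNIV :: 'a set)" using finite_span by blast
  then obtain F where F: "finite F" "(cochains k :: ('a list \<Rightarrow> real) set) \<subseteq> span F" by (rule cochains_finite_span)
  have sub: "subspace (coboundaries bracket k)" using subspace_coboundaries[of k] assms by auto
  have le: "coboundaries bracket k \<subseteq> cocycles bracket k" using coboundaries_subset assms by auto
  have "cocycles bracket k \<subseteq> span F" using F(2) unfolding cocycles_def by blast
  then show ?thesis
    unfolding cohomology_dim_def trivial_cohomology_iff_cocycles[OF assms]
    by (rule quotient_dim_zero_iff[OF subspace_cocycles sub le _ F(1)])
qed

section \<open>Derivations of exterior powers and of alternating forms\<close>

lemma cochainsD:
  assumes "f \<in> cochains k"
  shows "length xs \<noteq> k \<Longrightarrow> f xs = 0" "length xs = k \<Longrightarrow> j < k \<Longrightarrow> linear (\<lambda>x. f (xs[j := x]))"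
    "length xs = k \<Longrightarrow> \<not> distinct xs \<Longrightarrow> f xs = 0"
  using assms unfolding cochains_def by blast+

lemma cochain_swap:
  assumes f: "f \<in> cochains k" and xs: "length xs = k" and ij: "i < k" "j < k" "i \<noteq> j"
  shows "f (xs[i := x, j := y]) = - f (xs[i := y, j := x])"
proof -
  have li: "linear (\<lambda>u. f (xs[i := u, j := w]))" for w
    using cochainsD(2)[OF f, of "xs[j := w]" i] xs ij by (simp add: list_update_swap)
  have lj: "linear (\<lambda>u. f (xs[i := w, j := u]))" for w
    using cochainsD(2)[OF f, of "xs[i := w]" j] xs ij by simp
  have z: "f (xs[i := u, j := u]) = 0" for u
  proof (rule cochainsD(3)[OF f])
    have "xs[i := u, j := u] ! i = xs[i := u, j := u] ! j" using xs ij by simp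
    then show "\<not> distinct (xs[i := u, j := u])"
      using xs ij nth_eq_iff_index_eq[of "xs[i := u, j := u]" i j] by auto
  qed (simp add: xs)
  have "f (xs[i := x + y, j := x + y]) = f (xs[i := x, j := x]) + f (xs[i := x, j := y]) +
      (f (xs[i := y, j := x]) + f (xs[i := y, j := y]))"
    unfolding linear_add[OF li] linear_add[OF lj] by simp
  then show ?thesis unfolding z by simp
qed

lemma functional_vanishing_on:
  fixes R :: "'a::real_vector set"
  assumes "subspace R" "u \<notin> R"
  obtains \<psi> :: "'a \<Rightarrow> real" where "linear \<psi>" "\<And>r. r \<in> R \<Longrightarrow> \<psi> r = 0" "\<psi> u = 1"
proof -
  obtain A where A: "A \<subseteq> R" "independent A" "R \<subseteq> span A"
    using real_vector.maximal_independent_subset by blast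
  have sp: "span A = R" using A assms(1) by (simp add: real_vector.span_minimal subset_antisym)
  then have ind: "independent (insert u A)" using A(2) assms(2) by (simp add: real_vector.independent_insert)
  have "\<exists>\<psi>. linear \<psi> \<and> (\<forall>x\<in>insert u A. \<psi> x = (if x = u then 1 else (0::real)))"
    by (rule linear_independent_extend[OF ind])
  then obtain \<psi> where \<psi>: "linear \<psi>" "\<forall>x\<in>insert u A. \<psi> x = (if x = u then 1 else (0::real))"
    by (elim exE conjE)
  have A0: "\<psi> x = 0" if "x \<in> A" for x using \<psi>(2) that A(1) assms(2) by auto
  have "\<psi> r = 0" if "r \<in> R" for r
    by (rule linear_eq_0_on_span[OF \<psi>(1) A0, of A]) (use that sp in auto)
  moreover have "\<psi> u = 1" using \<psi>(2) by simp
  ultimately show thesis using that[OF \<psi>(1)] by simp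
qed

section \<open>The free vector space on tuples and the transposed derivation\<close>

lemma independent_generators: "independent (range (generator :: 'a list \<Rightarrow> 'a list \<Rightarrow> real))" "inj (generator :: 'a list \<Rightarrow> 'a list \<Rightarrow> real)"
proof -
  have lin: "linear (\<lambda>u :: 'a list \<Rightarrow> real. u xs)" for xs
    by (rule linearI) (simp_all add: plus_fun_def scaleR_fun_def)
  show "independent (range (generator :: 'a list \<Rightarrow> 'a list \<Rightarrow> real))" "inj (generator :: 'a list \<Rightarrow> 'a list \<Rightarrow> real)"
    by (rule independent_dual_family[of UNIV "\<lambda>xs u. u xs"]; use lin in \<open>auto simp: generator_def\<close>)+
qed

lemma generator_extension:
  fixes h :: "'a list \<Rightarrow> 'b::real_vector"
  obtains H where "linear H" "\<And>xs. H (generator xs) = h xs"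
proof -
  obtain H where "linear H" "\<forall>g\<in>range generator. H g = h (inv_into UNIV generator g)"
    using linear_independent_extend[OF independent_generators(1), of "\<lambda>g. h (inv_into UNIV generator g)"] by blast
  then show thesis using that[of H] by (simp add: inv_f_f[OF independent_generators(2)])
qed

lemma span_generators_finite: "u \<in> span (range generator) \<Longrightarrow> finite {xs. u xs \<noteq> 0}"
proof (induction rule: real_vector.span_induct_alt)
  case base
  then show ?case by (simp add: zero_fun_def)
next
  case (step c g v)
  have "{xs. (c *\<^sub>R g + v) xs \<noteq> 0} \<subseteq> {xs. g xs \<noteq> 0} \<union> {xs. v xs \<noteq> 0}"
    by (auto simp: plus_fun_def scaleR_fun_def)
  moreover have "finite {xs. g xs \<noteq> 0}" using step(1) by (auto simp: generator_def)
  ultimately show ?case using step(2) by (meson finite_UnI finite_subset)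
qed

lemma finite_support_expand:
  assumes "finite {xs. u xs \<noteq> 0}"
  shows "u = (\<Sum>xs | u xs \<noteq> 0. u xs *\<^sub>R generator xs)"
proof
  fix ys
  have lin: "linear (\<lambda>v :: 'a list \<Rightarrow> real. v ys)"
    by (rule linearI) (simp_all add: plus_fun_def scaleR_fun_def)
  have "(\<Sum>xs | u xs \<noteq> 0. u xs *\<^sub>R generator xs) ys = (\<Sum>xs | u xs \<noteq> 0. u xs * generator xs ys)"
    unfolding linear_sum[OF lin] by (simp add: scaleR_fun_def)
  also have "\<dots> = (\<Sum>xs | u xs \<noteq> 0. if xs = ys then u xs else 0)"
    by (rule sum.cong) (auto simp: generator_def)
  also have "\<dots> = u ys" using assms by (simp add: sum.delta')
  finally show "u ys = (\<Sum>xs | u xs \<noteq> 0. u xs *\<^sub>R generator xs) ys" ..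
qed

lemma linear_on_finite_support:
  assumes "linear H" "finite {xs. u xs \<noteq> 0}"
  shows "H u = (\<Sum>xs | u xs \<noteq> 0. u xs *\<^sub>R H (generator xs))"
  by (subst finite_support_expand[OF assms(2)]) (simp add: linear_sum[OF assms(1)] linear_cmul[OF assms(1)])

text \<open>The transpose of the derivation on the exterior power, without the minus sign of the
  contragredient action.\<close>

definition form_derivation :: "('a \<Rightarrow> 'a) \<Rightarrow> ('a list \<Rightarrow> real) \<Rightarrow> 'a list \<Rightarrow> real"
  where "form_derivation T f xs = (\<Sum>j<length xs. f (xs[j := T (xs ! j)]))"

lemma linear_form_derivation: "linear (form_derivation T)"
  by (rule linearI) (simp_all add: fun_eq_iff form_derivation_def plus_fun_def scaleR_fun_def sum.distrib sum_distrib_left)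

lemma form_derivation_cochain:
  assumes f: "f \<in> cochains k" and T: "linear T"
  shows "form_derivation T f \<in> cochains k"
  unfolding cochains_def mem_Collect_eq
proof (intro conjI allI impI)
  show "form_derivation T f xs = 0" if "length xs \<noteq> k" for xs
    using that cochainsD(1)[OF f] by (simp add: form_derivation_def)
next
  fix xs :: "'a list" and i assume xs: "length xs = k \<and> i < k"
  have "linear (\<lambda>x. f (xs[i := x, j := T (xs[i := x] ! j)]))" if "j < k" for j
  proof (cases "j = i")
    case True
    then show ?thesis
      using xs linear_compose[OF T cochainsD(2)[OF f, of xs i]] by (simp add: o_def)
  next
    case False
    then show ?thesis
      using xs that cochainsD(2)[OF f, of "xs[j := T (xs ! j)]" i] by (simp add: list_update_swap)
  qed
  then show "linear (\<lambda>x. form_derivation T f (xs[i := x]))"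
    unfolding form_derivation_def using xs by (auto intro!: linear_compose_sum)
next
  fix xs :: "'a list" assume xs: "length xs = k \<and> \<not> distinct xs"
  then obtain a b where ab: "a < k" "b < k" "a \<noteq> b" "xs ! a = xs ! b" by (auto simp: distinct_conv_nth)
  let ?t = "\<lambda>j. f (xs[j := T (xs ! j)])"
  have "?t j = 0" if "j < k" "j \<noteq> a" "j \<noteq> b" for j
  proof (rule cochainsD(3)[OF f])
    have "xs[j := T (xs ! j)] ! a = xs[j := T (xs ! j)] ! b" using ab that by simp
    then show "\<not> distinct (xs[j := T (xs ! j)])"
      using ab xs nth_eq_iff_index_eq[of "xs[j := T (xs ! j)]" a b] by auto
  qed (simp add: xs)
  then have "(\<Sum>j<k. ?t j) = (\<Sum>j\<in>{a, b}. ?t j)" using ab by (intro sum.mono_neutral_right) auto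
  also have "\<dots> = ?t a + ?t b" using ab by simp
  also have "?t a = - ?t b"
  proof -
    let ?x = "xs ! a"
    have "xs[a := T ?x] = xs[a := T ?x, b := ?x]" using ab(3,4) list_update_id[of xs b] by (metis list_update_swap)
    moreover have "xs[b := T (xs ! b)] = xs[a := ?x, b := T ?x]" by (metis ab(4) list_update_id)
    ultimately show ?thesis using cochain_swap[OF f _ ab(1,2,3), of xs "T ?x" ?x] xs by simp
  qed
  finally show "form_derivation T f xs = 0" using xs by (simp add: form_derivation_def)
qed

text \<open>
  \<open>\<pi>\<close> is a projection onto \<open>V\<close> and \<open>T\<close> an endomorphism that factors through it, so that the alternating forms
  on \<open>V\<close> become the forms on the whole space that factor through \<open>\<pi>\<close>.
\<close>

locale projected_endomorphism =
  fixes V :: "'a::real_vector set" and \<pi> T :: "'a \<Rightarrow> 'a"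
  assumes V: "subspace V" and lin_\<pi>: "linear \<pi>" and \<pi>V: "\<And>x. \<pi> x \<in> V" and \<pi>_id: "\<And>x. x \<in> V \<Longrightarrow> \<pi> x = x"
    and lin_T: "linear T" and TV: "\<And>x. T x \<in> V" and T\<pi>: "\<And>x. T (\<pi> x) = T x"
begin

definition forms :: "nat \<Rightarrow> ('a list \<Rightarrow> real) set"
  where "forms i = {f \<in> cochains i. \<forall>xs. f (map \<pi> xs) = f xs}"

lemma subspace_forms: "subspace (forms i)"
  using subspace_cochains[of i] unfolding forms_def real_vector.subspace_def
  by (auto simp: plus_fun_def scaleR_fun_def zero_fun_def)

lemma form_derivation_forms: "f \<in> forms i \<Longrightarrow> form_derivation T f \<in> forms i"
proof -
  assume f: "f \<in> forms i"
  have "f ((map \<pi> xs)[j := T (\<pi> (xs ! j))]) = f (xs[j := T (xs ! j)])" if "j < length xs" for xs j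
  proof -
    have "(map \<pi> xs)[j := T (\<pi> (xs ! j))] = map \<pi> (xs[j := T (xs ! j)])"
      by (simp add: map_update T\<pi> \<pi>_id[OF TV])
    then show ?thesis using f unfolding forms_def by simp
  qed
  then show ?thesis
    using f form_derivation_cochain[OF _ lin_T] unfolding forms_def by (auto simp: form_derivation_def)
qed

lemma map_\<pi>_tuple: "xs \<in> tuples V i \<Longrightarrow> map \<pi> xs = xs"
  unfolding tuples_def by (auto intro!: map_idI \<pi>_id)

lemma map_\<pi>_in_tuples: "length xs = i \<Longrightarrow> map \<pi> xs \<in> tuples V i"
  unfolding tuples_def using \<pi>V by auto

lemma generator_in_free: "xs \<in> tuples V i \<Longrightarrow> generator xs \<in> ext_free V i"
  unfolding ext_free_def by (intro real_vector.span_base) blast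

lemma tuples_update: "xs \<in> tuples V i \<Longrightarrow> x \<in> V \<Longrightarrow> xs[j := x] \<in> tuples V i"
  unfolding tuples_def using set_update_subset_insert[of xs j x] by auto

lemma ext_free_support:
  assumes "u \<in> ext_free V i"
  shows "finite {xs. u xs \<noteq> 0}" "u xs \<noteq> 0 \<Longrightarrow> xs \<in> tuples V i"
proof -
  show "finite {xs. u xs \<noteq> 0}"
    using assms real_vector.span_mono[of "generator ` tuples V i" "range generator"]
    unfolding ext_free_def by (intro span_generators_finite) auto
  have "u xs = 0" if "xs \<notin> tuples V i"
  proof -
    have "linear (\<lambda>u :: 'a list \<Rightarrow> real. u xs)" by (rule linearI) (simp_all add: plus_fun_def scaleR_fun_def)
    then show ?thesis
      by (rule linear_eq_0_on_span[OF _ _ assms[unfolded ext_free_def]]) (use that in \<open>auto simp: generator_def\<close>)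
  qed
  then show "u xs \<noteq> 0 \<Longrightarrow> xs \<in> tuples V i" by blast
qed

lemma ext_relations_subset: "ext_relations V i \<subseteq> ext_free V i"
  unfolding ext_relations_def
proof (rule real_vector.span_minimal)
  show "subspace (ext_free V i)" unfolding ext_free_def by simp
  have F: "subspace (ext_free V i)" unfolding ext_free_def by simp
  show "{generator (xs[j := x + y]) - generator (xs[j := x]) - generator (xs[j := y]) |xs j x y.
        xs \<in> tuples V i \<and> j < i \<and> x \<in> V \<and> y \<in> V} \<union>
     {generator (xs[j := c *\<^sub>R x]) - c *\<^sub>R generator (xs[j := x]) |xs j c x.
        xs \<in> tuples V i \<and> j < i \<and> x \<in> V} \<union>
     {generator xs |xs. xs \<in> tuples V i \<and> \<not> distinct xs} \<subseteq> ext_free V i"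
    using real_vector.subspace_add[OF V] real_vector.subspace_scale[OF V]
    by (auto intro!: real_vector.subspace_diff[OF F] real_vector.subspace_scale[OF F] generator_in_free tuples_update)
qed

lemma subspace_ext: "subspace (ext_relations V i)" "subspace (ext_free V i)"
  unfolding ext_relations_def ext_free_def by simp_all

lemma cochain_kills_relations:
  assumes f: "f \<in> cochains i" and H: "linear H" "\<And>xs. H (generator xs) = f xs" and r: "r \<in> ext_relations V i"
  shows "H r = 0"
proof (rule linear_eq_0_on_span[OF H(1) _ r[unfolded ext_relations_def]])
  note simps = linear_diff[OF H(1)] linear_cmul[OF H(1)] H(2)
  fix g assume "g \<in> {generator (xs[j := x + y]) - generator (xs[j := x]) - generator (xs[j := y]) |xs j x y.
        xs \<in> tuples V i \<and> j < i \<and> x \<in> V \<and> y \<in> V} \<union>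
     {generator (xs[j := c *\<^sub>R x]) - c *\<^sub>R generator (xs[j := x]) |xs j c x.
        xs \<in> tuples V i \<and> j < i \<and> x \<in> V} \<union>
     {generator xs |xs. xs \<in> tuples V i \<and> \<not> distinct xs}"
  then consider
    (add) xs j x y where "g = generator (xs[j := x + y]) - generator (xs[j := x]) - generator (xs[j := y])" "length xs = i" "j < i" |
    (scale) xs j c x where "g = generator (xs[j := c *\<^sub>R x]) - c *\<^sub>R generator (xs[j := x])" "length xs = i" "j < i" |
    (alt) xs where "g = generator xs" "length xs = i" "\<not> distinct xs"
    unfolding tuples_def by blast
  then show "H g = 0"
  proof cases
    case add
    then show ?thesis using linear_add[OF cochainsD(2)[OF f add(2,3)], of x y] by (simp add: simps)
  next
    case scale
    then show ?thesis using linear_cmul[OF cochainsD(2)[OF f scale(2,3)], of c x] by (simp add: simps)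
  next
    case alt
    then show ?thesis using cochainsD(3)[OF f alt(2,3)] by (simp add: simps)
  qed
qed

text \<open>Functionals on the exterior power are alternating forms on V; precomposition with \<pi>
  extends them to the whole space.\<close>

lemma functional_form:
  assumes \<psi>: "linear \<psi>" "\<And>r. r \<in> ext_relations V i \<Longrightarrow> \<psi> r = 0"
  shows "(\<lambda>xs. if length xs = i then \<psi> (generator (map \<pi> xs)) else 0) \<in> forms i"
proof -
  have rel: "\<psi> (generator (ys[j := x + y])) = \<psi> (generator (ys[j := x])) + \<psi> (generator (ys[j := y]))"
    "\<psi> (generator (ys[j := c *\<^sub>R x])) = c * \<psi> (generator (ys[j := x]))"
    if "ys \<in> tuples V i" "j < i" "x \<in> V" "y \<in> V" for ys j x y c
  proof -
    have "generator (ys[j := x + y]) - generator (ys[j := x]) - generator (ys[j := y]) \<in> ext_relations V i"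
      "generator (ys[j := c *\<^sub>R x]) - c *\<^sub>R generator (ys[j := x]) \<in> ext_relations V i"
      unfolding ext_relations_def using that by (intro real_vector.span_base; blast)+
    then have "\<psi> (generator (ys[j := x + y]) - generator (ys[j := x]) - generator (ys[j := y])) = 0"
      "\<psi> (generator (ys[j := c *\<^sub>R x]) - c *\<^sub>R generator (ys[j := x])) = 0" using \<psi>(2) by blast+
    then show "\<psi> (generator (ys[j := x + y])) = \<psi> (generator (ys[j := x])) + \<psi> (generator (ys[j := y]))"
      "\<psi> (generator (ys[j := c *\<^sub>R x])) = c * \<psi> (generator (ys[j := x]))"
      by (simp_all add: linear_diff[OF \<psi>(1)] linear_cmul[OF \<psi>(1)])
  qed
  have alt: "\<psi> (generator ys) = 0" if "ys \<in> tuples V i" "\<not> distinct ys" for ys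
    unfolding ext_relations_def by (intro \<psi>(2)) (use that in \<open>auto simp: ext_relations_def intro!: real_vector.span_base\<close>)
  let ?f = "\<lambda>xs. if length xs = i then \<psi> (generator (map \<pi> xs)) else 0"
  have "?f \<in> cochains i"
    unfolding cochains_def mem_Collect_eq
  proof (intro conjI allI impI)
    fix xs :: "'a list" and j assume xs: "length xs = i \<and> j < i"
    then have t: "map \<pi> xs \<in> tuples V i" using map_\<pi>_in_tuples by blast
    have "linear (\<lambda>x. \<psi> (generator ((map \<pi> xs)[j := \<pi> x])))"
      using rel[OF t _ \<pi>V \<pi>V] xs by (intro linearI) (simp_all add: linear_add[OF lin_\<pi>] linear_cmul[OF lin_\<pi>])
    then show "linear (\<lambda>x. ?f (xs[j := x]))" using xs by (simp add: map_update)
  next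
    fix xs :: "'a list" assume xs: "length xs = i \<and> \<not> distinct xs"
    then have "\<not> distinct (map \<pi> xs)" by (auto simp: distinct_map)
    then show "?f xs = 0" using alt[of "map \<pi> xs"] map_\<pi>_in_tuples xs by simp
  qed simp
  moreover have "map \<pi> (map \<pi> xs) = map \<pi> xs" for xs using \<pi>_id[OF \<pi>V] by simp
  ultimately show ?thesis unfolding forms_def by (simp del: map_map)
qed

text \<open>\<open>free_derivation\<close> sums over a support and is linear only among finitely
  supported functions. This globally linear map agrees with it on
  \<open>ext_free V i\<close>.\<close>

definition free_der :: "('a list \<Rightarrow> real) \<Rightarrow> 'a list \<Rightarrow> real"
  where "free_der = (SOME H. linear H \<and> (\<forall>xs. H (generator xs) = (\<Sum>j<length xs. generator (xs[j := T (xs ! j)]))))"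

lemma free_der: "linear free_der" "free_der (generator xs) = (\<Sum>j<length xs. generator (xs[j := T (xs ! j)]))"
proof -
  obtain H where "linear H" "\<And>xs. H (generator xs) = (\<Sum>j<length xs. generator (xs[j := T (xs ! j)]))"
    by (rule generator_extension[of "\<lambda>xs. \<Sum>j<length xs. generator (xs[j := T (xs ! j)])"]) (rule that; assumption)
  then have "\<exists>H. linear H \<and> (\<forall>xs. H (generator xs) = (\<Sum>j<length xs. generator (xs[j := T (xs ! j)])))" by blast
  then have "linear free_der \<and> (\<forall>xs. free_der (generator xs) = (\<Sum>j<length xs. generator (xs[j := T (xs ! j)])))"
    unfolding free_der_def by (rule someI_ex)
  then show "linear free_der" "free_der (generator xs) = (\<Sum>j<length xs. generator (xs[j := T (xs ! j)]))" by blast+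
qed

lemma free_derivation_eq: "u \<in> ext_free V i \<Longrightarrow> free_derivation T u = free_der u"
  unfolding free_derivation_def
  using linear_on_finite_support[OF free_der(1) ext_free_support(1)] by (simp add: free_der(2))

lemma free_der_in_free: "u \<in> ext_free V i \<Longrightarrow> free_der u \<in> ext_free V i"
proof -
  assume u: "u \<in> ext_free V i"
  have "free_der (generator xs) \<in> ext_free V i" if "xs \<in> tuples V i" for xs
    unfolding free_der(2) using that TV
    by (intro real_vector.subspace_sum[OF subspace_ext(2)] generator_in_free tuples_update)
  then have "free_der ` span (generator ` tuples V i) \<subseteq> ext_free V i"
    unfolding linear_span_image[OF free_der(1), symmetric] by (intro real_vector.span_minimal subspace_ext(2)) auto
  then show ?thesis using u unfolding ext_free_def by blast
qed

text \<open>The transpose relation: if f represents \<psi> on generators, then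
  \<open>form_derivation T f\<close> represents \<psi> after the derivation.\<close>

lemma functional_free_der:
  assumes \<psi>: "linear \<psi>" and f: "\<And>xs. xs \<in> tuples V i \<Longrightarrow> f xs = \<psi> (generator xs)"
    and H: "linear H" "\<And>xs. H (generator xs) = form_derivation T f xs" and u: "u \<in> ext_free V i"
  shows "\<psi> (free_der u) = H u"
proof -
  have g: "\<psi> (free_der (generator xs)) = H (generator xs)" if "xs \<in> tuples V i" for xs
    unfolding free_der(2) H(2) form_derivation_def linear_sum[OF \<psi>] using that TV
    by (intro sum.cong) (simp_all add: f tuples_update)
  have l: "linear (\<lambda>u. \<psi> (free_der u) - H u)"
    using linear_compose[OF free_der(1) \<psi>] H(1) by (intro linear_compose_sub) (simp_all add: o_def)
  have "\<psi> (free_der u) - H u = 0"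
    by (rule linear_eq_0_on_span[OF l _ u[unfolded ext_free_def]]) (use g in auto)
  then show ?thesis by simp
qed

lemma functional_form_values:
  assumes "\<And>xs. f xs = (if length xs = i then \<psi> (generator (map \<pi> xs)) else 0)" "xs \<in> tuples V i"
  shows "f xs = \<psi> (generator xs)"
  using assms map_\<pi>_tuple[OF assms(2)] by (simp add: tuples_def)

text \<open>By duality: otherwise a functional would kill the relations but not the image of r. It
  corresponds to an alternating form f, and \<open>form_derivation T f\<close> is alternating again,
  so it kills r.\<close>

lemma free_der_relations: "r \<in> ext_relations V i \<Longrightarrow> free_der r \<in> ext_relations V i"
proof (rule ccontr)
  assume r: "r \<in> ext_relations V i" and n: "free_der r \<notin> ext_relations V i"
  obtain \<psi> :: "('a list \<Rightarrow> real) \<Rightarrow> real" where \<psi>: "linear \<psi>" "\<And>r. r \<in> ext_relations V i \<Longrightarrow> \<psi> r = 0" "\<psi> (free_der r) = 1"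
    by (rule functional_vanishing_on[OF subspace_ext(1) n]) (rule that; assumption)
  define f where "f = (\<lambda>xs. if length xs = i then \<psi> (generator (map \<pi> xs)) else 0)"
  have f: "f \<in> cochains i" using functional_form[OF \<psi>(1,2)] unfolding f_def forms_def by blast
  obtain H where H: "linear H" "\<And>xs. H (generator xs) = form_derivation T f xs" by (rule generator_extension[of "form_derivation T f"]) (rule that; assumption)
  have fv: "f xs = \<psi> (generator xs)" if "xs \<in> tuples V i" for xs
    by (rule functional_form_values[OF _ that]) (simp add: f_def)
  have "\<psi> (free_der r) = H r"
    by (rule functional_free_der[OF \<psi>(1) fv H]) (use r ext_relations_subset in auto)
  also have "\<dots> = 0" by (rule cochain_kills_relations[OF form_derivation_cochain[OF f lin_T] H r])
  finally show False using \<psi>(3) by simp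
qed

lemma ext_kernel_trivial_iff_injective:
  "ext_kernel V i T = {ext_relations V i} \<longleftrightarrow> (\<forall>u\<in>ext_free V i. free_der u \<in> ext_relations V i \<longrightarrow> u \<in> ext_relations V i)"
proof -
  let ?F = "ext_free V i" and ?R = "ext_relations V i"
  note sR = subspace_ext(1)[of i] and sF = subspace_ext(2)[of i] and RF = ext_relations_subset[of i]
  have cls: "quotient_rel ?F ?R `` {u} = {w \<in> ?F. u - w \<in> ?R}" if "u \<in> ?F" for u
    using that by (auto simp: quotient_rel_def)
  have clsR: "quotient_rel ?F ?R `` {u} = ?R \<longleftrightarrow> u \<in> ?R" if u: "u \<in> ?F" for u
  proof
    assume "quotient_rel ?F ?R `` {u} = ?R"
    moreover have "u \<in> quotient_rel ?F ?R `` {u}" using cls[OF u] u real_vector.subspace_0[OF sR] by simp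
    ultimately show "u \<in> ?R" by simp
  next
    assume uR: "u \<in> ?R"
    have "w \<in> ?R" if "u - w \<in> ?R" for w
      using real_vector.subspace_diff[OF sR uR that] by simp
    then show "quotient_rel ?F ?R `` {u} = ?R"
      unfolding cls[OF u] using RF real_vector.subspace_diff[OF sR uR] by blast
  qed
  have der: "ext_derivation V i T (quotient_rel ?F ?R `` {u}) = quotient_rel ?F ?R `` {free_der u}" if u: "u \<in> ?F" for u
  proof -
    have "quotient_rel ?F ?R `` {free_derivation T w} = quotient_rel ?F ?R `` {free_der u}" if w: "w \<in> ?F" "u - w \<in> ?R" for w
    proof -
      have d: "free_der u - free_der w \<in> ?R" using free_der_relations[OF w(2)] by (simp add: linear_diff[OF free_der(1)])
      have "free_der w - x \<in> ?R \<longleftrightarrow> free_der u - x \<in> ?R" for x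
        using real_vector.subspace_add[OF sR d, of "free_der w - x"] real_vector.subspace_diff[OF sR _ d, of "free_der u - x"] by auto
      then show ?thesis using cls[OF free_der_in_free[OF w(1)]] cls[OF free_der_in_free[OF u]] free_derivation_eq[OF w(1)] by simp
    qed
    moreover have "u \<in> {w \<in> ?F. u - w \<in> ?R}" using u real_vector.subspace_0[OF sR] by simp
    ultimately show ?thesis unfolding ext_derivation_def quotient_map_def cls[OF u] by blast
  qed
  have pow: "C \<in> ext_power V i \<longleftrightarrow> (\<exists>u\<in>?F. C = quotient_rel ?F ?R `` {u})" for C
    unfolding ext_power_def quotient_space_def quotient_def by auto
  have R0: "?R = quotient_rel ?F ?R `` {0}" using clsR[of 0] real_vector.subspace_0[OF sR] RF by auto
  have Rin: "?R \<in> ext_kernel V i T"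
  proof -
    have "0 \<in> ?F" using real_vector.subspace_0[OF sF] .
    moreover have "ext_derivation V i T ?R = ?R"
      using der[OF \<open>0 \<in> ?F\<close>] R0 by (simp add: linear_0[OF free_der(1)])
    ultimately show ?thesis unfolding ext_kernel_def using pow R0 by blast
  qed
  have ker: "quotient_rel ?F ?R `` {u} \<in> ext_kernel V i T \<longleftrightarrow> free_der u \<in> ?R" if "u \<in> ?F" for u
    unfolding ext_kernel_def using pow that der[OF that] clsR[OF free_der_in_free[OF that]] by auto
  show ?thesis
  proof
    assume k: "ext_kernel V i T = {?R}"
    show "\<forall>u\<in>?F. free_der u \<in> ?R \<longrightarrow> u \<in> ?R" using ker clsR unfolding k by simp
  next
    assume inj: "\<forall>u\<in>?F. free_der u \<in> ?R \<longrightarrow> u \<in> ?R"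
    have "C = ?R" if C: "C \<in> ext_kernel V i T" for C
    proof -
      have "C \<in> ext_power V i" using C unfolding ext_kernel_def by simp
      then obtain u where u: "u \<in> ?F" "C = quotient_rel ?F ?R `` {u}" unfolding pow by (elim bexE)
      then have "u \<in> ?R" using inj ker C by simp
      then show ?thesis using clsR u by simp
    qed
    then show "ext_kernel V i T = {?R}" using Rin by blast
  qed
qed

text \<open>For u outside the relations take a functional with value 1 at u and write its form as
  the derivation of a form g. Its value at u is then that of g at \<open>free_der u\<close>, which
  is a relation.\<close>

lemma injective_if_surjective_on_forms:
  assumes surj: "\<And>f. f \<in> forms i \<Longrightarrow> \<exists>g\<in>forms i. form_derivation T g = f"
    and u: "u \<in> ext_free V i" "free_der u \<in> ext_relations V i"
  shows "u \<in> ext_relations V i"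
proof (rule ccontr)
  assume n: "u \<notin> ext_relations V i"
  obtain \<psi> :: "('a list \<Rightarrow> real) \<Rightarrow> real" where \<psi>: "linear \<psi>" "\<And>r. r \<in> ext_relations V i \<Longrightarrow> \<psi> r = 0" "\<psi> u = 1"
    by (rule functional_vanishing_on[OF subspace_ext(1) n]) (rule that; assumption)
  define f where "f = (\<lambda>xs. if length xs = i then \<psi> (generator (map \<pi> xs)) else 0)"
  have "f \<in> forms i" unfolding f_def by (rule functional_form[OF \<psi>(1,2)])
  then obtain g where g: "g \<in> forms i" "form_derivation T g = f" using surj by blast
  obtain G where G: "linear G" "\<And>xs. G (generator xs) = g xs" by (rule generator_extension[of "g"]) (rule that; assumption)
  obtain H where H: "linear H" "\<And>xs. H (generator xs) = form_derivation T g xs" by (rule generator_extension[of "form_derivation T g"]) (rule that; assumption)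
  have "G (free_der u) = H u" by (rule functional_free_der[OF G(1) _ H u(1)]) (simp add: G(2))
  moreover have "G (free_der u) = 0"
    using g(1) unfolding forms_def by (intro cochain_kills_relations[OF _ G u(2)]) blast
  moreover have "\<psi> u = H u"
  proof -
    have l: "linear (\<lambda>u. \<psi> u - H u)" using \<psi>(1) H(1) by (rule linear_compose_sub)
    have "\<psi> (generator xs) = f xs" if "xs \<in> tuples V i" for xs
      using functional_form_values[of f i \<psi>] that by (simp add: f_def)
    then have "\<psi> u - H u = 0"
      using H(2) g(2) by (intro linear_eq_0_on_span[OF l _ u(1)[unfolded ext_free_def]]) auto
    then show ?thesis by simp
  qed
  ultimately show False using \<psi>(3) by simp
qed

text \<open>A preimage of f is f composed with a left inverse of the derivation. The free space is
  infinite-dimensional, so the left inverse is taken on a complement N of the relations, where P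
  projects along the relations.\<close>

lemma surjective_on_forms_if_injective:
  assumes inj: "\<And>u. u \<in> ext_free V i \<Longrightarrow> free_der u \<in> ext_relations V i \<Longrightarrow> u \<in> ext_relations V i"
    and f: "f \<in> forms i"
  shows "\<exists>g\<in>forms i. form_derivation T g = f"
proof -
  let ?F = "ext_free V i" and ?R = "ext_relations V i"
  obtain A where A: "A \<subseteq> ?R" "independent A" "?R \<subseteq> span A"
    using real_vector.maximal_independent_subset by blast
  have "A \<subseteq> ?F" using A(1) ext_relations_subset by blast
  then obtain B where B: "A \<subseteq> B" "B \<subseteq> ?F" "independent B" "?F \<subseteq> span B"
    using real_vector.maximal_independent_subset_extend[of A ?F] A(2) by blast
  have spA: "span A = ?R" using A subspace_ext(1) by (simp add: real_vector.span_minimal subset_antisym)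
  have spB: "span B = ?F" using B subspace_ext(2) by (simp add: real_vector.span_minimal subset_antisym)
  obtain P where P: "linear P" "\<forall>x\<in>B. P x = (if x \<in> A then 0 else x)"
    using linear_independent_extend[OF B(3), of "\<lambda>x. if x \<in> A then 0 else x"] by blast
  have PA: "P x = 0" if "x \<in> A" for x using P(2) B(1) that by auto
  have PR: "P r = 0" if "r \<in> ?R" for r
    by (rule linear_eq_0_on_span[OF P(1) PA, of A]) (use that spA in auto)
  define N where "N = span (B - A)"
  have Pdiff: "x - P x \<in> ?R \<and> P x \<in> N" if "x \<in> ?F" for x
  proof -
    have "x \<in> span B" using that spB by simp
    then show ?thesis
    proof (induction rule: real_vector.span_induct_alt)
      case base
      show ?case unfolding linear_0[OF P(1)] N_def diff_zero
        by (intro conjI real_vector.span_zero real_vector.subspace_0[OF subspace_ext(1)])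
    next
      case (step c x y)
      have x: "x - P x \<in> ?R \<and> P x \<in> N"
        using step(1) P(2) A(1) real_vector.subspace_0[OF subspace_ext(1)]
        by (auto simp: N_def real_vector.span_zero intro: real_vector.span_base)
      have eq: "c *\<^sub>R x + y - P (c *\<^sub>R x + y) = c *\<^sub>R (x - P x) + (y - P y)"
        by (simp add: linear_add[OF P(1)] linear_cmul[OF P(1)] algebra_simps)
      have P_eq: "P (c *\<^sub>R x + y) = c *\<^sub>R P x + P y"
        unfolding linear_add[OF P(1)] linear_cmul[OF P(1)] ..
      show ?case
      proof
        show "c *\<^sub>R x + y - P (c *\<^sub>R x + y) \<in> ?R"
          unfolding eq using x step(2)
          by (intro real_vector.subspace_add[OF subspace_ext(1)] real_vector.subspace_scale[OF subspace_ext(1)]) blast+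
        show "P (c *\<^sub>R x + y) \<in> N"
          unfolding P_eq using x step(2) unfolding N_def
          by (intro real_vector.span_add real_vector.span_scale) blast+
      qed
    qed
  qed
  have NF: "N \<subseteq> ?F" unfolding N_def spB[symmetric] by (rule real_vector.span_mono) blast
  have PN: "P x = x" if "x \<in> N" for x
  proof -
    have "linear (\<lambda>x. P x - x)" using P(1) linear_id[unfolded id_def] by (rule linear_compose_sub)
    then have "P x - x = 0"
      by (rule linear_eq_0_on_span[OF _ _ that[unfolded N_def]]) (use P(2) in auto)
    then show ?thesis by simp
  qed
  define h where "h = (\<lambda>x. P (free_der x))"
  have linh: "linear h" unfolding h_def using linear_compose[OF free_der(1) P(1)] by (simp add: o_def)
  have "inj_on h N"
  proof (rule inj_onI)
    fix x y assume xy: "x \<in> N" "y \<in> N" "h x = h y"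
    have d: "x - y \<in> N" using xy unfolding N_def by (simp add: real_vector.span_diff)
    have "h (x - y) = 0" using xy(3) by (simp add: linear_diff[OF linh])
    then have "free_der (x - y) \<in> ?R"
      using Pdiff[OF free_der_in_free, of "x - y"] d NF unfolding h_def by auto
    then have "x - y \<in> ?R" using inj d NF by blast
    then have "P (x - y) = 0" by (rule PR)
    then show "x = y" using PN[OF d] by simp
  qed
  then obtain g where g: "linear g" "\<forall>v\<in>N. g (h v) = v"
    using linear_exists_left_inverse_on[OF linh, of N] unfolding N_def by auto
  obtain G where G: "linear G" "\<And>xs. G (generator xs) = f xs" by (rule generator_extension[of "f"]) (rule that; assumption)
  have fc: "f \<in> cochains i" using f unfolding forms_def by blast
  define \<psi> where "\<psi> = (\<lambda>x. G (g (P x)))"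
  have \<psi>: "linear \<psi>" unfolding \<psi>_def
    using linear_compose[OF linear_compose[OF P(1) g(1)] G(1)] by (simp add: o_def)
  have \<psi>R: "\<psi> r = 0" if "r \<in> ?R" for r
    using PR[OF that] linear_0[OF g(1)] linear_0[OF G(1)] by (simp add: \<psi>_def)
  have \<psi>der: "\<psi> (free_der u) = G u" if u: "u \<in> ?F" for u
  proof -
    have r: "u - P u \<in> ?R" "P u \<in> N" using Pdiff[OF u] by auto
    have "\<psi> (free_der (P u)) = G (P u)" using g(2) r(2) unfolding \<psi>_def h_def by simp
    moreover have "\<psi> (free_der (u - P u)) = 0" using \<psi>R free_der_relations r(1) by blast
    moreover have "G (u - P u) = 0" by (rule cochain_kills_relations[OF fc G r(1)])
    ultimately show ?thesis by (simp add: linear_diff[OF free_der(1)] linear_diff[OF \<psi>] linear_diff[OF G(1)])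
  qed
  define f' where "f' = (\<lambda>xs. if length xs = i then \<psi> (generator (map \<pi> xs)) else 0)"
  have f': "f' \<in> forms i" unfolding f'_def by (rule functional_form[OF \<psi> \<psi>R])
  have "form_derivation T f' xs = f xs" for xs
  proof (cases "length xs = i")
    case True
    obtain H where H: "linear H" "\<And>xs. H (generator xs) = form_derivation T f' xs" by (rule generator_extension[of "form_derivation T f'"]) (rule that; assumption)
    let ?ys = "map \<pi> xs"
    have ys: "?ys \<in> tuples V i" by (rule map_\<pi>_in_tuples[OF True])
    have fv: "f' zs = \<psi> (generator zs)" if "zs \<in> tuples V i" for zs
      by (rule functional_form_values[OF _ that]) (simp add: f'_def)
    have "form_derivation T f' xs = form_derivation T f' ?ys"
      using form_derivation_forms[OF f'] unfolding forms_def by simp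
    also have "\<dots> = H (generator ?ys)" using H(2) by simp
    also have "\<dots> = \<psi> (free_der (generator ?ys))"
      by (rule functional_free_der[OF \<psi> fv H generator_in_free[OF ys], symmetric])
    also have "\<dots> = f ?ys" using \<psi>der[OF generator_in_free[OF ys]] G(2) by simp
    also have "\<dots> = f xs" using f unfolding forms_def by simp
    finally show ?thesis .
  next
    case False
    then show ?thesis
      using cochainsD(1)[OF fc] form_derivation_forms[OF f'] cochainsD(1)[of "form_derivation T f'" i xs] unfolding forms_def by simp
  qed
  then show ?thesis using f' by blast
qed

lemma ext_kernel_trivial_iff_surjective:
  "ext_kernel V i T = {ext_relations V i} \<longleftrightarrow> (\<forall>f\<in>forms i. \<exists>g\<in>forms i. form_derivation T g = f)"
  unfolding ext_kernel_trivial_iff_injective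
  using injective_if_surjective_on_forms surjective_on_forms_if_injective by blast

lemma forms_injective_iff_surjective:
  assumes "finite B" "span B = (UNIV :: 'a set)"
  shows "(\<forall>f\<in>forms i. form_derivation T f = 0 \<longrightarrow> f = 0) \<longleftrightarrow> (\<forall>f\<in>forms i. \<exists>g\<in>forms i. form_derivation T g = f)"
proof -
  obtain F where F: "finite F" "(cochains i :: ('a list \<Rightarrow> real) set) \<subseteq> span F" by (rule cochains_finite_span[OF assms])
  have sF: "forms i \<subseteq> span F" using F(2) unfolding forms_def by blast
  have sub: "form_derivation T ` forms i \<subseteq> forms i" using form_derivation_forms by blast
  show ?thesis
  proof
    assume inj: "\<forall>f\<in>forms i. form_derivation T f = 0 \<longrightarrow> f = 0"
    have "form_derivation T ` forms i = forms i"
      by (rule inj_endomorphism_surj[OF linear_form_derivation sub subspace_forms sF F(1)]) (use inj in blast)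
    then show "\<forall>f\<in>forms i. \<exists>g\<in>forms i. form_derivation T g = f" by (metis imageE)
  next
    assume "\<forall>f\<in>forms i. \<exists>g\<in>forms i. form_derivation T g = f"
    then have "forms i \<subseteq> form_derivation T ` forms i" by (metis imageI subsetI)
    then have im: "form_derivation T ` forms i = forms i" using sub by (rule subset_antisym[rotated])
    show "\<forall>f\<in>forms i. form_derivation T f = 0 \<longrightarrow> f = 0"
      using surj_endomorphism_inj[OF linear_form_derivation im subspace_forms sF F(1)] by blast
  qed
qed

end

section \<open>Algebras with an Abelian ideal of codimension one\<close>

locale abelian_extension = fd_lie_algebra bracket for bracket :: "'a::real_vector \<Rightarrow> 'a \<Rightarrow> 'a" +
  fixes V :: "'a set" and \<alpha> :: "'a \<Rightarrow> real" and v :: 'a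
  assumes V\<alpha>: "V = {x. \<alpha> x = 0}" and lin_\<alpha>: "linear \<alpha>" and \<alpha>v: "\<alpha> v = 1" and \<alpha>br: "\<And>x y. \<alpha> (bracket x y) = 0"
    and abel: "abelian_on bracket V"
begin

definition \<pi> :: "'a \<Rightarrow> 'a"
  where "\<pi> x = x - \<alpha> x *\<^sub>R v"

lemma lin_\<pi>: "linear \<pi>"
  unfolding \<pi>_def by (rule linearI) (simp_all add: linear_add[OF lin_\<alpha>] linear_cmul[OF lin_\<alpha>] algebra_simps)

lemma \<pi>V: "\<pi> x \<in> V"
  unfolding \<pi>_def V\<alpha> by (simp add: linear_diff[OF lin_\<alpha>] linear_cmul[OF lin_\<alpha>] \<alpha>v)

lemma \<pi>_id: "x \<in> V \<Longrightarrow> \<pi> x = x"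
  unfolding \<pi>_def V\<alpha> by simp

lemma \<pi>_v: "\<pi> v = 0"
  unfolding \<pi>_def by (simp add: \<alpha>v)

lemma br_V: "bracket x y \<in> V"
  unfolding V\<alpha> by (simp add: \<alpha>br)

sublocale projected_endomorphism V \<pi> "bracket v"
proof
  show "subspace V" unfolding V\<alpha> real_vector.subspace_def
    by (simp add: linear_0[OF lin_\<alpha>] linear_add[OF lin_\<alpha>] linear_cmul[OF lin_\<alpha>])
  show "bracket v (\<pi> x) = bracket v x" for x unfolding \<pi>_def by (simp add: br_diff br_scale bracket_self)
qed (simp_all add: linear_add[OF lin_\<pi>] linear_cmul[OF lin_\<pi>] \<pi>V \<pi>_id br_V br_add br_scale)

lemma decompose: "x = \<alpha> x *\<^sub>R v + \<pi> x"
  unfolding \<pi>_def by simp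

lemma bracket_formula: "bracket x y = \<alpha> x *\<^sub>R bracket v y - \<alpha> y *\<^sub>R bracket v x"
proof -
  have "bracket (\<pi> x) (\<pi> y) = 0" using abel \<pi>V unfolding abelian_on_def by blast
  moreover have "bracket x y = bracket (\<alpha> x *\<^sub>R v + \<pi> x) (\<alpha> y *\<^sub>R v + \<pi> y)" using decompose by metis
  ultimately have "bracket x y = \<alpha> x *\<^sub>R bracket v (\<pi> y) + \<alpha> y *\<^sub>R bracket (\<pi> x) v"
    by (simp add: br_add br_scale bracket_self)
  then show ?thesis using br_skew[of "\<pi> x" v] by (simp add: T\<pi>)
qed

section \<open>Forms on the Abelian ideal and cohomology in degrees two and three\<close>

lemma forms_1: "forms 1 = form1 ` {\<theta>. linear \<theta> \<and> (\<forall>x. \<theta> (\<pi> x) = \<theta> x)}"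
proof (intro Set.set_eqI iffI)
  fix f assume f: "f \<in> forms 1"
  then obtain \<theta> where \<theta>: "f = form1 \<theta>" "linear \<theta>" unfolding forms_def cochains_1 by blast
  have "f (map \<pi> [x]) = f [x]" for x using f unfolding forms_def by blast
  then show "f \<in> form1 ` {\<theta>. linear \<theta> \<and> (\<forall>x. \<theta> (\<pi> x) = \<theta> x)}" using \<theta> by auto
qed (auto simp: forms_def cochains_1 form1_def simp del: One_nat_def)

lemma forms_2: "forms 2 = form2 ` {\<omega>. alt2 \<omega> \<and> (\<forall>x y. \<omega> (\<pi> x) (\<pi> y) = \<omega> x y)}"
proof (intro Set.set_eqI iffI)
  fix f assume f: "f \<in> forms 2"
  then obtain \<omega> where \<omega>: "f = form2 \<omega>" "alt2 \<omega>" unfolding forms_def cochains_2 by blast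
  have "f (map \<pi> [x, y]) = f [x, y]" for x y using f unfolding forms_def by blast
  then show "f \<in> form2 ` {\<omega>. alt2 \<omega> \<and> (\<forall>x y. \<omega> (\<pi> x) (\<pi> y) = \<omega> x y)}" using \<omega> by auto
qed (auto simp: forms_def cochains_2 form2_def)

lemma forms_3: "forms 3 = form3 ` {\<phi>. alt3 \<phi> \<and> (\<forall>x y z. \<phi> (\<pi> x) (\<pi> y) (\<pi> z) = \<phi> x y z)}"
proof (intro Set.set_eqI iffI)
  fix f assume f: "f \<in> forms 3"
  then obtain \<phi> where \<phi>: "f = form3 \<phi>" "alt3 \<phi>" unfolding forms_def cochains_3 by blast
  have "f (map \<pi> [x, y, z]) = f [x, y, z]" for x y z using f unfolding forms_def by blast
  then show "f \<in> form3 ` {\<phi>. alt3 \<phi> \<and> (\<forall>x y z. \<phi> (\<pi> x) (\<pi> y) (\<pi> z) = \<phi> x y z)}" using \<phi> by auto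
qed (auto simp: forms_def cochains_3 form3_def)

lemma derivation_form1: "form_derivation (bracket v) (form1 \<theta>) = form1 (\<lambda>x. \<theta> (bracket v x))"
  by (rule ext) (auto simp: form_derivation_def form1_def length_Suc_conv)

lemma derivation_form2: "form_derivation (bracket v) (form2 \<omega>) = form2 (\<lambda>x y. \<omega> (bracket v x) y + \<omega> x (bracket v y))"
proof
  fix xs
  show "form_derivation (bracket v) (form2 \<omega>) xs = form2 (\<lambda>x y. \<omega> (bracket v x) y + \<omega> x (bracket v y)) xs"
  proof (cases "length xs = 2")
    case True
    then obtain x y where "xs = [x, y]" unfolding length_2_conv by blast
    then show ?thesis by (simp add: form_derivation_def)
  qed (simp add: form_derivation_def form2_def)
qed

lemma derivation_form3: "form_derivation (bracket v) (form3 \<phi>) =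
  form3 (\<lambda>x y z. \<phi> (bracket v x) y z + \<phi> x (bracket v y) z + \<phi> x y (bracket v z))"
proof
  fix xs
  show "form_derivation (bracket v) (form3 \<phi>) xs =
    form3 (\<lambda>x y z. \<phi> (bracket v x) y z + \<phi> x (bracket v y) z + \<phi> x y (bracket v z)) xs"
  proof (cases "length xs = 3")
    case True
    then obtain x y z where "xs = [x, y, z]" unfolding length_3_conv by blast
    then show ?thesis by (simp add: form_derivation_def)
  qed (simp add: form_derivation_def form3_def)
qed

definition surjective_on :: "nat \<Rightarrow> bool"
  where "surjective_on i \<longleftrightarrow> (\<forall>f\<in>forms i. \<exists>g\<in>forms i. form_derivation (bracket v) g = f)"

lemma surjective_on_injective: "surjective_on i \<longleftrightarrow> (\<forall>f\<in>forms i. form_derivation (bracket v) f = 0 \<longrightarrow> f = 0)"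
proof -
  obtain B where B: "finite B" "span B = (UNIV :: 'a set)" using finite_span by blast
  show ?thesis unfolding surjective_on_def by (rule forms_injective_iff_surjective[OF B, symmetric])
qed

text \<open>For a 1-form \<beta> on V the product of \<alpha> and \<beta> is closed. If \<theta> is
  a primitive of it, the restriction of - \<theta> to V is a preimage of \<beta>.\<close>

lemma H2_surjective_1:
  assumes H2: "H2_trivial"
  shows "surjective_on 1"
  unfolding surjective_on_def
proof
  fix f assume "f \<in> forms 1"
  then obtain \<beta> where \<beta>: "f = form1 \<beta>" "linear \<beta>" "\<And>x. \<beta> (\<pi> x) = \<beta> x" unfolding forms_1 by blast
  have \<beta>v: "\<beta> v = 0" using \<beta>(3)[of v] by (simp add: \<pi>_v linear_0[OF \<beta>(2)])
  define \<omega> where "\<omega> x y = \<alpha> x * \<beta> y - \<alpha> y * \<beta> x" for x y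
  have "alt2 \<omega>"
    unfolding alt2_def bilinear_def \<omega>_def
    by (auto intro!: linearI simp: linear_add[OF lin_\<alpha>] linear_cmul[OF lin_\<alpha>] linear_add[OF \<beta>(2)] linear_cmul[OF \<beta>(2)] algebra_simps)
  moreover have "d2 \<omega> x y z = 0" for x y z
    unfolding d2_def \<omega>_def \<alpha>br unfolding bracket_formula[of x y] bracket_formula[of x z] bracket_formula[of y z]
    by (simp add: linear_diff[OF \<beta>(2)] linear_cmul[OF \<beta>(2)] algebra_simps)
  ultimately have "\<exists>\<theta>. linear \<theta> \<and> (\<forall>x y. \<omega> x y = - \<theta> (bracket x y))" using H2 unfolding H2_trivial_def by simp
  then obtain \<theta> where \<theta>: "linear \<theta>" "\<And>x y. \<omega> x y = - \<theta> (bracket x y)" by blast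
  let ?g = "form1 (\<lambda>x. - \<theta> (\<pi> x))"
  have "linear (\<lambda>x. - \<theta> (\<pi> x))"
    using linear_compose_neg[OF linear_compose[OF lin_\<pi> \<theta>(1)]] by (simp add: o_def)
  then have "?g \<in> forms 1" unfolding forms_1 using \<pi>_id[OF \<pi>V] by auto
  moreover have "form_derivation (bracket v) ?g = f"
  proof -
    have "- \<theta> (\<pi> (bracket v x)) = \<beta> x" for x
      using \<theta>(2)[of v x] \<pi>_id[OF br_V] by (simp add: \<omega>_def \<alpha>v \<beta>v)
    then show ?thesis unfolding derivation_form1 \<beta>(1) by simp
  qed
  ultimately show "\<exists>g\<in>forms 1. form_derivation (bracket v) g = f" by blast
qed

text \<open>The same argument one degree higher, with the product of \<alpha> and a 2-form \<eta> on
  V.\<close>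

lemma H3_surjective_2:
  assumes H3: "H3_trivial"
  shows "surjective_on 2"
  unfolding surjective_on_def
proof
  fix f assume "f \<in> forms 2"
  then obtain \<eta> where \<eta>: "f = form2 \<eta>" "alt2 \<eta>" "\<And>x y. \<eta> (\<pi> x) (\<pi> y) = \<eta> x y" unfolding forms_2 by blast
  note l = alt2_linear[OF \<eta>(2)]
  note ls = linear_add[OF l(1)] linear_add[OF l(2)] linear_cmul[OF l(1)] linear_cmul[OF l(2)] linear_diff[OF l(2)]
  have \<eta>v: "\<eta> v y = 0" "\<eta> y v = 0" for y
    using \<eta>(3)[of v y] \<eta>(3)[of y v] by (simp_all add: \<pi>_v linear_0[OF l(1)] linear_0[OF l(2)])
  define \<phi> where "\<phi> x y z = \<alpha> x * \<eta> y z - \<alpha> y * \<eta> x z + \<alpha> z * \<eta> x y" for x y z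
  have sk: "\<eta> y x = - \<eta> x y" for x y by (rule alt2_skew[OF \<eta>(2)])
  have "alt3 \<phi>"
    unfolding alt3_def
  proof (intro conjI allI)
    show "linear (\<phi> x y)" "linear (\<lambda>z. \<phi> x z y)" "linear (\<lambda>z. \<phi> z x y)" for x y
      unfolding \<phi>_def by (rule linearI; simp add: linear_add[OF lin_\<alpha>] linear_cmul[OF lin_\<alpha>] ls algebra_simps)+
    show "\<phi> x x y = 0" "\<phi> x y y = 0" "\<phi> x y x = 0" for x y
      unfolding \<phi>_def using sk[of x y] by (simp_all add: l(3))
  qed
  moreover have "d3 \<phi> x y z w = 0" for x y z w
  proof -
    have t: "\<phi> (bracket x y) z w = - \<alpha> z * (\<alpha> x * \<eta> (bracket v y) w - \<alpha> y * \<eta> (bracket v x) w) +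
        \<alpha> w * (\<alpha> x * \<eta> (bracket v y) z - \<alpha> y * \<eta> (bracket v x) z)" for x y z w
      unfolding \<phi>_def \<alpha>br unfolding bracket_formula[of x y] by (simp add: ls)
    show ?thesis unfolding d3_def t by (simp add: algebra_simps)
  qed
  ultimately have "\<exists>\<omega>. alt2 \<omega> \<and> (\<forall>x y z. \<phi> x y z = d2 \<omega> x y z)" using H3 unfolding H3_trivial_def by simp
  then obtain \<omega> where \<omega>: "alt2 \<omega>" "\<And>x y z. \<phi> x y z = d2 \<omega> x y z" by blast
  note m = alt2_linear[OF \<omega>(1)]
  let ?w = "\<lambda>x y. - \<omega> (\<pi> x) (\<pi> y)"
  have "alt2 ?w"
    unfolding alt2_def bilinear_def
    by (auto intro!: linearI simp: linear_add[OF lin_\<pi>] linear_cmul[OF lin_\<pi>] linear_add[OF m(1)] linear_add[OF m(2)]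
        linear_cmul[OF m(1)] linear_cmul[OF m(2)] m(3))
  then have "form2 ?w \<in> forms 2" unfolding forms_2 using \<pi>_id[OF \<pi>V] by auto
  moreover have "form_derivation (bracket v) (form2 ?w) = f"
  proof -
    have "?w (bracket v x) y + ?w x (bracket v y) = \<eta> x y" for x y
    proof -
      have z: "bracket (\<pi> x) (\<pi> y) = 0" using abel \<pi>V unfolding abelian_on_def by blast
      have "\<eta> x y = \<phi> v (\<pi> x) (\<pi> y)" unfolding \<phi>_def by (simp add: \<alpha>v \<eta>v \<eta>(3))
      also have "\<dots> = - \<omega> (bracket v x) (\<pi> y) + \<omega> (bracket v y) (\<pi> x)"
        unfolding \<omega>(2) d2_def z T\<pi> by (simp add: linear_0[OF m(2)])
      finally show ?thesis using alt2_skew[OF \<omega>(1), of "bracket v y" "\<pi> x"] by (simp add: \<pi>_id[OF br_V])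
    qed
    then show ?thesis unfolding derivation_form2 \<eta>(1) by simp
  qed
  ultimately show "\<exists>g\<in>forms 2. form_derivation (bracket v) g = f" by blast
qed

lemma d3_formula:
  assumes "alt3 \<phi>"
  shows "d3 \<phi> x y z w =
    - \<alpha> x * (\<phi> (bracket v y) z w + \<phi> y (bracket v z) w + \<phi> y z (bracket v w))
    + \<alpha> y * (\<phi> (bracket v x) z w + \<phi> x (bracket v z) w + \<phi> x z (bracket v w))
    - \<alpha> z * (\<phi> (bracket v x) y w + \<phi> x (bracket v y) w + \<phi> x y (bracket v w))
    + \<alpha> w * (\<phi> (bracket v x) y z + \<phi> x (bracket v y) z + \<phi> x y (bracket v z))"
proof -
  note l = alt3_linear[OF assms]
  have t: "\<phi> (bracket x y) z w = \<alpha> x * \<phi> (bracket v y) z w - \<alpha> y * \<phi> (bracket v x) z w" for x y z w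
    by (subst bracket_formula) (simp add: linear_diff[OF l(3)] linear_cmul[OF l(3)])
  have s: "\<phi> y (bracket v u) w = - \<phi> (bracket v u) y w" "\<phi> y z (bracket v u) = \<phi> (bracket v u) y z" for y z u w
    using alt3_swap(1)[OF assms, of y "bracket v u" w] alt3_swap(1)[OF assms, of y "bracket v u" z]
      alt3_swap(2)[OF assms, of y z "bracket v u"] by linarith+
  show ?thesis
    unfolding d3_def t[of x y] t[of x z] t[of x w] t[of y z] t[of y w] t[of z w] s by (simp add: algebra_simps)
qed

text \<open>A 3-form on V that v annihilates is closed on g, hence exact. Exact 3-forms vanish on V
  because V is Abelian, so the form is zero; surjectivity follows from this injectivity in finite
  dimension.\<close>

lemma H3_surjective_3:
  assumes H3: "H3_trivial"
  shows "surjective_on 3"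
  unfolding surjective_on_injective
proof (intro ballI impI)
  fix f assume f: "f \<in> forms 3" "form_derivation (bracket v) f = 0"
  obtain \<phi> where \<phi>: "f = form3 \<phi>" "alt3 \<phi>" "\<And>x y z. \<phi> (\<pi> x) (\<pi> y) (\<pi> z) = \<phi> x y z" using f(1) unfolding forms_3 by blast
  have "form_derivation (bracket v) f [x, y, z] = 0" for x y z unfolding f(2) by (simp add: zero_fun_def)
  then have D: "\<phi> (bracket v x) y z + \<phi> x (bracket v y) z + \<phi> x y (bracket v z) = 0" for x y z
    unfolding \<phi>(1) derivation_form3 by simp
  have "d3 \<phi> x y z w = 0" for x y z w unfolding d3_formula[OF \<phi>(2)] D by simp
  then have "\<exists>\<omega>. alt2 \<omega> \<and> (\<forall>x y z. \<phi> x y z = d2 \<omega> x y z)" using H3 \<phi>(2) unfolding H3_trivial_def by simp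
  then obtain \<omega> where \<omega>: "alt2 \<omega>" "\<And>x y z. \<phi> x y z = d2 \<omega> x y z" by blast
  have z: "bracket (\<pi> x) (\<pi> y) = 0" for x y using abel \<pi>V unfolding abelian_on_def by blast
  have "d2 \<omega> (\<pi> x) (\<pi> y) (\<pi> w) = 0" for x y w
    unfolding d2_def z by (simp add: linear_0[OF alt2_linear(2)[OF \<omega>(1)]])
  then have "\<phi> x y w = 0" for x y w using \<phi>(3)[of x y w] \<omega>(2) by simp
  then show "f = 0" unfolding \<phi>(1) by (auto simp: form3_def fun_eq_iff zero_fun_def)
qed

text \<open>A closed \<omega> is split into its restriction to V and the 1-form b = \<omega>(v, .)
  on V. Closedness says that v annihilates the restriction, which vanishes by injectivity on
  2-forms; surjectivity on 1-forms then supplies a primitive from b.\<close>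

lemma surjective_H2:
  assumes s: "surjective_on 1" "surjective_on 2"
  shows "H2_trivial"
  unfolding H2_trivial_def
proof (intro allI impI)
  fix \<omega> assume "alt2 \<omega> \<and> (\<forall>x y z. d2 \<omega> x y z = 0)"
  then have \<omega>: "alt2 \<omega>" "\<And>x y z. d2 \<omega> x y z = 0" by auto
  note m = alt2_linear[OF \<omega>(1)]
  have z: "bracket (\<pi> x) (\<pi> y) = 0" for x y using abel \<pi>V unfolding abelian_on_def by blast
  let ?w = "\<lambda>x y. \<omega> (\<pi> x) (\<pi> y)"
  have "alt2 ?w"
    unfolding alt2_def bilinear_def
    by (auto intro!: linearI simp: linear_add[OF lin_\<pi>] linear_cmul[OF lin_\<pi>] linear_add[OF m(1)] linear_add[OF m(2)]
        linear_cmul[OF m(1)] linear_cmul[OF m(2)] m(3))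
  then have "form2 ?w \<in> forms 2" unfolding forms_2 using \<pi>_id[OF \<pi>V] by auto
  moreover have "form_derivation (bracket v) (form2 ?w) = 0"
  proof -
    have "?w (bracket v x) y + ?w x (bracket v y) = 0" for x y
      using \<omega>(2)[of v "\<pi> x" "\<pi> y"] alt2_skew[OF \<omega>(1), of "bracket v y" "\<pi> x"]
      unfolding d2_def z T\<pi> by (simp add: linear_0[OF m(2)] \<pi>_id[OF br_V])
    then show ?thesis unfolding derivation_form2 by (auto simp: form2_def fun_eq_iff zero_fun_def)
  qed
  ultimately have "form2 ?w = 0" using s(2) unfolding surjective_on_injective by blast
  then have "form2 ?w [x, y] = 0" for x y by (simp only: zero_fun_def)
  then have w0: "\<omega> (\<pi> x) (\<pi> y) = 0" for x y by simp
  let ?b = "\<lambda>x. \<omega> v (\<pi> x)"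
  have "linear ?b" using linear_compose[OF lin_\<pi> m(1)] by (simp add: o_def)
  then have "form1 ?b \<in> forms 1" unfolding forms_1 using \<pi>_id[OF \<pi>V] by auto
  then obtain g where g: "g \<in> forms 1" "form_derivation (bracket v) g = form1 ?b" using s(1) unfolding surjective_on_def by blast
  then obtain \<theta> where \<theta>: "g = form1 \<theta>" "linear \<theta>" unfolding forms_1 by blast
  have b: "\<theta> (bracket v x) = \<omega> v (\<pi> x)" for x
    using g(2) unfolding \<theta>(1) derivation_form1 form1_inj by (rule fun_cong)
  have "\<omega> x y = - (- \<theta> (bracket x y))" for x y
  proof -
    have "\<omega> x y = \<omega> (\<alpha> x *\<^sub>R v + \<pi> x) (\<alpha> y *\<^sub>R v + \<pi> y)" using decompose by metis
    also have "\<dots> = \<alpha> x * \<omega> v (\<pi> y) + \<alpha> y * \<omega> (\<pi> x) v"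
      by (simp add: linear_add[OF m(1)] linear_add[OF m(2)] linear_cmul[OF m(1)] linear_cmul[OF m(2)] m(3) w0)
    also have "\<dots> = \<theta> (bracket x y)"
      unfolding bracket_formula[of x y] using alt2_skew[OF \<omega>(1), of "\<pi> x" v]
      by (simp add: linear_diff[OF \<theta>(2)] linear_cmul[OF \<theta>(2)] b)
    finally show ?thesis by simp
  qed
  then show "\<exists>\<theta>. linear \<theta> \<and> (\<forall>x y. \<omega> x y = - \<theta> (bracket x y))" using linear_compose_neg[OF \<theta>(2)] by blast
qed

text \<open>As in degree two: injectivity on 3-forms removes the restriction to V, and surjectivity
  on 2-forms integrates the contraction with v.\<close>

lemma surjective_H3:
  assumes s: "surjective_on 2" "surjective_on 3"
  shows "H3_trivial"
  unfolding H3_trivial_def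
proof (intro allI impI)
  fix \<phi> assume "alt3 \<phi> \<and> (\<forall>x y z w. d3 \<phi> x y z w = 0)"
  then have \<phi>: "alt3 \<phi>" "\<And>x y z w. d3 \<phi> x y z w = 0" by auto
  note m = alt3_linear[OF \<phi>(1)]
  note ms = linear_add[OF m(1)] linear_add[OF m(2)] linear_add[OF m(3)] linear_cmul[OF m(1)] linear_cmul[OF m(2)] linear_cmul[OF m(3)]
  have \<alpha>\<pi>: "\<alpha> (\<pi> x) = 0" for x using \<pi>V[of x] unfolding V\<alpha> by simp
  have m6: "\<phi> x y x = 0" for x y using \<phi>(1) unfolding alt3_def by blast
  let ?p = "\<lambda>x y z. \<phi> (\<pi> x) (\<pi> y) (\<pi> z)"
  have "alt3 ?p"
    unfolding alt3_def by (auto intro!: linearI simp: linear_add[OF lin_\<pi>] linear_cmul[OF lin_\<pi>] ms m(4,5) m6)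
  then have "form3 ?p \<in> forms 3" unfolding forms_3 using \<pi>_id[OF \<pi>V] by auto
  moreover have "form_derivation (bracket v) (form3 ?p) = 0"
  proof -
    have "?p (bracket v x) y z + ?p x (bracket v y) z + ?p x y (bracket v z) = 0" for x y z
      using \<phi>(2)[of v "\<pi> x" "\<pi> y" "\<pi> z"] unfolding d3_formula[OF \<phi>(1)] \<alpha>\<pi> \<alpha>v T\<pi> \<pi>_id[OF br_V] by simp
    then show ?thesis unfolding derivation_form3 by (auto simp: form3_def fun_eq_iff zero_fun_def)
  qed
  ultimately have "form3 ?p = 0" using s(2) unfolding surjective_on_injective by blast
  then have "form3 ?p [x, y, z] = 0" for x y z by (simp only: zero_fun_def)
  then have p0: "\<phi> (\<pi> x) (\<pi> y) (\<pi> z) = 0" for x y z by simp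
  let ?e = "\<lambda>x y. \<phi> v (\<pi> x) (\<pi> y)"
  have "alt2 ?e"
    unfolding alt2_def bilinear_def by (auto intro!: linearI simp: linear_add[OF lin_\<pi>] linear_cmul[OF lin_\<pi>] ms m(5))
  then have "form2 ?e \<in> forms 2" unfolding forms_2 using \<pi>_id[OF \<pi>V] by auto
  then obtain g where g: "g \<in> forms 2" "form_derivation (bracket v) g = form2 ?e" using s(1) unfolding surjective_on_def by blast
  then obtain \<eta> where \<eta>: "g = form2 \<eta>" "alt2 \<eta>" unfolding forms_2 by blast
  note l = alt2_linear[OF \<eta>(2)]
  have "(\<lambda>x y. \<eta> (bracket v x) y + \<eta> x (bracket v y)) = ?e"
    using g(2) unfolding \<eta>(1) derivation_form2 form2_inj .
  then have e: "\<phi> v (\<pi> x) (\<pi> y) = \<eta> (bracket v x) y + \<eta> x (bracket v y)" for x y by (simp add: fun_eq_iff)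
  let ?w = "\<lambda>x y. - \<eta> x y"
  have "alt2 ?w" using \<eta>(2) unfolding alt2_def bilinear_def by (auto intro: linear_compose_neg)
  moreover have "\<phi> x y z = d2 ?w x y z" for x y z
  proof -
    have "\<phi> x y z = \<phi> (\<alpha> x *\<^sub>R v + \<pi> x) (\<alpha> y *\<^sub>R v + \<pi> y) (\<alpha> z *\<^sub>R v + \<pi> z)" using decompose by metis
    also have "\<dots> = \<alpha> x * \<phi> v (\<pi> y) (\<pi> z) + \<alpha> y * \<phi> (\<pi> x) v (\<pi> z) + \<alpha> z * \<phi> (\<pi> x) (\<pi> y) v"
      by (simp add: ms m(4,5) m6 p0)
    also have "\<phi> (\<pi> x) v (\<pi> z) = - \<phi> v (\<pi> x) (\<pi> z)" by (rule alt3_swap(1)[OF \<phi>(1)])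
    also have "\<phi> (\<pi> x) (\<pi> y) v = \<phi> v (\<pi> x) (\<pi> y)"
      using alt3_swap(2)[OF \<phi>(1), of "\<pi> x" "\<pi> y" v] alt3_swap(1)[OF \<phi>(1), of "\<pi> x" v "\<pi> y"] by simp
    also have "\<alpha> x * \<phi> v (\<pi> y) (\<pi> z) + \<alpha> y * (- \<phi> v (\<pi> x) (\<pi> z)) + \<alpha> z * \<phi> v (\<pi> x) (\<pi> y) = d2 ?w x y z"
    proof -
      have t: "\<eta> (bracket x y) z = \<alpha> x * \<eta> (bracket v y) z - \<alpha> y * \<eta> (bracket v x) z" for x y z
        by (subst bracket_formula) (simp add: linear_diff[OF l(2)] linear_cmul[OF l(2)])
      have sk: "\<eta> u (bracket v w) = - \<eta> (bracket v w) u" for u w by (rule alt2_skew[OF \<eta>(2)])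
      show ?thesis unfolding d2_def e t[of x y] t[of x z] t[of y z] sk by (simp add: algebra_simps)
    qed
    finally show ?thesis .
  qed
  ultimately show "\<exists>\<omega>. alt2 \<omega> \<and> (\<forall>x y z. \<phi> x y z = d2 \<omega> x y z)" by blast
qed

end

section \<open>The classification\<close>

context fd_lie_algebra
begin

lemma abelian_isomorphic:
  assumes "dim S = 5" "subspace S" "abelian_on bracket S"
  shows "lie_isomorphic bracket S (\<lambda>_ _. 0) (UNIV :: (real ^ 5) set)"
proof -
  have "{0} \<subseteq> S" using assms(2) by (simp add: real_vector.subspace_0)
  then obtain n b \<xi> where rc: "rel_coords S {0} n b \<xi>" "dim S = dim ({0} :: 'a set) + n"
    by (rule coords[OF assms(2) real_vector.subspace_single_0])
  moreover have "dim ({0} :: 'a set) = 0"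
    by (metis card.empty real_vector.dim_span_eq_card_independent real_vector.independent_empty real_vector.span_empty)
  ultimately have rc: "rel_coords S {0} 5 b \<xi>" using assms(1) by simp
  note r = rel_coordsD[OF rc]
  obtain h :: "5 \<Rightarrow> nat" where h: "bij_betw h UNIV {..<5}"
    using ex_bij_betw_finite_nat[of "UNIV :: 5 set"] by (auto simp: atLeast0LessThan)
  have h5: "h i < 5" for i using h by (auto simp: bij_betw_def)
  define f :: "'a \<Rightarrow> real ^ 5" where "f x = (\<chi> i. \<xi> (h i) x)" for x
  have fl: "f (x + y) = f x + f y" "f (c *\<^sub>R x) = c *\<^sub>R f x" for x y c
    unfolding f_def by (simp_all add: Finite_Cartesian_Product.vec_eq_iff linear_add[OF r(5)[OF h5]] linear_cmul[OF r(5)[OF h5]])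
  have ker: "x = 0" if "x \<in> S" "f x = 0" for x
  proof -
    have "\<xi> j x = 0" if "j < 5" for j
    proof -
      obtain i where "j = h i" using h \<open>j < 5\<close> by (auto simp: bij_betw_def)
      then show ?thesis using \<open>f x = 0\<close> by (simp add: f_def Finite_Cartesian_Product.vec_eq_iff)
    qed
    then show ?thesis using rel_coords_zero[OF rc that(1)] by blast
  qed
  have "bij_betw f S UNIV"
    unfolding bij_betw_def
  proof
    show "inj_on f S"
    proof (rule inj_onI)
      fix x y assume xy: "x \<in> S" "y \<in> S" "f x = f y"
      have "f (x - y) = 0" using fl(1)[of "x - y" y] xy(3) by simp
      then have "x - y = 0" by (rule ker[OF real_vector.subspace_diff[OF assms(2) xy(1,2)]])
      then show "x = y" by simp
    qed
    have "y \<in> f ` S" for y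
    proof -
      define x where "x = (\<Sum>j<5. y $ inv_into UNIV h j *\<^sub>R b j)"
      have "x \<in> S" unfolding x_def using r(4) assms(2) by (intro real_vector.subspace_sum real_vector.subspace_scale) auto
      moreover have "f x = y"
      proof -
        have "\<xi> (h i) x = y $ i" for i
          unfolding x_def using r(5,7) h5[of i] h
          by (simp add: linear_sum linear_cmul if_distrib[of "\<lambda>x. _ * x"] bij_betw_def cong: if_cong)
        then show ?thesis by (simp add: f_def Finite_Cartesian_Product.vec_eq_iff)
      qed
      ultimately show ?thesis by blast
    qed
    then show "f ` S = UNIV" by blast
  qed
  moreover have "f (bracket x y) = 0" if "x \<in> S" "y \<in> S" for x y
    using assms(3) that fl(2)[of 0 0] unfolding abelian_on_def by simp
  ultimately show ?thesis unfolding lie_isomorphic_def using fl by blast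
qed

lemma isomorphic_abelian:
  assumes iso: "lie_isomorphic bracket S (\<lambda>_ _. 0) (UNIV :: (real ^ 5) set)" and S: "lie_ideal bracket S"
  shows "abelian_on bracket S" "dim S = 5"
proof -
  have sS: "subspace S" using S by (rule lie_ideal_subspace)
  obtain f :: "'a \<Rightarrow> real ^ 5" where f: "bij_betw f S UNIV" "\<And>x y. x \<in> S \<Longrightarrow> y \<in> S \<Longrightarrow> f (x + y) = f x + f y"
    "\<And>c x. x \<in> S \<Longrightarrow> f (c *\<^sub>R x) = c *\<^sub>R f x" "\<And>x y. x \<in> S \<Longrightarrow> y \<in> S \<Longrightarrow> f (bracket x y) = 0"
    using iso unfolding lie_isomorphic_def by blast
  have S0: "0 \<in> S" using sS by (rule real_vector.subspace_0)
  have f0: "f 0 = 0" using f(3)[OF S0, of 0] by simp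
  show "abelian_on bracket S"
    unfolding abelian_on_def
  proof (intro ballI)
    fix x y assume xy: "x \<in> S" "y \<in> S"
    have "f (bracket x y) = f 0" using f(4)[OF xy] f0 by simp
    then show "bracket x y = 0"
      using f(1) lie_ideal_right[OF S xy(2)] S0 unfolding bij_betw_def inj_on_def by blast
  qed
  define g where "g = inv_into S f"
  have gS: "g y \<in> S" and fg: "f (g y) = y" for y
    using f(1) unfolding g_def by (auto simp: bij_betw_def intro: inv_into_into f_inv_into_f)
  have gf: "g (f x) = x" if "x \<in> S" for x using f(1) that unfolding g_def by (simp add: bij_betw_def)
  have ling: "linear g"
  proof (rule linearI)
    fix x y c
    have "g (x + y) = g (f (g x + g y))" using f(2)[OF gS gS] by (simp add: fg)
    also have "\<dots> = g x + g y" using gS sS by (intro gf) (simp add: real_vector.subspace_add)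
    finally show "g (x + y) = g x + g y" .
    have "g (c *\<^sub>R x) = g (f (c *\<^sub>R g x))" using f(3)[OF gS] by (simp add: fg)
    also have "\<dots> = c *\<^sub>R g x" using gS sS by (intro gf) (simp add: real_vector.subspace_scale)
    finally show "g (c *\<^sub>R x) = c *\<^sub>R g x" .
  qed
  have injg: "inj g" by (metis fg injI)
  have "g ` UNIV = S" using gS gf by (metis UNIV_I image_eqI image_subset_iff subset_antisym subsetI)
  moreover have "g ` UNIV = span (g ` (Basis :: (real ^ 5) set))"
    using linear_span_image[OF ling, of Basis] by simp
  ultimately have S_span: "S = span (g ` (Basis :: (real ^ 5) set))" by simp
  have "independent (g ` (Basis :: (real ^ 5) set))"
    using linear_independent_injective_image[OF ling independent_Basis] injg inj_on_subset by blast
  then have "dim S = card (g ` (Basis :: (real ^ 5) set))"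
    unfolding S_span by (rule real_vector.dim_span_eq_card_independent)
  also have "\<dots> = 5" using card_image[OF inj_on_subset[OF injg], of "Basis :: (real ^ 5) set"] by simp
  finally show "dim S = 5" .
qed

lemma two_three_trivial_iff: "two_three_trivial bracket \<longleftrightarrow> H2_trivial \<and> H3_trivial"
  unfolding two_three_trivial_def trivial_cohomology_2 trivial_cohomology_3 ..

text \<open>Rescaling the functional that defines S to the value 1 at v makes the criterion
  available for each single v outside S. In the theorem it yields the condition for all v, and any
  one v suffices for the converse.\<close>

lemma abelian_codim_one_criterion:
  assumes S: "lie_ideal bracket S" "abelian_on bracket S" and d: "dim (UNIV :: 'a set) = dim S + 1" and v: "v \<notin> S"
  shows "two_three_trivial bracket \<longleftrightarrow>
    (\<forall>i\<in>{1, 2, 3}. ext_kernel S i (bracket v) = {ext_relations S i})"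
proof -
  note sS = lie_ideal_subspace[OF S(1)]
  obtain n b \<xi> where rc: "rel_coords (UNIV :: 'a set) S n b \<xi>" and dn: "dim (UNIV :: 'a set) = dim S + n"
    by (rule coords[OF real_vector.subspace_UNIV sS]) auto
  have n: "n = 1" using dn d by simp
  define \<beta> where "\<beta> = \<xi> 0"
  have \<beta>: "linear \<beta>" using rel_coordsD(5)[OF rc] n unfolding \<beta>_def by simp
  have S\<beta>: "S = {x. \<beta> x = 0}"
  proof -
    have "x \<in> S" if "\<beta> x = 0" for x using rel_coordsD(8)[OF rc, of x] that n unfolding \<beta>_def by simp
    then show ?thesis using rel_coordsD(6)[OF rc] n unfolding \<beta>_def by auto
  qed
  have \<beta>v: "\<beta> v \<noteq> 0" using v S\<beta> by simp
  define \<alpha> where "\<alpha> x = \<beta> x / \<beta> v" for x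
  have \<alpha>: "linear \<alpha>" unfolding \<alpha>_def
    by (rule linearI) (simp_all add: linear_add[OF \<beta>] linear_cmul[OF \<beta>] add_divide_distrib)
  have S\<alpha>: "S = {x. \<alpha> x = 0}" unfolding S\<beta> \<alpha>_def using \<beta>v by simp
  have \<alpha>v: "\<alpha> v = 1" unfolding \<alpha>_def using \<beta>v by simp
  have "\<alpha> (bracket x y) = 0" for x y
  proof -
    \<comment> \<open>Modulo S the algebra is one-dimensional, so brackets lie in S: subtract the
      components along v and use that S is an ideal.\<close>
    define x' y' where "x' = x - \<alpha> x *\<^sub>R v" and "y' = y - \<alpha> y *\<^sub>R v"
    have s: "x' \<in> S" "y' \<in> S" unfolding x'_def y'_def S\<alpha> by (simp_all add: linear_diff[OF \<alpha>] linear_cmul[OF \<alpha>] \<alpha>v)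
    have "bracket x y = \<alpha> x *\<^sub>R bracket v y' + bracket x' y"
    proof -
      have "bracket x y = \<alpha> x *\<^sub>R bracket v y + bracket x' y" unfolding x'_def by (simp add: br_diff br_scale)
      also have "bracket v y = bracket v y'" unfolding y'_def by (simp add: br_diff br_scale bracket_self)
      finally show ?thesis .
    qed
    moreover have "\<alpha> (bracket v y') = 0" "\<alpha> (bracket x' y) = 0"
      using lie_ideal_right[OF S(1) s(2)] lie_ideal_left[OF S(1) s(1)] S\<alpha> by auto
    ultimately show ?thesis by (simp add: linear_add[OF \<alpha>] linear_cmul[OF \<alpha>])
  qed
  then interpret abelian_extension bracket S \<alpha> v
    using S\<alpha> \<alpha>v S(2) by unfold_locales (simp_all add: linear_add[OF \<alpha>] linear_cmul[OF \<alpha>])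
  have "ext_kernel S i (bracket v) = {ext_relations S i} \<longleftrightarrow> surjective_on i" for i
    unfolding surjective_on_def by (rule ext_kernel_trivial_iff_surjective)
  then show ?thesis
    unfolding two_three_trivial_iff
    using H2_surjective_1 H3_surjective_2 H3_surjective_3 surjective_H2 surjective_H3 by auto
qed

end

theorem corollary4p2:
  fixes br :: "'a::real_vector \<Rightarrow> 'a \<Rightarrow> 'a"
  assumes "lie_algebra br"
    and "dim (UNIV :: 'a set) = 6"
  shows "two_three_trivial br \<longleftrightarrow>
    (indecomposable br \<and> dim (nilradical br) = 5 \<and> \<not> abelian_on br (nilradical br) \<and>
       cohomology_dim br 2 = 0 \<and> cohomology_dim br 3 = 0) \<or>
    (lie_isomorphic br (nilradical br) (\<lambda>_ _. 0) (UNIV :: (real ^ 5) set) \<and>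
       (\<forall>v. v \<notin> nilradical br \<longrightarrow>
          (\<forall>i \<in> {1, 2, 3}.
             ext_kernel (nilradical br) i (br v) = {ext_relations (nilradical br) i})))"
proof -
  interpret lie_algebra br by fact
  have "\<exists>F. finite F \<and> span F = (UNIV :: 'a set)"
  proof -
    obtain B where B: "independent B" "(UNIV :: 'a set) \<subseteq> span B" "card B = 6"
      using real_vector.basis_exists[of "UNIV :: 'a set"] assms(2) by auto
    then have "finite B" using card.infinite by fastforce
    then show ?thesis using B(2) by blast
  qed
  then interpret fd_lie_algebra br by unfold_locales
  let ?N = "nilradical br"
  have codim: "dim (UNIV :: 'a set) = dim (derived 1) + 1" "nilpotent_on br (derived 1)" "?N = derived 1"
    if H: "H2_trivial" "H3_trivial"
  proof -
    show c: "dim (UNIV :: 'a set) = dim (derived 1) + 1"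
      using H2_trivial_codim_derived[OF H(1) perfect_dim_6[OF H(2) assms(2)]] .
    \<comment> \<open>Codimension one gives dim [g, g] = 5, the bound under which triviality of the
      third cohomology implies solvability.\<close>
    then obtain m where "derived m = {0}" using H3_trivial_solvable[OF H(2)] assms(2) by auto
    then show n: "nilpotent_on br (derived 1)" by (rule solvable_derived_nilpotent)
    show "?N = derived 1" using nilradical_eq_derived[OF c _ n] assms(2) by simp
  qed
  show ?thesis
  proof
    assume t: "two_three_trivial br"
    then have H: "H2_trivial" "H3_trivial" unfolding two_three_trivial_iff by auto
    note c = codim[OF H]
    have d5: "dim ?N = 5" using c(1,3) assms(2) by simp
    note ideal = nilradical_greatest(1)
    show "(indecomposable br \<and> dim ?N = 5 \<and> \<not> abelian_on br ?N \<and> cohomology_dim br 2 = 0 \<and> cohomology_dim br 3 = 0) \<or>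
      (lie_isomorphic br ?N (\<lambda>_ _. 0) (UNIV :: (real ^ 5) set) \<and>
       (\<forall>v. v \<notin> ?N \<longrightarrow> (\<forall>i \<in> {1, 2, 3}. ext_kernel ?N i (br v) = {ext_relations ?N i})))"
    proof (cases "abelian_on br ?N")
      case False
      have "indecomposable br" by (rule codim_one_indecomposable[OF c(1,2)])
      moreover have "cohomology_dim br 2 = 0" "cohomology_dim br 3 = 0"
        using t cohomology_dim_zero_iff unfolding two_three_trivial_def by auto
      ultimately show ?thesis using d5 False by blast
    next
      case True
      have "lie_isomorphic br ?N (\<lambda>_ _. 0) (UNIV :: (real ^ 5) set)"
        using abelian_isomorphic[OF d5 lie_ideal_subspace[OF ideal] True] .
      moreover have "\<forall>i \<in> {1, 2, 3}. ext_kernel ?N i (br v) = {ext_relations ?N i}" if "v \<notin> ?N" for v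
        using abelian_codim_one_criterion[OF ideal True _ that] t d5 assms(2) by simp
      ultimately show ?thesis by blast
    qed
  next
    assume "(indecomposable br \<and> dim ?N = 5 \<and> \<not> abelian_on br ?N \<and> cohomology_dim br 2 = 0 \<and> cohomology_dim br 3 = 0) \<or>
      (lie_isomorphic br ?N (\<lambda>_ _. 0) (UNIV :: (real ^ 5) set) \<and>
       (\<forall>v. v \<notin> ?N \<longrightarrow> (\<forall>i \<in> {1, 2, 3}. ext_kernel ?N i (br v) = {ext_relations ?N i})))"
    then show "two_three_trivial br"
    proof
      assume "indecomposable br \<and> dim ?N = 5 \<and> \<not> abelian_on br ?N \<and> cohomology_dim br 2 = 0 \<and> cohomology_dim br 3 = 0"
      then show ?thesis using cohomology_dim_zero_iff unfolding two_three_trivial_def by auto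
    next
      assume a: "lie_isomorphic br ?N (\<lambda>_ _. 0) (UNIV :: (real ^ 5) set) \<and>
       (\<forall>v. v \<notin> ?N \<longrightarrow> (\<forall>i \<in> {1, 2, 3}. ext_kernel ?N i (br v) = {ext_relations ?N i}))"
      note ideal = nilradical_greatest(1)
      have ab: "abelian_on br ?N" "dim ?N = 5" using isomorphic_abelian[OF _ ideal] a by blast+
      have "?N \<noteq> UNIV" using ab(2) assms(2) by auto
      then obtain v where "v \<notin> ?N" by blast
      then show ?thesis using abelian_codim_one_criterion[OF ideal ab(1), of v] a ab(2) assms(2) by simp
    qed
  qed
qed

end
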